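(* Let $L$ be a proper pseudo-Finsler metric on $A$. Given $\mathrm{N}=\mathrm{N}^L+\dot\partial\mathcal{Z}+\mathcal{A}\otimes\mathbb{C}\in\mathrm{Sol}_L(A)$ with $\mathcal{Z}\in\mathrm{h}^2\mathcal{T}^1_0(M_A)$ and $\mathcal{A}\in\mathrm{h}^0\mathcal{T}^0_1(M_A)$, the connection $\mathrm{N}$ is a proper solution, i.e. $\mathrm{N}\in\mathrm{Sol}_L(\overline A)$, if and only if both $\mathcal{Z}$ and $\mathcal{A}$ extend smoothly to $\overline A$. Consequently, the projection $\Pi:\mathrm{Sol}_L(A)\to\mathrm{Sol}^{\mathrm{sym}}_L(A)$, $\mathrm{N}^L+\dot\partial\mathcal{Z}+\mathcal{A}\otimes\mathbb{C}\mapsto\mathrm{N}^L+\dot\partial\mathcal{Z}$, maps $\mathrm{Sol}_L(\overline A)$ onto $\mathrm{Sol}^{\mathrm{sym}}_L(A)\cap\mathrm{Sol}_L(\overline A)$.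
   Context: $M$ is a connected smooth manifold of dimension $n\ge2$ (the section containing the result works essentially in $n\ge 3$), $\pi:TM\to M$ the projection. Charts $(x^i)$ of $M$ induce charts $(x^i,y^i)$ of $TM$; $\partial_i=\partial/\partial x^i$, $\dot\partial_i=\partial/\partial y^i$; repeated indices are summed. $A\subseteq TM\setminus\mathbf{0}$ is open and conic ($\lambda v\in A$ for $v\in A$, $\lambda>0$) with $\pi(A)=M$; $A_p=A\cap T_pM$; $\overline A$ is the closure of $A$ in $TM\setminus\mathbf 0$, $\partial A=\overline A\setminus A$. An anisotropic tensor of type $(r,s)$ is a smooth section of the pullback to $A$ of $\bigotimes^rTM\otimes\bigotimes^sT^*M$, with components $T^{i_1\dots i_r}_{j_1\dots j_s}(x,y)$; the space of those with components positively $\alpha$-homogeneous in $y$ is $\mathrm{h}^\alpha\mathcal{T}^r_s(M_A)$. A subscript $\cdot i$ denotes $\dot\partial_i$; $(\dot\partial\mathcal{Z})_i^k=\mathcal{Z}^k_{\cdot i}$. $\mathbb{C}=y^a\partial_a$, $(\mathcal{A}\otimes\mathbb{C})_i^k=\mathcal{A}_iy^k$. A homogeneous nonlinear connection $\mathrm{N}$ on $A$ is given in each chart by smooth functions $\mathrm{N}_i^k(x,y)$, positively $1$-homogeneous in $y$, transforming by $\bar{\mathrm{N}}_i^k=\frac{\partial\bar x^k}{\partial x^c}\frac{\partial^2x^c}{\partial\bar x^i\partial\bar x^b}\bar y^b+\frac{\partial\bar x^k}{\partial x^c}\frac{\partial x^a}{\partial\bar x^i}\mathrm{N}_a^c$.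 Differences of two such lie in $\mathrm{h}^1\mathcal{T}^1_1(M_A)$. $\mathrm{N}$ is symmetric if $\mathrm{N}^k_{i\cdot j}=\mathrm{N}^k_{j\cdot i}$. A pseudo-Finsler metric on $A$ is a smooth positively $2$-homogeneous $L:A\to\mathbb{R}$ with $g_{ij}=\frac12L_{\cdot i\cdot j}$ non-degenerate everywhere. It is proper if (i) each $A_p$ is connected and $L>0$ on $A$, and (ii) $L$ extends smoothly to $\overline A$ with $L=0$ and $g$ non-degenerate on $\partial A$. Indices are moved with $g$; $y_i=g_{ia}y^a$. $(\mathrm{G}^L)^i=\frac14g^{ia}(2\partial_cg_{ab}-\partial_ag_{bc})y^by^c$; $(\mathrm{N}^L)_i^k=\dot\partial_i(\mathrm{G}^L)^k$ (which extends smoothly to $\overline A$ when $L$ is proper). $\mathrm{C}_{ijk}=\frac12g_{ij\cdot k}$, $\mathrm{C}_i=g^{ab}\mathrm{C}_{abi}$. $\mathrm{Lan}_{ijk}=\frac12\nabla^L_kg_{ij}$ with $\nabla^L_kg_{ij}=(\partial_k-(\mathrm{N}^L)_k^a\dot\partial_a)g_{ij}-(\mathrm{N}^L)^a_{k\cdot i}g_{aj}-(\mathrm{N}^L)^a_{k\cdot j}g_{ia}$, $\mathrm{Lan}_i=g^{ab}\mathrm{Lan}_{abi}$. $\mathrm{Sol}_L(A)$ is the set of homogeneous nonlinear connections $\mathrm{N}=\mathrm{N}^L+\mathcal{J}$, $\mathcal{J}\in\mathrm{h}^1\mathcal{T}^1_1(M_A)$, satisfying the affine equation on $A$: $$\Big\{2\mathrm{Lan}_b+(n+2)\tfrac{y_a}{L}\mathcal{J}^a_b-2\mathrm{C}_a\mathcal{J}^a_b-(\mathcal{J}^a_{b\cdot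 a}+\mathcal{J}^a_{a\cdot b})\Big\}(\delta^b_iy^j-y^b\delta^j_i)-(\mathcal{J}^j_{i\cdot a}-\mathcal{J}^j_{a\cdot i})y^a=0 ;$$ $\mathrm{Sol}^{\mathrm{sym}}_L(A)$ is the subset of symmetric ones; $\mathrm{Sol}_L(\overline A)$ (proper solutions) is the subset of those extending smoothly to $\overline A$. Every $\mathrm{N}\in\mathrm{Sol}_L(A)$ has a unique expression $\mathrm{N}^L+\dot\partial\mathcal{Z}+\mathcal{A}\otimes\mathbb{C}$ with $\mathcal{Z}\in\mathrm{h}^2\mathcal{T}^1_0(M_A)$, $\mathcal{A}\in\mathrm{h}^0\mathcal{T}^0_1(M_A)$, and then $\mathrm{N}^L+\dot\partial\mathcal{Z}\in\mathrm{Sol}^{\mathrm{sym}}_L(A)$, so $\Pi$ is well defined. *)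

theory Defs
  imports "HOL-Analysis.Analysis" "HOL-Library.Function_Algebras"
begin

section \<open>Smooth maps between normed spaces\<close>

primrec C_k_on :: "nat \<Rightarrow> 'a::real_normed_vector set \<Rightarrow> ('a \<Rightarrow> 'b::real_normed_vector) \<Rightarrow> bool" where
  "C_k_on 0 U f \<longleftrightarrow> continuous_on U f"
| "C_k_on (Suc k) U f \<longleftrightarrow>
     (\<forall>x\<in>U. f differentiable (at x)) \<and> (\<forall>v. C_k_on k U (\<lambda>x. frechet_derivative f (at x) v))"

text \<open>
  \<open>C_k_on\<close> is only meaningful on open sets. On an arbitrary set a map is smooth if it is locally
  the restriction of a smooth map defined on an open set; for open sets this is the usual notion.
\<close>

definition smooth_on :: "'a::real_normed_vector set \<Rightarrow> ('a \<Rightarrow> 'b::real_normed_vector) \<Rightarrow> bool" where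
  "smooth_on S f \<longleftrightarrow>
     (\<forall>z\<in>S. \<exists>U F. open U \<and> z \<in> U \<and> (\<forall>k. C_k_on k U F) \<and> (\<forall>w\<in>U \<inter> S. F w = f w))"


section \<open>Manifolds and their tangent bundle\<close>

text \<open>
  The manifold is the whole type \<open>'m\<close>, its dimension is \<open>CARD('n)\<close>. A chart is a pair of a domain and a
  coordinate map, whose values outside of the domain are irrelevant. The atlas need not be maximal.
\<close>

type_synonym ('m, 'n) chart = "'m set \<times> ('m \<Rightarrow> real ^ 'n)"

definition is_chart :: "('m::topological_space, 'n::finite) chart \<Rightarrow> bool" where
  "is_chart c \<longleftrightarrow> open (fst c) \<and> open (snd c ` fst c) \<and>
     (\<exists>g. homeomorphism (fst c) (snd c ` fst c) (snd c) g)"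

definition transition ::
  "('m, 'n::finite) chart \<Rightarrow> ('m, 'n) chart \<Rightarrow> real ^ 'n \<Rightarrow> real ^ 'n" where
  "transition c c' = snd c' \<circ> the_inv_into (fst c) (snd c)"

definition smooth_atlas :: "('m::topological_space, 'n::finite) chart set \<Rightarrow> bool" where
  "smooth_atlas \<Phi> \<longleftrightarrow> (\<forall>c\<in>\<Phi>. is_chart c) \<and> (\<Union>c\<in>\<Phi>. fst c) = UNIV \<and>
     (\<forall>c\<in>\<Phi>. \<forall>c'\<in>\<Phi>. smooth_on (snd c ` (fst c \<inter> fst c')) (transition c c'))"

text \<open>
  A tangent vector at \<open>p\<close> is the family of its components with respect to all charts around \<open>p\<close>,
  related by the Jacobians of the coordinate changes (and padded by \<open>0\<close> for the other charts).
\<close>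

type_synonym ('m, 'n) tvec = "'m \<times> (('m, 'n) chart \<Rightarrow> real ^ 'n)"

definition tangent_bundle :: "('m, 'n::finite) chart set \<Rightarrow> ('m, 'n) tvec set" where
  "tangent_bundle \<Phi> = {(p, v).
     (\<forall>c\<in>\<Phi>. \<forall>c'\<in>\<Phi>. p \<in> fst c \<longrightarrow> p \<in> fst c' \<longrightarrow>
        v c' = jacobian (transition c c') (at (snd c p)) *v v c) \<and>
     (\<forall>c. \<not> (c \<in> \<Phi> \<and> p \<in> fst c) \<longrightarrow> v c = 0)}"

definition slit_bundle :: "('m, 'n::finite) chart set \<Rightarrow> ('m, 'n) tvec set" where
  "slit_bundle \<Phi> = {w \<in> tangent_bundle \<Phi>. snd w \<noteq> (\<lambda>_. 0)}"

definition scale_tvec :: "real \<Rightarrow> ('m, 'n::finite) tvec \<Rightarrow> ('m, 'n) tvec" where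
  "scale_tvec r w = (fst w, \<lambda>c. r *\<^sub>R snd w c)"

definition tchart :: "('m, 'n::finite) chart \<Rightarrow> ('m, 'n) tvec \<Rightarrow> (real ^ 'n) \<times> (real ^ 'n)" where
  "tchart c w = (snd c (fst w), snd w c)"

definition timg :: "('m, 'n::finite) chart \<Rightarrow> ('m, 'n) tvec set \<Rightarrow> ((real ^ 'n) \<times> (real ^ 'n)) set" where
  "timg c D = tchart c ` {w \<in> D. fst w \<in> fst c}"

definition tangent_topology :: "('m, 'n::finite) chart set \<Rightarrow> ('m, 'n) tvec topology" where
  "tangent_topology \<Phi> =
     topology (\<lambda>U. U \<subseteq> tangent_bundle \<Phi> \<and> (\<forall>c\<in>\<Phi>. open (timg c U)))"

definition slit_closure ::
  "('m, 'n::finite) chart set \<Rightarrow> ('m, 'n) tvec set \<Rightarrow> ('m, 'n) tvec set" where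
  "slit_closure \<Phi> A = subtopology (tangent_topology \<Phi>) (slit_bundle \<Phi>) closure_of A"

definition conic_domain :: "('m, 'n::finite) chart set \<Rightarrow> ('m, 'n) tvec set \<Rightarrow> bool" where
  "conic_domain \<Phi> A \<longleftrightarrow> A \<subseteq> slit_bundle \<Phi> \<and> openin (tangent_topology \<Phi>) A \<and>
     (\<forall>w\<in>A. \<forall>r>0. scale_tvec r w \<in> A) \<and> fst ` A = UNIV"

definition coord_fun ::
  "('m, 'n::finite) chart set \<Rightarrow> ('m, 'n) chart \<Rightarrow> (('m, 'n) tvec \<Rightarrow> real)
     \<Rightarrow> (real ^ 'n) \<times> (real ^ 'n) \<Rightarrow> real" where
  "coord_fun \<Phi> c f = f \<circ> the_inv_into {w \<in> tangent_bundle \<Phi>. fst w \<in> fst c} (tchart c)"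

definition smooth_fun ::
  "('m, 'n::finite) chart set \<Rightarrow> ('m, 'n) tvec set \<Rightarrow> (('m, 'n) tvec \<Rightarrow> real) \<Rightarrow> bool" where
  "smooth_fun \<Phi> D f \<longleftrightarrow> (\<forall>c\<in>\<Phi>. smooth_on (timg c D) (coord_fun \<Phi> c f))"


section \<open>Anisotropic tensors and nonlinear connections\<close>

text \<open>
  Fields over \<open>D\<close> (used for \<open>D = A\<close> and for the closure of \<open>A\<close>) are given by their components
  \<open>T c (x, y)\<close> in each induced chart. Components are \<open>0\<close> outside of the coordinate image of \<open>D\<close>,
  so that equal fields over \<open>D\<close> are equal as functions. The components with a lower index \<open>i\<close> and
  an upper index \<open>k\<close> are accessed by \<open>T c z $ i $ k\<close>.
\<close>

type_synonym ('m, 'n, 'b) fld = "('m, 'n) chart \<Rightarrow> (real ^ 'n) \<times> (real ^ 'n) \<Rightarrow> 'b"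

definition restrict_fld ::
  "('m, 'n::finite) chart set \<Rightarrow> ('m, 'n) tvec set \<Rightarrow> ('m, 'n, 'b::zero) fld \<Rightarrow> ('m, 'n, 'b) fld" where
  "restrict_fld \<Phi> D T = (\<lambda>c z. if c \<in> \<Phi> \<and> z \<in> timg c D then T c z else 0)"

definition h_smooth ::
  "('m, 'n::finite) chart set \<Rightarrow> ('m, 'n) tvec set \<Rightarrow> real \<Rightarrow> ('m, 'n, 'b::real_normed_vector) fld \<Rightarrow> bool" where
  "h_smooth \<Phi> D \<alpha> T \<longleftrightarrow> restrict_fld \<Phi> D T = T \<and>
     (\<forall>c\<in>\<Phi>. smooth_on (timg c D) (T c) \<and>
        (\<forall>(x, y)\<in>timg c D. \<forall>r>0. T c (x, r *\<^sub>R y) = (r powr \<alpha>) *\<^sub>R T c (x, y)))"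

definition tensors_1_0 ::
  "('m, 'n::finite) chart set \<Rightarrow> ('m, 'n) tvec set \<Rightarrow> real \<Rightarrow> ('m, 'n, real ^ 'n) fld set" where
  "tensors_1_0 \<Phi> D \<alpha> = {T. h_smooth \<Phi> D \<alpha> T \<and>
     (\<forall>c\<in>\<Phi>. \<forall>c'\<in>\<Phi>. \<forall>w\<in>D. fst w \<in> fst c \<longrightarrow> fst w \<in> fst c' \<longrightarrow>
       (let B = jacobian (transition c c') (at (snd c (fst w)))
        in \<forall>k. T c' (tchart c' w) $ k = (\<Sum>a\<in>UNIV. B $ k $ a * T c (tchart c w) $ a)))}"

definition tensors_0_1 ::
  "('m, 'n::finite) chart set \<Rightarrow> ('m, 'n) tvec set \<Rightarrow> real \<Rightarrow> ('m, 'n, real ^ 'n) fld set" where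
  "tensors_0_1 \<Phi> D \<alpha> = {T. h_smooth \<Phi> D \<alpha> T \<and>
     (\<forall>c\<in>\<Phi>. \<forall>c'\<in>\<Phi>. \<forall>w\<in>D. fst w \<in> fst c \<longrightarrow> fst w \<in> fst c' \<longrightarrow>
       (let E = jacobian (transition c' c) (at (snd c' (fst w)))
        in \<forall>i. T c' (tchart c' w) $ i = (\<Sum>a\<in>UNIV. E $ a $ i * T c (tchart c w) $ a)))}"

definition tensors_1_1 ::
  "('m, 'n::finite) chart set \<Rightarrow> ('m, 'n) tvec set \<Rightarrow> real \<Rightarrow> ('m, 'n, real ^ 'n ^ 'n) fld set" where
  "tensors_1_1 \<Phi> D \<alpha> = {T. h_smooth \<Phi> D \<alpha> T \<and>
     (\<forall>c\<in>\<Phi>. \<forall>c'\<in>\<Phi>. \<forall>w\<in>D. fst w \<in> fst c \<longrightarrow> fst w \<in> fst c' \<longrightarrow>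
       (let B = jacobian (transition c c') (at (snd c (fst w)));
            E = jacobian (transition c' c) (at (snd c' (fst w)))
        in \<forall>i k. T c' (tchart c' w) $ i $ k =
             (\<Sum>d\<in>UNIV. \<Sum>a\<in>UNIV. B $ k $ d * E $ a $ i * T c (tchart c w) $ a $ d)))}"

definition connections ::
  "('m, 'n::finite) chart set \<Rightarrow> ('m, 'n) tvec set \<Rightarrow> ('m, 'n, real ^ 'n ^ 'n) fld set" where
  "connections \<Phi> D = {N. h_smooth \<Phi> D 1 N \<and>
     (\<forall>c\<in>\<Phi>. \<forall>c'\<in>\<Phi>. \<forall>w\<in>D. fst w \<in> fst c \<longrightarrow> fst w \<in> fst c' \<longrightarrow>
       (let x' = snd c' (fst w); y' = snd w c';
            B = jacobian (transition c c') (at (snd c (fst w)));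
            E = jacobian (transition c' c) (at x');
            H = (\<lambda>d i b. frechet_derivative
                   (\<lambda>u. jacobian (transition c' c) (at u) $ d $ b) (at x') (axis i 1))
        in \<forall>i k. N c' (tchart c' w) $ i $ k =
             (\<Sum>d\<in>UNIV. \<Sum>b\<in>UNIV. B $ k $ d * H d i b * y' $ b) +
             (\<Sum>d\<in>UNIV. \<Sum>a\<in>UNIV. B $ k $ d * E $ a $ i * N c (tchart c w) $ a $ d)))}"

text \<open>
  \<open>T\<close>, a field over \<open>D\<close>, is the restriction of a field over \<open>D'\<close> from the class \<open>\<T>\<close>
  (that is, \<open>\<T>\<close> is one of the four sets of fields above, taken over \<open>D'\<close>).
\<close>

definition extends_in ::
  "('m, 'n::finite) chart set \<Rightarrow> ('m, 'n) tvec set \<Rightarrow> ('m, 'n, 'b::zero) fld set \<Rightarrow> ('m, 'n, 'b) fld \<Rightarrow> bool" where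
  "extends_in \<Phi> D \<T> T \<longleftrightarrow> (\<exists>T'\<in>\<T>. restrict_fld \<Phi> D T' = T)"


section \<open>Coordinate expressions of Finsler quantities\<close>

text \<open>
  Throughout, \<open>F\<close> is the coordinate expression of the metric function and \<open>z = (x, y)\<close>.
  In \<open>nl F i k\<close> the first index is the lower one.
\<close>

definition dx :: "'n::finite \<Rightarrow> ((real ^ 'n) \<times> (real ^ 'n) \<Rightarrow> real) \<Rightarrow> (real ^ 'n) \<times> (real ^ 'n) \<Rightarrow> real" where
  "dx i f z = frechet_derivative f (at z) (axis i 1, 0)"

definition dy :: "'n::finite \<Rightarrow> ((real ^ 'n) \<times> (real ^ 'n) \<Rightarrow> real) \<Rightarrow> (real ^ 'n) \<times> (real ^ 'n) \<Rightarrow> real" where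
  "dy i f z = frechet_derivative f (at z) (0, axis i 1)"

definition fund :: "((real ^ 'n::finite) \<times> (real ^ 'n) \<Rightarrow> real) \<Rightarrow> (real ^ 'n) \<times> (real ^ 'n) \<Rightarrow> real ^ 'n ^ 'n" where
  "fund F z = (\<chi> i j. 1/2 * dy j (dy i F) z)"

definition cofund :: "((real ^ 'n::finite) \<times> (real ^ 'n) \<Rightarrow> real) \<Rightarrow> (real ^ 'n) \<times> (real ^ 'n) \<Rightarrow> real ^ 'n ^ 'n" where
  "cofund F z = matrix_inv (fund F z)"

definition y_low :: "((real ^ 'n::finite) \<times> (real ^ 'n) \<Rightarrow> real) \<Rightarrow> 'n \<Rightarrow> (real ^ 'n) \<times> (real ^ 'n) \<Rightarrow> real" where
  "y_low F i z = (\<Sum>a\<in>UNIV. fund F z $ i $ a * snd z $ a)"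

definition spray :: "((real ^ 'n::finite) \<times> (real ^ 'n) \<Rightarrow> real) \<Rightarrow> 'n \<Rightarrow> (real ^ 'n) \<times> (real ^ 'n) \<Rightarrow> real" where
  "spray F i z = 1/4 * (\<Sum>a\<in>UNIV. \<Sum>b\<in>UNIV. \<Sum>c\<in>UNIV. cofund F z $ i $ a *
     (2 * dx c (\<lambda>w. fund F w $ a $ b) z - dx a (\<lambda>w. fund F w $ b $ c) z) * snd z $ b * snd z $ c)"

definition nl :: "((real ^ 'n::finite) \<times> (real ^ 'n) \<Rightarrow> real) \<Rightarrow> 'n \<Rightarrow> 'n \<Rightarrow> (real ^ 'n) \<times> (real ^ 'n) \<Rightarrow> real" where
  "nl F i k z = dy i (spray F k) z"

definition cartan :: "((real ^ 'n::finite) \<times> (real ^ 'n) \<Rightarrow> real) \<Rightarrow> 'n \<Rightarrow> 'n \<Rightarrow> 'n \<Rightarrow> (real ^ 'n) \<times> (real ^ 'n) \<Rightarrow> real" where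
  "cartan F i j k z = 1/2 * dy k (\<lambda>w. fund F w $ i $ j) z"

definition mean_cartan :: "((real ^ 'n::finite) \<times> (real ^ 'n) \<Rightarrow> real) \<Rightarrow> 'n \<Rightarrow> (real ^ 'n) \<times> (real ^ 'n) \<Rightarrow> real" where
  "mean_cartan F i z = (\<Sum>a\<in>UNIV. \<Sum>b\<in>UNIV. cofund F z $ a $ b * cartan F a b i z)"

definition landsberg :: "((real ^ 'n::finite) \<times> (real ^ 'n) \<Rightarrow> real) \<Rightarrow> 'n \<Rightarrow> 'n \<Rightarrow> 'n \<Rightarrow> (real ^ 'n) \<times> (real ^ 'n) \<Rightarrow> real" where
  "landsberg F i j k z = 1/2 *
     (dx k (\<lambda>w. fund F w $ i $ j) z - (\<Sum>a\<in>UNIV. nl F k a z * dy a (\<lambda>w. fund F w $ i $ j) z)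
      - (\<Sum>a\<in>UNIV. dy i (nl F k a) z * fund F z $ a $ j)
      - (\<Sum>a\<in>UNIV. dy j (nl F k a) z * fund F z $ i $ a))"

definition mean_landsberg :: "((real ^ 'n::finite) \<times> (real ^ 'n) \<Rightarrow> real) \<Rightarrow> 'n \<Rightarrow> (real ^ 'n) \<times> (real ^ 'n) \<Rightarrow> real" where
  "mean_landsberg F i z = (\<Sum>a\<in>UNIV. \<Sum>b\<in>UNIV. cofund F z $ a $ b * landsberg F a b i z)"

definition affine_bracket ::
  "((real ^ 'n::finite) \<times> (real ^ 'n) \<Rightarrow> real) \<Rightarrow> ((real ^ 'n) \<times> (real ^ 'n) \<Rightarrow> real ^ 'n ^ 'n)
     \<Rightarrow> 'n \<Rightarrow> (real ^ 'n) \<times> (real ^ 'n) \<Rightarrow> real" where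
  "affine_bracket F J b z =
     2 * mean_landsberg F b z
     + (real CARD('n) + 2) * (\<Sum>a\<in>UNIV. y_low F a z / F z * J z $ b $ a)
     - 2 * (\<Sum>a\<in>UNIV. mean_cartan F a z * J z $ b $ a)
     - (\<Sum>a\<in>UNIV. dy a (\<lambda>w. J w $ b $ a) z + dy b (\<lambda>w. J w $ a $ a) z)"

definition affine_equation ::
  "((real ^ 'n::finite) \<times> (real ^ 'n) \<Rightarrow> real) \<Rightarrow> ((real ^ 'n) \<times> (real ^ 'n) \<Rightarrow> real ^ 'n ^ 'n)
     \<Rightarrow> (real ^ 'n) \<times> (real ^ 'n) \<Rightarrow> bool" where
  "affine_equation F J z \<longleftrightarrow> (\<forall>i j.
     (\<Sum>b\<in>UNIV. affine_bracket F J b z * (of_bool (b = i) * snd z $ j - snd z $ b * of_bool (j = i)))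
     - (\<Sum>a\<in>UNIV. (dy a (\<lambda>w. J w $ i $ j) z - dy i (\<lambda>w. J w $ a $ j) z) * snd z $ a) = 0)"


section \<open>Proper pseudo-Finsler metrics and the solution spaces\<close>

definition pseudo_finsler ::
  "('m, 'n::finite) chart set \<Rightarrow> ('m, 'n) tvec set \<Rightarrow> (('m, 'n) tvec \<Rightarrow> real) \<Rightarrow> bool" where
  "pseudo_finsler \<Phi> A L \<longleftrightarrow> smooth_fun \<Phi> A L \<and>
     (\<forall>w\<in>A. \<forall>r>0. L (scale_tvec r w) = r\<^sup>2 * L w) \<and>
     (\<forall>c\<in>\<Phi>. \<forall>z\<in>timg c A. invertible (fund (coord_fun \<Phi> c L) z))"

text \<open>
  At a boundary point the fundamental tensor of the extension \<open>L'\<close> is computed from a local smooth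
  extension \<open>F\<close> of its coordinate expression; as \<open>A\<close> is open and dense in its closure, it does not
  depend on the choice of \<open>F\<close>.
\<close>

definition proper_pseudo_finsler ::
  "('m, 'n::finite) chart set \<Rightarrow> ('m, 'n) tvec set \<Rightarrow> (('m, 'n) tvec \<Rightarrow> real) \<Rightarrow> bool" where
  "proper_pseudo_finsler \<Phi> A L \<longleftrightarrow> pseudo_finsler \<Phi> A L \<and>
     (\<forall>p. connectedin (tangent_topology \<Phi>) {w \<in> A. fst w = p}) \<and> (\<forall>w\<in>A. L w > 0) \<and>
     (\<exists>L'. smooth_fun \<Phi> (slit_closure \<Phi> A) L' \<and> (\<forall>w\<in>A. L' w = L w) \<and>
        (\<forall>w\<in>slit_closure \<Phi> A - A. L' w = 0) \<and>
        (\<forall>c\<in>\<Phi>. \<forall>z\<in>timg c (slit_closure \<Phi> A - A).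
           \<exists>U F. open U \<and> z \<in> U \<and> (\<forall>k. C_k_on k U F) \<and>
             (\<forall>u\<in>U \<inter> timg c (slit_closure \<Phi> A). F u = coord_fun \<Phi> c L' u) \<and>
             invertible (fund F z)))"

definition N_metric ::
  "('m, 'n::finite) chart set \<Rightarrow> ('m, 'n) tvec set \<Rightarrow> (('m, 'n) tvec \<Rightarrow> real)
     \<Rightarrow> ('m, 'n, real ^ 'n ^ 'n) fld" where
  "N_metric \<Phi> A L = restrict_fld \<Phi> A (\<lambda>c z. \<chi> i k. nl (coord_fun \<Phi> c L) i k z)"

definition vdiff ::
  "('m, 'n::finite) chart set \<Rightarrow> ('m, 'n) tvec set \<Rightarrow> ('m, 'n, real ^ 'n) fld
     \<Rightarrow> ('m, 'n, real ^ 'n ^ 'n) fld" where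
  "vdiff \<Phi> A Z = restrict_fld \<Phi> A (\<lambda>c z. \<chi> i k. dy i (\<lambda>w. Z c w $ k) z)"

definition tensor_C :: "('m, 'n::finite, real ^ 'n) fld \<Rightarrow> ('m, 'n, real ^ 'n ^ 'n) fld" where
  "tensor_C \<A> = (\<lambda>c z. \<chi> i k. \<A> c z $ i * snd z $ k)"

definition Sol ::
  "('m, 'n::finite) chart set \<Rightarrow> ('m, 'n) tvec set \<Rightarrow> (('m, 'n) tvec \<Rightarrow> real)
     \<Rightarrow> ('m, 'n, real ^ 'n ^ 'n) fld set" where
  "Sol \<Phi> A L = {N \<in> connections \<Phi> A. \<exists>J \<in> tensors_1_1 \<Phi> A 1. N = N_metric \<Phi> A L + J \<and>
     (\<forall>c\<in>\<Phi>. \<forall>z\<in>timg c A. affine_equation (coord_fun \<Phi> c L) (J c) z)}"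

definition Sol_sym ::
  "('m, 'n::finite) chart set \<Rightarrow> ('m, 'n) tvec set \<Rightarrow> (('m, 'n) tvec \<Rightarrow> real)
     \<Rightarrow> ('m, 'n, real ^ 'n ^ 'n) fld set" where
  "Sol_sym \<Phi> A L = {N \<in> Sol \<Phi> A L. \<forall>c\<in>\<Phi>. \<forall>z\<in>timg c A. \<forall>i j k.
     dy j (\<lambda>w. N c w $ i $ k) z = dy i (\<lambda>w. N c w $ j $ k) z}"

definition Sol_proper ::
  "('m, 'n::finite) chart set \<Rightarrow> ('m, 'n) tvec set \<Rightarrow> (('m, 'n) tvec \<Rightarrow> real)
     \<Rightarrow> ('m, 'n, real ^ 'n ^ 'n) fld set" where
  "Sol_proper \<Phi> A L =
     {N \<in> Sol \<Phi> A L. extends_in \<Phi> A (connections \<Phi> (slit_closure \<Phi> A)) N}"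

text \<open>The description is proper on \<open>Sol \<Phi> A L\<close>: the decomposition of a solution is unique.\<close>

definition sym_proj ::
  "('m, 'n::finite) chart set \<Rightarrow> ('m, 'n) tvec set \<Rightarrow> (('m, 'n) tvec \<Rightarrow> real)
     \<Rightarrow> ('m, 'n, real ^ 'n ^ 'n) fld \<Rightarrow> ('m, 'n, real ^ 'n ^ 'n) fld" where
  "sym_proj \<Phi> A L N = (THE S. \<exists>Z\<in>tensors_1_0 \<Phi> A 2. \<exists>\<A>\<in>tensors_0_1 \<Phi> A 0.
     N = N_metric \<Phi> A L + vdiff \<Phi> A Z + tensor_C \<A> \<and> S = N_metric \<Phi> A L + vdiff \<Phi> A Z)"

end

theory Submission
  imports Defs
begin

text \<open>
  Write \<open>n\<close> for the dimension and \<open>J = N - N\<^sup>L\<close>. The point is that the parts of a decomposition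
  \<open>J = \<partial>Z + A \<otimes> C\<close> are differential polynomials in \<open>J\<close> and \<open>y\<close>, up to a division by \<open>|y|\<^sup>2\<close>. As \<open>Z\<close> is
  homogeneous of degree two, half of the contraction of \<open>J\<close> with \<open>y\<close> is \<open>W = Z + f y / 2\<close> with
  \<open>f = A\<^sub>ay\<^sup>a\<close>. The trace of \<open>J\<close> is \<open>div Z + f\<close> and, by Euler's identity, the vertical divergence of
  \<open>W\<close> is \<open>div Z + (n + 1) f / 2\<close>. So \<open>f\<close> is \<open>2 / (n - 1)\<close> times the difference of the
  two, which uses \<open>n \<ge> 2\<close>; then \<open>Z = W - f y / 2\<close>, and \<open>A\<close> is read off from \<open>J - \<partial>Z = A \<otimes> C\<close> because
  \<open>y \<noteq> 0\<close> (\<open>decomposition_recovers\<close>). Hence the decomposition is unique and, since these formulas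
  make sense for any local smooth extension of \<open>J\<close> to a boundary point, \<open>Z\<close> and \<open>A\<close> extend
  smoothly wherever \<open>J\<close> does (\<open>extendable_decomposition\<close>). The metric connection extends because the
  fundamental tensor stays invertible at the boundary (\<open>N_metric_extendable\<close>).

  What is extended chart by chart is a field over the closure again: its values at boundary points are
  limits, and transformation laws and homogeneity pass to the limit (\<open>extendable_imp_extends_in\<close>).

  For the projection, decompositions must be shown to exist. By homogeneity the affine equation says
  that \<open>2 J - 2 \<partial>W\<close> equals \<open>B \<otimes> C - (B\<^sub>ay\<^sup>a) id\<close> with the bracket \<open>B\<close>, which is turned into a
  decomposition by correcting \<open>W\<close> by a multiple of \<open>y\<close> (\<open>affine_equation_imp_decomposition\<close>). The
  equation does not see summands \<open>A \<otimes> C\<close> (\<open>affine_equation_radial_invariance\<close>), so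
  \<open>N\<^sup>L + \<partial>Z\<close> is a solution, symmetric because second derivatives commute. Conversely a
  symmetric solution is of the form \<open>N\<^sup>L + \<partial>Z\<close> and is fixed by the projection.
\<close>

section \<open>Smooth functions on open sets\<close>

definition C_inf_on :: "'a::real_normed_vector set \<Rightarrow> ('a \<Rightarrow> 'b::real_normed_vector) \<Rightarrow> bool" where
  "C_inf_on U f \<longleftrightarrow> (\<forall>k. C_k_on k U f)"

lemma frechet_derivative_cong_open:
  assumes "open U" "x \<in> U" "\<And>z. z \<in> U \<Longrightarrow> f z = g z"
  shows "frechet_derivative f (at x) = frechet_derivative g (at x)"
proof -
  have "(f has_derivative D) (at x) \<longleftrightarrow> (g has_derivative D) (at x)" for D
    using assms has_derivative_transform_within_open[of f D x UNIV U g]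
      has_derivative_transform_within_open[of g D x UNIV U f] by auto
  then show ?thesis
    unfolding frechet_derivative_def by simp
qed

lemma differentiable_cong_open:
  assumes "open U" "x \<in> U" "\<And>z. z \<in> U \<Longrightarrow> f z = g z" "f differentiable (at x)"
  shows "g differentiable (at x)"
  using assms has_derivative_transform_within_open[of f _ x UNIV U g]
  unfolding differentiable_def by blast

lemma C_k_on_cong:
  assumes "open U" "\<And>z. z \<in> U \<Longrightarrow> f z = g z" "C_k_on k U f"
  shows "C_k_on k U g"
  using assms(2,3)
proof (induction k arbitrary: f g)
  case 0
  then show ?case using continuous_on_cong[of U U f g] by simp
next
  case (Suc k)
  have "C_k_on k U (\<lambda>x. frechet_derivative g (at x) v)" for v
  proof (rule Suc.IH)
    show "C_k_on k U (\<lambda>x. frechet_derivative f (at x) v)"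
      using Suc.prems(2) by simp
    fix z assume "z \<in> U"
    then show "frechet_derivative f (at z) v = frechet_derivative g (at z) v"
      using frechet_derivative_cong_open[OF assms(1)] Suc.prems(1) by metis
  qed
  moreover have "g differentiable (at x)" if "x \<in> U" for x
    using differentiable_cong_open[OF assms(1) that] Suc.prems that by auto
  ultimately show ?case by simp
qed

lemma C_k_on_subset: "C_k_on k U f \<Longrightarrow> V \<subseteq> U \<Longrightarrow> C_k_on k V f"
  by (induction k arbitrary: f) (auto intro: continuous_on_subset)

lemma C_k_on_Suc_imp: "C_k_on (Suc k) U f \<Longrightarrow> C_k_on k U f"
proof (induction k arbitrary: f)
  case 0
  then show ?case
    by (auto intro!: continuous_at_imp_continuous_on differentiable_imp_continuous_within)
next
  case (Suc k)
  then show ?case by (auto simp del: C_k_on.simps(1) intro: Suc.IH)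
qed

lemma C_k_on_local:
  assumes "\<And>z. z \<in> S \<Longrightarrow> \<exists>U. open U \<and> z \<in> U \<and> C_k_on k U f"
  shows "C_k_on k S f"
  using assms
proof (induction k arbitrary: f)
  case 0
  then show ?case
    by (metis C_k_on.simps(1) at_within_open continuous_at_imp_continuous_on continuous_on_eq_continuous_within)
next
  case (Suc k)
  have "C_k_on k S (\<lambda>x. frechet_derivative f (at x) v)" for v
  proof (rule Suc.IH)
    fix z assume "z \<in> S"
    then show "\<exists>U. open U \<and> z \<in> U \<and> C_k_on k U (\<lambda>x. frechet_derivative f (at x) v)"
      using Suc.prems by (metis C_k_on.simps(2))
  qed
  moreover have "f differentiable (at x)" if "x \<in> S" for x
    using Suc.prems[OF that] by auto
  ultimately show ?case by simp
qed

lemma C_inf_on_cong: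
  "open U \<Longrightarrow> (\<And>z. z \<in> U \<Longrightarrow> f z = g z) \<Longrightarrow> C_inf_on U f \<Longrightarrow> C_inf_on U g"
  unfolding C_inf_on_def by (metis C_k_on_cong)

lemma C_inf_on_subset: "C_inf_on U f \<Longrightarrow> V \<subseteq> U \<Longrightarrow> C_inf_on V f"
  unfolding C_inf_on_def by (metis C_k_on_subset)

lemma C_inf_on_differentiable: "C_inf_on U f \<Longrightarrow> x \<in> U \<Longrightarrow> f differentiable (at x)"
  unfolding C_inf_on_def by (metis C_k_on.simps(2))

lemma C_inf_on_continuous: "C_inf_on U f \<Longrightarrow> x \<in> U \<Longrightarrow> isCont f x"
  using C_inf_on_differentiable differentiable_imp_continuous_within by blast

lemma C_inf_on_derivative: "C_inf_on U f \<Longrightarrow> C_inf_on U (\<lambda>x. frechet_derivative f (at x) v)"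
  unfolding C_inf_on_def by (metis C_k_on.simps(2))

lemma C_k_on_const: "C_k_on k U (\<lambda>x. c)"
  by (induction k arbitrary: c) auto

lemma C_inf_on_const: "C_inf_on U (\<lambda>x. c)"
  by (simp add: C_inf_on_def C_k_on_const)

lemma C_inf_on_bounded_linear:
  assumes "bounded_linear h"
  shows "C_inf_on U h"
proof -
  have "C_k_on k U h" for k
  proof (cases k)
    case 0
    then show ?thesis using assms by (simp add: linear_continuous_on)
  next
    case (Suc m)
    have "frechet_derivative h (at x) = h" for x
      using frechet_derivative_at[OF bounded_linear_imp_has_derivative[OF assms]] by metis
    then show ?thesis
      using assms by (simp add: Suc C_k_on_const bounded_linear_imp_differentiable)
  qed
  then show ?thesis by (simp add: C_inf_on_def)
qed

lemma C_k_on_compose_linear: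
  assumes "bounded_linear h" "open U" "C_k_on k U f"
  shows "C_k_on k U (\<lambda>x. h (f x))"
  using assms(3)
proof (induction k arbitrary: f)
  case 0
  then show ?case using assms(1) bounded_linear.continuous_on by auto
next
  case (Suc k)
  have der: "((\<lambda>x. h (f x)) has_derivative (\<lambda>v. h (frechet_derivative f (at x) v))) (at x)"
    if "x \<in> U" for x
    using Suc.prems that by (auto simp: frechet_derivative_works intro: bounded_linear.has_derivative[OF assms(1)])
  have "C_k_on k U (\<lambda>x. frechet_derivative (\<lambda>x. h (f x)) (at x) v)" for v
  proof (rule C_k_on_cong[OF assms(2)])
    show "C_k_on k U (\<lambda>x. h (frechet_derivative f (at x) v))"
      using Suc by simp
    show "h (frechet_derivative f (at z) v) = frechet_derivative (\<lambda>x. h (f x)) (at z) v" if "z \<in> U" for z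
      using frechet_derivative_at[OF der[OF that]] by metis
  qed
  then show ?case using der unfolding C_k_on.simps differentiable_def by blast
qed

lemma C_inf_on_compose_linear:
  "bounded_linear h \<Longrightarrow> open U \<Longrightarrow> C_inf_on U f \<Longrightarrow> C_inf_on U (\<lambda>x. h (f x))"
  by (simp add: C_inf_on_def C_k_on_compose_linear)

lemma C_k_on_add:
  assumes "open U" "C_k_on k U f" "C_k_on k U g"
  shows "C_k_on k U (\<lambda>x. f x + g x)"
  using assms(2,3)
proof (induction k arbitrary: f g)
  case 0
  then show ?case by (auto intro: continuous_intros)
next
  case (Suc k)
  have der: "((\<lambda>x. f x + g x) has_derivative
      (\<lambda>v. frechet_derivative f (at x) v + frechet_derivative g (at x) v)) (at x)"
    if "x \<in> U" for x
    using Suc.prems that by (auto simp: frechet_derivative_works intro: has_derivative_add)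
  have "C_k_on k U (\<lambda>x. frechet_derivative (\<lambda>x. f x + g x) (at x) v)" for v
  proof (rule C_k_on_cong[OF assms(1)])
    show "C_k_on k U (\<lambda>x. frechet_derivative f (at x) v + frechet_derivative g (at x) v)"
      using Suc by simp
    show "frechet_derivative f (at z) v + frechet_derivative g (at z) v
        = frechet_derivative (\<lambda>x. f x + g x) (at z) v" if "z \<in> U" for z
      using frechet_derivative_at[OF der[OF that]] by metis
  qed
  then show ?case using der unfolding C_k_on.simps differentiable_def by blast
qed

lemma C_inf_on_add:
  "open U \<Longrightarrow> C_inf_on U f \<Longrightarrow> C_inf_on U g \<Longrightarrow> C_inf_on U (\<lambda>x. f x + g x)"
  by (simp add: C_inf_on_def C_k_on_add)

lemma C_k_on_bilinear:
  assumes "bounded_bilinear p" "open U" "C_k_on k U f" "C_k_on k U g"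
  shows "C_k_on k U (\<lambda>x. p (f x) (g x))"
  using assms(3,4)
proof (induction k arbitrary: f g)
  case 0
  then show ?case using assms(1) bounded_bilinear.continuous_on by auto
next
  case (Suc k)
  have der: "((\<lambda>x. p (f x) (g x)) has_derivative
      (\<lambda>v. p (f x) (frechet_derivative g (at x) v) + p (frechet_derivative f (at x) v) (g x))) (at x)"
    if "x \<in> U" for x
    using Suc.prems that by (auto simp: frechet_derivative_works intro: bounded_bilinear.FDERIV[OF assms(1)])
  have "C_k_on k U (\<lambda>x. frechet_derivative (\<lambda>x. p (f x) (g x)) (at x) v)" for v
  proof (rule C_k_on_cong[OF assms(2)])
    show "C_k_on k U (\<lambda>x. p (f x) (frechet_derivative g (at x) v) + p (frechet_derivative f (at x) v) (g x))"
      using Suc.prems by (intro C_k_on_add[OF assms(2)] Suc.IH) (auto dest!: C_k_on_Suc_imp simp del: C_k_on.simps(1) simp: C_k_on_Suc_imp)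
    show "p (f z) (frechet_derivative g (at z) v) + p (frechet_derivative f (at z) v) (g z)
        = frechet_derivative (\<lambda>x. p (f x) (g x)) (at z) v" if "z \<in> U" for z
      using frechet_derivative_at[OF der[OF that]] by metis
  qed
  then show ?case using der unfolding C_k_on.simps differentiable_def by blast
qed

lemma C_inf_on_bilinear:
  "bounded_bilinear p \<Longrightarrow> open U \<Longrightarrow> C_inf_on U f \<Longrightarrow> C_inf_on U g \<Longrightarrow> C_inf_on U (\<lambda>x. p (f x) (g x))"
  by (simp add: C_inf_on_def C_k_on_bilinear)

lemma C_inf_on_mult:
  fixes f g :: "_ \<Rightarrow> real"
  shows "open U \<Longrightarrow> C_inf_on U f \<Longrightarrow> C_inf_on U g \<Longrightarrow> C_inf_on U (\<lambda>x. f x * g x)"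
  by (rule C_inf_on_bilinear[OF bounded_bilinear_mult])

lemma C_k_on_inverse:
  fixes f :: "'a::real_normed_vector \<Rightarrow> real"
  assumes "open U" "C_k_on k U f" "\<And>x. x \<in> U \<Longrightarrow> f x \<noteq> 0"
  shows "C_k_on k U (\<lambda>x. inverse (f x))"
  using assms(2)
proof (induction k)
  case 0
  then show ?case using assms(3) by (auto intro: continuous_intros)
next
  case (Suc k)
  have der: "((\<lambda>x. inverse (f x)) has_derivative
      (\<lambda>v. - (inverse (f x) * frechet_derivative f (at x) v * inverse (f x)))) (at x)"
    if "x \<in> U" for x
    using Suc.prems that assms(3) by (auto simp: frechet_derivative_works intro: has_derivative_inverse)
  have "C_k_on k U (\<lambda>x. frechet_derivative (\<lambda>x. inverse (f x)) (at x) v)" for v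
  proof (rule C_k_on_cong[OF assms(1)])
    have "C_k_on k U (\<lambda>x. inverse (f x))"
      using Suc C_k_on_Suc_imp by blast
    then have "C_k_on k U (\<lambda>x. inverse (f x) * frechet_derivative f (at x) v * inverse (f x))"
      using Suc.prems by (intro C_k_on_bilinear[OF bounded_bilinear_mult assms(1)]) auto
    then show "C_k_on k U (\<lambda>x. - (inverse (f x) * frechet_derivative f (at x) v * inverse (f x)))"
      by (rule C_k_on_compose_linear[OF bounded_linear_minus[OF bounded_linear_ident] assms(1)])
    show "- (inverse (f z) * frechet_derivative f (at z) v * inverse (f z))
        = frechet_derivative (\<lambda>x. inverse (f x)) (at z) v" if "z \<in> U" for z
      using frechet_derivative_at[OF der[OF that]] by metis
  qed
  then show ?case using der unfolding C_k_on.simps differentiable_def by blast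
qed

lemma C_inf_on_inverse:
  fixes f :: "'a::real_normed_vector \<Rightarrow> real"
  shows "open U \<Longrightarrow> C_inf_on U f \<Longrightarrow> (\<And>x. x \<in> U \<Longrightarrow> f x \<noteq> 0) \<Longrightarrow> C_inf_on U (\<lambda>x. inverse (f x))"
  by (simp add: C_inf_on_def C_k_on_inverse)

lemma C_inf_on_sum:
  "open U \<Longrightarrow> (\<And>i. i \<in> I \<Longrightarrow> C_inf_on U (f i)) \<Longrightarrow> C_inf_on U (\<lambda>x. \<Sum>i\<in>I. f i x)"
  by (induction I rule: infinite_finite_induct) (auto simp: C_inf_on_const C_inf_on_add)

lemma C_inf_on_prod:
  fixes f :: "_ \<Rightarrow> _ \<Rightarrow> real"
  shows "open U \<Longrightarrow> (\<And>i. i \<in> I \<Longrightarrow> C_inf_on U (f i)) \<Longrightarrow> C_inf_on U (\<lambda>x. \<Prod>i\<in>I. f i x)"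
  by (induction I rule: infinite_finite_induct) (auto simp: C_inf_on_const C_inf_on_mult)

lemma C_inf_on_vec:
  fixes f :: "'a::real_normed_vector \<Rightarrow> 'b::real_normed_vector ^ 'n::finite"
  assumes "open U" "\<And>i. C_inf_on U (\<lambda>x. f x $ i)"
  shows "C_inf_on U f"
proof -
  have lin: "bounded_linear (\<lambda>b :: 'b. axis i b :: 'b ^ 'n)" for i
  proof (rule bounded_linear_intro[where K=1])
    show "norm (axis i x :: 'b ^ 'n) \<le> norm x * 1" for x :: 'b
    proof -
      have "norm (axis i x :: 'b ^ 'n) \<le> (\<Sum>j\<in>UNIV. norm ((axis i x :: 'b ^ 'n) $ j))"
        unfolding norm_vec_def by (rule L2_set_le_sum) simp
      also have "\<dots> = (\<Sum>j\<in>UNIV. if j = i then norm x else 0)"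
        by (intro sum.cong) (auto simp: axis_def)
      finally show ?thesis by simp
    qed
  qed (auto simp: axis_def vec_eq_iff)
  have "f x = (\<Sum>i\<in>UNIV. axis i (f x $ i))" for x
    by (auto simp: vec_eq_iff axis_def if_distrib cong: if_cong)
  moreover have "C_inf_on U (\<lambda>x. \<Sum>i\<in>UNIV. axis i (f x $ i))"
    using assms by (intro C_inf_on_sum C_inf_on_compose_linear[OF lin]) auto
  ultimately show ?thesis by simp
qed

lemma C_inf_on_vec_nth:
  "open U \<Longrightarrow> C_inf_on U f \<Longrightarrow> C_inf_on U (\<lambda>x. f x $ i)"
  by (rule C_inf_on_compose_linear[OF bounded_linear_vec_nth])

lemma C_inf_on_det:
  fixes G :: "'a::real_normed_vector \<Rightarrow> real ^ 'n ^ 'n::finite"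
  assumes "open U" "\<And>i j. C_inf_on U (\<lambda>z. G z $ i $ j)"
  shows "C_inf_on U (\<lambda>z. det (G z))"
  unfolding det_def using assms
  by (intro C_inf_on_sum C_inf_on_mult C_inf_on_prod C_inf_on_const) auto

text \<open>
  The columns of the inverse solve linear systems with unit vectors on the right-hand side. This
  exhibits the entries of the inverse as quotients of determinants, hence as smooth functions.
\<close>

lemma matrix_inv_cramer:
  fixes G :: "real ^ 'n ^ 'n::finite"
  assumes "invertible G"
  shows "matrix_inv G $ k $ l = det (\<chi> i j. if j = k then axis l 1 $ i else G $ i $ j) * inverse (det G)"
proof -
  have G: "G ** matrix_inv G = mat 1"
    using assms someI_ex[of "\<lambda>A'. G ** A' = mat 1 \<and> A' ** G = mat 1"]
    unfolding invertible_def matrix_inv_def by blast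
  define x where "x = matrix_inv G *v axis l 1"
  have "G *v x = axis l 1"
    using G by (simp add: x_def matrix_vector_mul_assoc)
  then have "x = (\<chi> k. det (\<chi> i j. if j = k then axis l 1 $ i else G $ i $ j) / det G)"
    using cramer[of G x "axis l 1"] assms by (simp add: invertible_det_nz)
  moreover have "x $ k = matrix_inv G $ k $ l"
    by (simp add: x_def matrix_vector_mult_def axis_def if_distrib cong: if_cong)
  ultimately show ?thesis by (simp add: divide_inverse)
qed

lemma C_inf_on_matrix_inv:
  fixes G :: "'a::real_normed_vector \<Rightarrow> real ^ 'n ^ 'n::finite"
  assumes "open U" "\<And>i j. C_inf_on U (\<lambda>z. G z $ i $ j)" "\<And>z. z \<in> U \<Longrightarrow> invertible (G z)"
  shows "C_inf_on U (\<lambda>z. matrix_inv (G z) $ k $ l)"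
proof (rule C_inf_on_cong[OF assms(1)])
  show "det (\<chi> i j. if j = k then axis l 1 $ i else G z $ i $ j) * inverse (det (G z))
      = matrix_inv (G z) $ k $ l" if "z \<in> U" for z
    using matrix_inv_cramer[OF assms(3)[OF that]] by simp
  have "C_inf_on U (\<lambda>z. (\<chi> i j. if j = k then axis l 1 $ i else G z $ i $ j) $ i $ j)" for i j
    using assms(2) by (cases "j = k") (auto simp: C_inf_on_const)
  then show "C_inf_on U (\<lambda>z. det (\<chi> i j. if j = k then axis l 1 $ i else G z $ i $ j) * inverse (det (G z)))"
    using assms by (intro C_inf_on_mult C_inf_on_inverse C_inf_on_det) (auto simp: invertible_det_nz)
qed

text \<open>
  The second difference is a first difference in direction \<open>u\<close> of \<open>f (w + h v) - f w\<close>, so the mean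
  value theorem applies to it first in direction \<open>u\<close> and then in direction \<open>v\<close>.
\<close>

lemma second_difference_mean_value:
  fixes f :: "'a::real_normed_vector \<Rightarrow> real"
  assumes "h > 0" and inU: "\<And>s t. 0 \<le> s \<Longrightarrow> s \<le> h \<Longrightarrow> 0 \<le> t \<Longrightarrow> t \<le> h \<Longrightarrow> x + s *\<^sub>R u + t *\<^sub>R v \<in> U"
    and f: "C_inf_on U f"
  shows "\<exists>s t. 0 \<le> s \<and> s \<le> h \<and> 0 \<le> t \<and> t \<le> h \<and>
     f (x + h *\<^sub>R u + h *\<^sub>R v) - f (x + h *\<^sub>R u) - f (x + h *\<^sub>R v) + f x
     = h\<^sup>2 * frechet_derivative (\<lambda>w. frechet_derivative f (at w) u) (at (x + s *\<^sub>R u + t *\<^sub>R v)) v"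
proof -
  have mvt: "\<exists>s. 0 < s \<and> s < h \<and> g (p + h *\<^sub>R e) - g p = h * frechet_derivative g (at (p + s *\<^sub>R e)) e"
    if g: "\<And>s. 0 \<le> s \<Longrightarrow> s \<le> h \<Longrightarrow> g differentiable (at (p + s *\<^sub>R e))" for g :: "'a \<Rightarrow> real" and p e
  proof -
    have "((\<lambda>s. g (p + s *\<^sub>R e)) has_derivative (\<lambda>r. frechet_derivative g (at (p + s *\<^sub>R e)) (r *\<^sub>R e)))
        (at s within {0..h})" if "0 \<le> s" "s \<le> h" for s
    proof -
      have "((\<lambda>s. p + s *\<^sub>R e) has_derivative (\<lambda>r. r *\<^sub>R e)) (at s within {0..h})"
        by (auto intro!: derivative_eq_intros)
      from has_derivative_compose[OF this g[OF that, unfolded frechet_derivative_works]]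
      show ?thesis .
    qed
    then obtain s where s: "s \<in> {0<..<h}"
      "g (p + h *\<^sub>R e) - g (p + 0 *\<^sub>R e) = frechet_derivative g (at (p + s *\<^sub>R e)) ((h - 0) *\<^sub>R e)"
      using mvt_simple[OF assms(1), of "\<lambda>s. g (p + s *\<^sub>R e)" "\<lambda>s r. frechet_derivative g (at (p + s *\<^sub>R e)) (r *\<^sub>R e)"]
      by auto
    have "linear (frechet_derivative g (at (p + s *\<^sub>R e)))"
      using g s by (auto intro: linear_frechet_derivative)
    then show ?thesis using s by (auto simp: linear_cmul)
  qed
  define \<phi> where "\<phi> = (\<lambda>w. f (w + h *\<^sub>R v) - f w)"
  have shift: "((\<lambda>w. f (w + h *\<^sub>R v)) has_derivative frechet_derivative f (at (w + h *\<^sub>R v))) (at w)"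
    if "w + h *\<^sub>R v \<in> U" for w
  proof -
    have "((\<lambda>w. w + h *\<^sub>R v) has_derivative (\<lambda>e. e)) (at w)"
      by (auto intro!: derivative_eq_intros)
    from has_derivative_compose[OF this C_inf_on_differentiable[OF f that, unfolded frechet_derivative_works]]
    show ?thesis .
  qed
  have d\<phi>: "(\<phi> has_derivative (\<lambda>e. frechet_derivative f (at (w + h *\<^sub>R v)) e - frechet_derivative f (at w) e)) (at w)"
    if "w + h *\<^sub>R v \<in> U" "w \<in> U" for w
    unfolding \<phi>_def using shift[OF that(1)] C_inf_on_differentiable[OF f that(2), unfolded frechet_derivative_works]
    by (rule has_derivative_diff)
  have in1: "x + s *\<^sub>R u \<in> U" "x + s *\<^sub>R u + h *\<^sub>R v \<in> U" if "0 \<le> s" "s \<le> h" for s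
    using inU[of s 0] inU[of s h] that assms(1) by auto
  obtain s where s: "0 < s" "s < h"
    "\<phi> (x + h *\<^sub>R u) - \<phi> x = h * frechet_derivative \<phi> (at (x + s *\<^sub>R u)) u"
    using mvt[where p=x and e=u and g=\<phi>] differentiableI[OF d\<phi>[OF in1(2,1)]] by blast
  have "frechet_derivative \<phi> (at (x + s *\<^sub>R u)) u
      = frechet_derivative f (at (x + s *\<^sub>R u + h *\<^sub>R v)) u - frechet_derivative f (at (x + s *\<^sub>R u)) u"
    using fun_cong[OF frechet_derivative_at[OF d\<phi>[OF in1(2,1)]], of s u] s by simp
  moreover obtain t where t: "0 < t" "t < h"
    "frechet_derivative f (at (x + s *\<^sub>R u + h *\<^sub>R v)) u - frechet_derivative f (at (x + s *\<^sub>R u)) u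
     = h * frechet_derivative (\<lambda>w. frechet_derivative f (at w) u) (at (x + s *\<^sub>R u + t *\<^sub>R v)) v"
  proof -
    have "(\<lambda>w. frechet_derivative f (at w) u) differentiable (at (x + s *\<^sub>R u + t *\<^sub>R v))"
      if "0 \<le> t" "t \<le> h" for t
      using s that by (intro C_inf_on_differentiable[OF C_inf_on_derivative[OF f]] inU) auto
    from mvt[where p="x + s *\<^sub>R u" and e=v, OF this] that show ?thesis by blast
  qed
  moreover have "\<phi> (x + h *\<^sub>R u) - \<phi> x
      = f (x + h *\<^sub>R u + h *\<^sub>R v) - f (x + h *\<^sub>R u) - f (x + h *\<^sub>R v) + f x"
    by (simp add: \<phi>_def)
  ultimately show ?thesis using s t by (intro exI[of _ s] exI[of _ t]) (auto simp: power2_eq_square)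
qed

text \<open>
  The second difference is symmetric in \<open>u\<close> and \<open>v\<close>, so the value of one mixed derivative at some
  point arbitrarily close to \<open>x\<close> is the value of the other one at another such point; continuity of
  both at \<open>x\<close> gives the claim.
\<close>

lemma symmetric_second_derivative:
  fixes f :: "'a::real_normed_vector \<Rightarrow> real"
  assumes "open U" "x \<in> U" and f: "C_inf_on U f"
  shows "frechet_derivative (\<lambda>w. frechet_derivative f (at w) u) (at x) v
       = frechet_derivative (\<lambda>w. frechet_derivative f (at w) v) (at x) u" (is "?P x = ?Q x")
proof (rule ccontr)
  assume ne: "?P x \<noteq> ?Q x"
  define e where "e = \<bar>?P x - ?Q x\<bar> / 2"
  have "e > 0" using ne by (simp add: e_def)
  have "isCont ?P x" "isCont ?Q x"
    by (rule C_inf_on_continuous[OF C_inf_on_derivative[OF C_inf_on_derivative[OF f]] assms(2)])+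
  then have ex: "\<exists>r>0. \<forall>w. dist w x < r \<longrightarrow> dist (?P w) (?P x) < e"
      "\<exists>r>0. \<forall>w. dist w x < r \<longrightarrow> dist (?Q w) (?Q x) < e"
    unfolding continuous_at_eps_delta dist_norm real_norm_def using \<open>e > 0\<close> by simp_all
  obtain d1 where d1: "d1 > 0" "\<And>w. dist w x < d1 \<Longrightarrow> dist (?P w) (?P x) < e"
    using ex(1) by blast
  obtain d2 where d2: "d2 > 0" "\<And>w. dist w x < d2 \<Longrightarrow> dist (?Q w) (?Q x) < e"
    using ex(2) by blast
  obtain d3 where d3: "d3 > 0" "ball x d3 \<subseteq> U"
    using assms openE by blast
  define d where "d = min d1 (min d2 d3)"
  \<comment> \<open>So small that the whole parallelogram lies in the ball of radius \<open>d\<close>.\<close>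
  define h where "h = d / (norm u + norm v + 1)"
  have "d > 0" using d1 d2 d3 by (simp add: d_def)
  have pos: "norm u + norm v + 1 > 0"
    using norm_ge_zero[of u] norm_ge_zero[of v] by linarith
  have "h > 0" unfolding h_def using \<open>d > 0\<close> pos by (rule divide_pos_pos)
  have near: "dist (x + s *\<^sub>R u + t *\<^sub>R v) x < d" if "0 \<le> s" "s \<le> h" "0 \<le> t" "t \<le> h" for s t
  proof -
    have "dist (x + s *\<^sub>R u + t *\<^sub>R v) x \<le> norm (s *\<^sub>R u) + norm (t *\<^sub>R v)"
      using norm_triangle_ineq[of "s *\<^sub>R u" "t *\<^sub>R v"] by (simp add: dist_norm algebra_simps)
    also have "\<dots> \<le> h * norm u + h * norm v"
      using that by (auto intro!: add_mono mult_right_mono)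
    also have "\<dots> < h * (norm u + norm v + 1)"
      using \<open>h > 0\<close> by (simp add: algebra_simps)
    also have "\<dots> = d"
      using pos unfolding h_def by simp
    finally show ?thesis .
  qed
  then have inU: "x + s *\<^sub>R u + t *\<^sub>R v \<in> U" if "0 \<le> s" "s \<le> h" "0 \<le> t" "t \<le> h" for s t
    using near[OF that] d3(2) by (auto simp: d_def dist_commute subset_iff)
  have inU': "x + t *\<^sub>R v + s *\<^sub>R u \<in> U" if "0 \<le> t" "t \<le> h" "0 \<le> s" "s \<le> h" for s t
    using inU[OF that(3,4,1,2)] by (simp add: add_ac)
  obtain s t where st: "0 \<le> s" "s \<le> h" "0 \<le> t" "t \<le> h"
    "f (x + h *\<^sub>R u + h *\<^sub>R v) - f (x + h *\<^sub>R u) - f (x + h *\<^sub>R v) + f x = h\<^sup>2 * ?P (x + s *\<^sub>R u + t *\<^sub>R v)"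
    using second_difference_mean_value[OF \<open>h > 0\<close> _ f, of x u v] inU by blast
  obtain t' s' where st': "0 \<le> t'" "t' \<le> h" "0 \<le> s'" "s' \<le> h"
    "f (x + h *\<^sub>R v + h *\<^sub>R u) - f (x + h *\<^sub>R v) - f (x + h *\<^sub>R u) + f x = h\<^sup>2 * ?Q (x + t' *\<^sub>R v + s' *\<^sub>R u)"
    using second_difference_mean_value[OF \<open>h > 0\<close> _ f, of x v u] inU' by blast
  have "h\<^sup>2 * ?P (x + s *\<^sub>R u + t *\<^sub>R v) = h\<^sup>2 * ?Q (x + t' *\<^sub>R v + s' *\<^sub>R u)"
  proof -
    have comm: "x + h *\<^sub>R v + h *\<^sub>R u = x + h *\<^sub>R u + h *\<^sub>R v"
      by (simp add: add_ac)
    show ?thesis using st(5) st'(5)[unfolded comm] by linarith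
  qed
  then have "?P (x + s *\<^sub>R u + t *\<^sub>R v) = ?Q (x + t' *\<^sub>R v + s' *\<^sub>R u)"
    using \<open>h > 0\<close> by (metis mult_cancel_left power_not_zero less_irrefl)
  moreover have "dist (?P (x + s *\<^sub>R u + t *\<^sub>R v)) (?P x) < e"
    using near[OF st(1-4)] by (intro d1(2)) (simp add: d_def)
  moreover have "dist (?Q (x + t' *\<^sub>R v + s' *\<^sub>R u)) (?Q x) < e"
  proof -
    have "dist (x + t' *\<^sub>R v + s' *\<^sub>R u) x < d"
      using near[OF st'(3,4,1,2)] by (simp add: add_ac)
    then show ?thesis by (intro d2(2)) (simp add: d_def)
  qed
  ultimately have "\<bar>?P x - ?Q x\<bar> < 2 * e"
    unfolding dist_real_def by linarith
  then show False by (simp add: e_def)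
qed

section \<open>Smooth extendability at a point\<close>

text \<open>
  The notion is meant for \<open>z\<close> in the closure of an open set \<open>S\<close>: only the values of \<open>f\<close> on \<open>S\<close> matter, and
  \<open>z\<close> may be a boundary point. For open \<open>S\<close> it is stable under the formation of derivatives of \<open>f\<close>,
  which on \<open>S\<close> are the derivatives of the local extension.
\<close>

definition smooth_ext_at ::
  "'a::real_normed_vector set \<Rightarrow> 'a \<Rightarrow> ('a \<Rightarrow> 'b::real_normed_vector) \<Rightarrow> bool" where
  "smooth_ext_at S z f \<longleftrightarrow> (\<exists>U F. open U \<and> z \<in> U \<and> C_inf_on U F \<and> (\<forall>u\<in>U \<inter> S. F u = f u))"

lemma smooth_on_iff_smooth_ext_at: "smooth_on S f \<longleftrightarrow> (\<forall>z\<in>S. smooth_ext_at S z f)"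
  unfolding smooth_on_def smooth_ext_at_def C_inf_on_def by blast

lemma smooth_ext_atI:
  "open U \<Longrightarrow> z \<in> U \<Longrightarrow> C_inf_on U F \<Longrightarrow> (\<And>u. u \<in> U \<Longrightarrow> u \<in> S \<Longrightarrow> F u = f u) \<Longrightarrow> smooth_ext_at S z f"
  unfolding smooth_ext_at_def by blast

lemma smooth_ext_atE:
  assumes "smooth_ext_at S z f"
  obtains U F where "open U" "z \<in> U" "C_inf_on U F" "\<And>u. u \<in> U \<Longrightarrow> u \<in> S \<Longrightarrow> F u = f u"
  using assms unfolding smooth_ext_at_def by blast

lemma smooth_ext_at_cong:
  "smooth_ext_at S z f \<Longrightarrow> (\<And>u. u \<in> S \<Longrightarrow> f u = g u) \<Longrightarrow> smooth_ext_at S z g"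
  unfolding smooth_ext_at_def by auto

lemma smooth_ext_at_subset: "smooth_ext_at S z f \<Longrightarrow> T \<subseteq> S \<Longrightarrow> smooth_ext_at T z f"
  unfolding smooth_ext_at_def by blast

lemma smooth_on_imp_C_inf_on:
  assumes "open S" "smooth_on S f"
  shows "C_inf_on S f"
  unfolding C_inf_on_def
proof (intro allI C_k_on_local)
  fix k z assume "z \<in> S"
  then have "smooth_ext_at S z f"
    using assms(2) unfolding smooth_on_iff_smooth_ext_at by blast
  then obtain U F where U: "open U" "z \<in> U" "C_inf_on U F" "\<And>u. u \<in> U \<Longrightarrow> u \<in> S \<Longrightarrow> F u = f u"
    by (rule smooth_ext_atE) (rule that)
  have "C_inf_on (U \<inter> S) f"
    by (rule C_inf_on_cong[OF open_Int[OF U(1) assms(1)] _ C_inf_on_subset[OF U(3)]]) (use U in auto)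
  then show "\<exists>U. open U \<and> z \<in> U \<and> C_k_on k U f"
    using U(1,2) assms(1) \<open>z \<in> S\<close> by (intro exI[of _ "U \<inter> S"]) (simp add: C_inf_on_def open_Int)
qed

lemma smooth_ext_at_of_C_inf_on:
  assumes "C_inf_on UNIV f"
  shows "smooth_ext_at S z f"
  by (rule smooth_ext_atI[OF open_UNIV UNIV_I assms refl])

lemma smooth_ext_at_const: "smooth_ext_at S z (\<lambda>w. c)"
  by (rule smooth_ext_at_of_C_inf_on[OF C_inf_on_const])

lemma smooth_ext_at_bounded_linear: "bounded_linear h \<Longrightarrow> smooth_ext_at S z h"
  by (rule smooth_ext_at_of_C_inf_on[OF C_inf_on_bounded_linear])

lemma smooth_ext_at_snd_nth:
  "smooth_ext_at S z (\<lambda>w :: (real ^ 'n) \<times> (real ^ 'n::finite). snd w $ i)"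
  by (intro smooth_ext_at_bounded_linear bounded_linear_compose[OF bounded_linear_vec_nth] bounded_linear_snd)

lemma smooth_ext_at_compose_linear:
  assumes "bounded_linear h" "smooth_ext_at S z f"
  shows "smooth_ext_at S z (\<lambda>w. h (f w))"
proof -
  obtain U F where U: "open U" "z \<in> U" "C_inf_on U F" "\<And>u. u \<in> U \<Longrightarrow> u \<in> S \<Longrightarrow> F u = f u"
    using assms(2) by (rule smooth_ext_atE) (rule that)
  then show ?thesis
    by (intro smooth_ext_atI[OF U(1,2) C_inf_on_compose_linear[OF assms(1) U(1,3)]]) simp
qed

lemma smooth_ext_at_nth: "smooth_ext_at S z f \<Longrightarrow> smooth_ext_at S z (\<lambda>w. f w $ i)"
  by (rule smooth_ext_at_compose_linear[OF bounded_linear_vec_nth])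

lemma smooth_ext_at_uminus: "smooth_ext_at S z f \<Longrightarrow> smooth_ext_at S z (\<lambda>w. - f w)"
  by (rule smooth_ext_at_compose_linear[OF bounded_linear_minus[OF bounded_linear_ident]])

lemma smooth_ext_at_add:
  assumes "smooth_ext_at S z f" "smooth_ext_at S z g"
  shows "smooth_ext_at S z (\<lambda>w. f w + g w)"
proof -
  obtain U F where U: "open U" "z \<in> U" "C_inf_on U F" "\<And>u. u \<in> U \<Longrightarrow> u \<in> S \<Longrightarrow> F u = f u"
    using assms(1) by (rule smooth_ext_atE) (rule that)
  obtain V G where V: "open V" "z \<in> V" "C_inf_on V G" "\<And>u. u \<in> V \<Longrightarrow> u \<in> S \<Longrightarrow> G u = g u"
    using assms(2) by (rule smooth_ext_atE) (rule that)
  show ?thesis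
  proof (rule smooth_ext_atI)
    show "open (U \<inter> V)" "z \<in> U \<inter> V" using U V by auto
    show "C_inf_on (U \<inter> V) (\<lambda>w. F w + G w)"
      by (rule C_inf_on_add[OF open_Int[OF U(1) V(1)] C_inf_on_subset[OF U(3)] C_inf_on_subset[OF V(3)]]) auto
    show "F u + G u = f u + g u" if "u \<in> U \<inter> V" "u \<in> S" for u
      using U(4) V(4) that by simp
  qed
qed

lemma smooth_ext_at_diff:
  "smooth_ext_at S z f \<Longrightarrow> smooth_ext_at S z g \<Longrightarrow> smooth_ext_at S z (\<lambda>w. f w - g w)"
  using smooth_ext_at_add[of S z f "\<lambda>w. - g w"] smooth_ext_at_uminus[of S z g] by simp

lemma smooth_ext_at_sum:
  "(\<And>i. i \<in> I \<Longrightarrow> smooth_ext_at S z (f i)) \<Longrightarrow> smooth_ext_at S z (\<lambda>w. \<Sum>i\<in>I. f i w)"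
  by (induction I rule: infinite_finite_induct) (auto simp: smooth_ext_at_const smooth_ext_at_add)

lemma smooth_ext_at_mult:
  fixes f g :: "_ \<Rightarrow> real"
  assumes "smooth_ext_at S z f" "smooth_ext_at S z g"
  shows "smooth_ext_at S z (\<lambda>w. f w * g w)"
proof -
  obtain U F where U: "open U" "z \<in> U" "C_inf_on U F" "\<And>u. u \<in> U \<Longrightarrow> u \<in> S \<Longrightarrow> F u = f u"
    using assms(1) by (rule smooth_ext_atE) (rule that)
  obtain V G where V: "open V" "z \<in> V" "C_inf_on V G" "\<And>u. u \<in> V \<Longrightarrow> u \<in> S \<Longrightarrow> G u = g u"
    using assms(2) by (rule smooth_ext_atE) (rule that)
  show ?thesis
  proof (rule smooth_ext_atI)
    show "open (U \<inter> V)" "z \<in> U \<inter> V" using U V by auto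
    show "C_inf_on (U \<inter> V) (\<lambda>w. F w * G w)"
      by (rule C_inf_on_mult[OF open_Int[OF U(1) V(1)] C_inf_on_subset[OF U(3)] C_inf_on_subset[OF V(3)]]) auto
    show "F u * G u = f u * g u" if "u \<in> U \<inter> V" "u \<in> S" for u
      using U(4) V(4) that by simp
  qed
qed

lemma smooth_ext_at_vec:
  fixes f :: "'a::real_normed_vector \<Rightarrow> 'b::real_normed_vector ^ 'n::finite"
  assumes "\<And>i. smooth_ext_at S z (\<lambda>w. f w $ i)"
  shows "smooth_ext_at S z f"
proof -
  have "\<exists>U F. open U \<and> z \<in> U \<and> C_inf_on U F \<and> (\<forall>u\<in>U \<inter> S. F u = f u $ i)" for i
    using assms[of i] unfolding smooth_ext_at_def .
  then obtain U F where U: "\<And>i. open (U i) \<and> z \<in> U i \<and> C_inf_on (U i) (F i) \<and> (\<forall>u\<in>U i \<inter> S. F i u = f u $ i)"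
    by metis
  have "open (\<Inter>i. U i)"
    using U by (intro open_INT) auto
  moreover have "C_inf_on (\<Inter>i. U i) (\<lambda>w. \<chi> i. F i w)"
  proof (rule C_inf_on_vec[OF calculation])
    fix i
    have "C_inf_on (\<Inter>i. U i) (F i)"
      by (rule C_inf_on_subset[of "U i"]) (use U[of i] in auto)
    then show "C_inf_on (\<Inter>i. U i) (\<lambda>w. (\<chi> i. F i w) $ i)" by simp
  qed
  moreover have "z \<in> (\<Inter>i. U i)" "\<And>u. u \<in> (\<Inter>i. U i) \<Longrightarrow> u \<in> S \<Longrightarrow> (\<chi> i. F i u) = f u"
    using U by (auto simp: vec_eq_iff)
  ultimately show ?thesis
    by (intro smooth_ext_atI)
qed

lemma smooth_ext_at_derivative:
  assumes "open S" "smooth_ext_at S z f"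
  shows "smooth_ext_at S z (\<lambda>w. frechet_derivative f (at w) v)"
proof -
  obtain U F where U: "open U" "z \<in> U" "C_inf_on U F" "\<And>u. u \<in> U \<Longrightarrow> u \<in> S \<Longrightarrow> F u = f u"
    using assms(2) by (rule smooth_ext_atE) (rule that)
  show ?thesis
  proof (rule smooth_ext_atI[OF U(1,2) C_inf_on_derivative[OF U(3)]])
    fix u assume "u \<in> U" "u \<in> S"
    then show "frechet_derivative F (at u) v = frechet_derivative f (at u) v"
      using U assms(1) by (subst frechet_derivative_cong_open[of "U \<inter> S" u F f]) auto
  qed
qed

lemma smooth_ext_at_dy: "open S \<Longrightarrow> smooth_ext_at S z f \<Longrightarrow> smooth_ext_at S z (dy i f)"
  unfolding dy_def by (rule smooth_ext_at_derivative)

lemma smooth_ext_at_dx: "open S \<Longrightarrow> smooth_ext_at S z f \<Longrightarrow> smooth_ext_at S z (dx i f)"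
  unfolding dx_def by (rule smooth_ext_at_derivative)

lemma smooth_ext_at_differentiable:
  assumes "open S" "z \<in> S" "smooth_ext_at S z f"
  shows "f differentiable (at z)"
proof -
  obtain U F where U: "open U" "z \<in> U" "C_inf_on U F" "\<And>u. u \<in> U \<Longrightarrow> u \<in> S \<Longrightarrow> F u = f u"
    using assms(3) by (rule smooth_ext_atE) (rule that)
  then show ?thesis
    using assms differentiable_cong_open[of "U \<inter> S" z F f] C_inf_on_differentiable[of U F z] by auto
qed

lemma smooth_ext_at_inverse_norm_fibre:
  fixes z :: "(real ^ 'n::finite) \<times> (real ^ 'n)"
  assumes "snd z \<noteq> 0"
  shows "smooth_ext_at S z (\<lambda>w. inverse (\<Sum>j\<in>UNIV. snd w $ j * snd w $ j))"
proof -
  define U :: "((real ^ 'n) \<times> (real ^ 'n)) set" where "U = {w. snd w \<noteq> 0}"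
  have U: "open U"
    unfolding U_def by (intro open_Collect_neq continuous_intros)
  have lin: "C_inf_on U (\<lambda>w :: (real ^ 'n) \<times> (real ^ 'n). snd w $ j)" for j
    by (intro C_inf_on_bounded_linear bounded_linear_compose[OF bounded_linear_vec_nth] bounded_linear_snd)
  have "C_inf_on U (\<lambda>w. inverse (\<Sum>j\<in>UNIV. snd w $ j * snd w $ j))"
  proof (intro C_inf_on_inverse U C_inf_on_sum C_inf_on_mult lin)
    fix w assume "w \<in> U"
    then show "(\<Sum>j\<in>UNIV. snd w $ j * snd w $ j) \<noteq> 0"
      unfolding U_def by (simp add: sum_nonneg_eq_0_iff vec_eq_iff)
  qed
  then show ?thesis
    using assms by (intro smooth_ext_atI[OF U(1)]) (simp_all add: U_def)
qed


section \<open>Vertical derivatives and homogeneity\<close>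

lemma dy_cong_open:
  "open S \<Longrightarrow> z \<in> S \<Longrightarrow> (\<And>w. w \<in> S \<Longrightarrow> f w = g w) \<Longrightarrow> dy i f z = dy i g z"
  unfolding dy_def by (simp add: frechet_derivative_cong_open[of S z f g])

lemma dy_const: "dy i (\<lambda>w. c) z = 0"
  by (simp add: dy_def)

lemma dy_snd_nth: "dy i (\<lambda>w. snd w $ j) z = of_bool (i = j)"
proof -
  have "bounded_linear (\<lambda>w :: (real ^ 'a) \<times> (real ^ 'a). snd w $ j)"
    by (intro bounded_linear_compose[OF bounded_linear_vec_nth] bounded_linear_snd)
  from fun_cong[OF frechet_derivative_at[OF bounded_linear_imp_has_derivative[OF this]], of "(0, axis i 1)"]
  show ?thesis by (simp add: dy_def axis_def)
qed

lemma differentiable_snd_nth [simp]: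
  "(\<lambda>w :: (real ^ 'n::finite) \<times> (real ^ 'n). snd w $ j) differentiable (at z)"
  by (intro bounded_linear_imp_differentiable bounded_linear_compose[OF bounded_linear_vec_nth] bounded_linear_snd)

lemma dy_add:
  assumes "f differentiable (at z)" "g differentiable (at z)"
  shows "dy i (\<lambda>w. f w + g w) z = dy i f z + dy i g z"
proof -
  from fun_cong[OF frechet_derivative_at[OF has_derivative_add[OF assms[unfolded frechet_derivative_works]]], of "(0, axis i 1)"]
  show ?thesis unfolding dy_def by simp
qed

lemma dy_diff:
  assumes "f differentiable (at z)" "g differentiable (at z)"
  shows "dy i (\<lambda>w. f w - g w) z = dy i f z - dy i g z"
proof -
  from fun_cong[OF frechet_derivative_at[OF has_derivative_diff[OF assms[unfolded frechet_derivative_works]]], of "(0, axis i 1)"]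
  show ?thesis unfolding dy_def by simp
qed

lemma dy_mult:
  assumes "f differentiable (at z)" "g differentiable (at z)"
  shows "dy i (\<lambda>w. f w * g w) z = dy i f z * g z + f z * dy i g z"
proof -
  from fun_cong[OF frechet_derivative_at[OF has_derivative_mult[OF assms[unfolded frechet_derivative_works]]], of "(0, axis i 1)"]
  show ?thesis unfolding dy_def by simp
qed

lemma dy_cmult:
  "f differentiable (at z) \<Longrightarrow> dy i (\<lambda>w. c * f w) z = c * dy i f z"
  using dy_mult[of "\<lambda>w. c" z f i] by (simp add: dy_const)

lemma dy_sum:
  assumes "\<And>j. j \<in> I \<Longrightarrow> f j differentiable (at z)"
  shows "dy i (\<lambda>w. \<Sum>j\<in>I. f j w) z = (\<Sum>j\<in>I. dy i (f j) z)"
  using assms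
proof (induction I rule: infinite_finite_induct)
  case (insert j I)
  then show ?case by (simp add: dy_add differentiable_sum)
qed (auto simp: dy_const)

definition homogeneous_on ::
  "((real ^ 'n::finite) \<times> (real ^ 'n)) set \<Rightarrow> real \<Rightarrow> ((real ^ 'n) \<times> (real ^ 'n) \<Rightarrow> 'b::real_vector) \<Rightarrow> bool" where
  "homogeneous_on S \<alpha> f \<longleftrightarrow> (\<forall>(x, y)\<in>S. \<forall>r>0. f (x, r *\<^sub>R y) = (r powr \<alpha>) *\<^sub>R f (x, y))"

definition conic_set :: "((real ^ 'n::finite) \<times> (real ^ 'n)) set \<Rightarrow> bool" where
  "conic_set S \<longleftrightarrow> (\<forall>(x, y)\<in>S. \<forall>r>0. (x, r *\<^sub>R y) \<in> S)"

lemma frechet_derivative_vertical: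
  fixes f :: "(real ^ 'n::finite) \<times> (real ^ 'n) \<Rightarrow> real"
  assumes "f differentiable (at z)"
  shows "frechet_derivative f (at z) (0, v) = (\<Sum>a\<in>UNIV. v $ a * dy a f z)"
proof -
  have lin: "linear (frechet_derivative f (at z))"
    using assms by (rule linear_frechet_derivative)
  have "(0, v) = (\<Sum>a\<in>UNIV. v $ a *\<^sub>R (0 :: real ^ 'n, axis a 1 :: real ^ 'n))"
    by (auto simp: prod_eq_iff fst_sum snd_sum vec_eq_iff axis_def if_distrib cong: if_cong)
  then have "frechet_derivative f (at z) (0, v)
      = frechet_derivative f (at z) (\<Sum>a\<in>UNIV. v $ a *\<^sub>R (0 :: real ^ 'n, axis a 1 :: real ^ 'n))"
    by metis
  also have "\<dots> = (\<Sum>a\<in>UNIV. v $ a * dy a f z)"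
    unfolding dy_def by (simp only: linear_sum[OF lin] linear_cmul[OF lin] real_scaleR_def)
  finally show ?thesis .
qed

text \<open>
  Both sides are the derivative of \<open>r \<mapsto> f (x, r y)\<close> at \<open>r = 1\<close>.
\<close>

lemma euler_homogeneous:
  fixes f :: "(real ^ 'n::finite) \<times> (real ^ 'n) \<Rightarrow> real"
  assumes "f differentiable (at z)" "z \<in> S" "homogeneous_on S \<alpha> f"
  shows "(\<Sum>a\<in>UNIV. dy a f z * snd z $ a) = \<alpha> * f z"
proof -
  obtain x y where z: "z = (x, y)" by (cases z)
  have ray: "((\<lambda>r. (x, r *\<^sub>R y)) has_derivative (\<lambda>r. (0, r *\<^sub>R y))) (at 1)"
    by (auto intro!: derivative_eq_intros)
  have "(f has_derivative frechet_derivative f (at z)) (at (x, 1 *\<^sub>R y))"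
    using assms(1) z by (simp add: frechet_derivative_works)
  from has_derivative_compose[OF ray this]
  have D1: "((\<lambda>r. f (x, r *\<^sub>R y)) has_derivative (\<lambda>r. frechet_derivative f (at z) (0, r *\<^sub>R y))) (at 1)" .
  have "((\<lambda>r. r powr \<alpha> * f z) has_derivative (\<lambda>r. r * \<alpha> * f z)) (at (1::real))"
    by (auto intro!: derivative_eq_intros)
  then have "((\<lambda>r. f (x, r *\<^sub>R y)) has_derivative (\<lambda>r. r * \<alpha> * f z)) (at 1)"
    by (rule has_derivative_transform_within_open[of _ _ _ _ "{0<..}"])
      (use assms(2,3) z in \<open>auto simp: homogeneous_on_def\<close>)
  with D1 have "(\<lambda>r. frechet_derivative f (at z) (0, r *\<^sub>R y)) = (\<lambda>r. r * \<alpha> * f z)"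
    by (rule has_derivative_unique)
  from fun_cong[OF this, of 1] show ?thesis
    using frechet_derivative_vertical[OF assms(1), of y] z by (simp add: mult.commute)
qed

text \<open>
  The derivatives of the two sides of \<open>f (x, r y) = r\<^sup>\<alpha> f (x, y)\<close> in direction \<open>y\<^sup>a\<close> are compared;
  the inner derivative contributes the factor \<open>r\<close>.
\<close>

lemma homogeneous_on_dy:
  fixes f :: "(real ^ 'n::finite) \<times> (real ^ 'n) \<Rightarrow> real"
  assumes "open S" "conic_set S" "\<And>z. z \<in> S \<Longrightarrow> f differentiable (at z)" "homogeneous_on S \<alpha> f"
  shows "homogeneous_on S (\<alpha> - 1) (dy a f)"
  unfolding homogeneous_on_def
proof (clarify)
  fix x y and r :: real assume xy: "(x, y) \<in> S" and r: "r > 0"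
  have xry: "(x, r *\<^sub>R y) \<in> S"
    using assms(2) xy r unfolding conic_set_def by blast
  have scale: "((\<lambda>w. (fst w, r *\<^sub>R snd w)) has_derivative (\<lambda>w. (fst w, r *\<^sub>R snd w))) (at (x, y))"
    by (auto intro!: derivative_eq_intros)
  have "(f has_derivative frechet_derivative f (at (x, r *\<^sub>R y))) (at (fst (x, y), r *\<^sub>R snd (x, y)))"
    using assms(3)[OF xry] by (simp add: frechet_derivative_works)
  from has_derivative_compose[OF scale this]
  have D1: "((\<lambda>w. f (fst w, r *\<^sub>R snd w)) has_derivative
      (\<lambda>w. frechet_derivative f (at (x, r *\<^sub>R y)) (fst w, r *\<^sub>R snd w))) (at (x, y))" .
  have "((\<lambda>w. r powr \<alpha> * f w) has_derivative (\<lambda>v. r powr \<alpha> * frechet_derivative f (at (x, y)) v)) (at (x, y))"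
    by (rule has_derivative_mult_right[OF assms(3)[OF xy, unfolded frechet_derivative_works]])
  then have D2: "((\<lambda>w. f (fst w, r *\<^sub>R snd w)) has_derivative (\<lambda>v. r powr \<alpha> * frechet_derivative f (at (x, y)) v)) (at (x, y))"
  proof (rule has_derivative_transform_within_open[OF _ assms(1) xy])
    fix w assume "w \<in> S"
    then show "r powr \<alpha> * f w = f (fst w, r *\<^sub>R snd w)"
      using assms(4) r by (cases w) (simp add: homogeneous_on_def case_prod_beta Ball_def)
  qed
  have "frechet_derivative f (at (x, r *\<^sub>R y)) (0, r *\<^sub>R axis a 1) = r powr \<alpha> * dy a f (x, y)"
    using fun_cong[OF has_derivative_unique[OF D1 D2], of "(0, axis a 1)"] by (simp add: dy_def)
  moreover have "frechet_derivative f (at (x, r *\<^sub>R y)) (0, r *\<^sub>R axis a 1) = r * dy a f (x, r *\<^sub>R y)"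
    using linear_cmul[OF linear_frechet_derivative[OF assms(3)[OF xry]], of r "(0, axis a 1)"]
    by (simp add: dy_def)
  ultimately have "dy a f (x, r *\<^sub>R y) = r powr \<alpha> * dy a f (x, y) / r"
    using r by (metis less_irrefl nonzero_mult_div_cancel_left)
  then show "dy a f (x, r *\<^sub>R y) = r powr (\<alpha> - 1) *\<^sub>R dy a f (x, y)"
    using r by (simp add: powr_diff)
qed

lemma homogeneous_on_nth:
  fixes f :: "_ \<Rightarrow> 'b::real_vector ^ 'n::finite"
  shows "homogeneous_on S \<alpha> f \<Longrightarrow> homogeneous_on S \<alpha> (\<lambda>w. f w $ i)"
  unfolding homogeneous_on_def by (simp add: case_prod_beta)

section \<open>Decomposition of fields of type (1,1) along the fibres\<close>

text \<open>
  The next four functions express the parts of \<open>J = \<partial>Z + A \<otimes> C\<close> in terms of \<open>J\<close>: the trace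
  defect is \<open>A\<^sub>ay\<^sup>a\<close>, the potential is \<open>Z\<close> and the radial covector is \<open>A\<close>. They are defined for every
  \<open>J\<close>, and they depend smoothly on \<open>J\<close> as long as \<open>y \<noteq> 0\<close>.
\<close>

definition half_contraction ::
  "((real ^ 'n::finite) \<times> (real ^ 'n) \<Rightarrow> real ^ 'n ^ 'n) \<Rightarrow> (real ^ 'n) \<times> (real ^ 'n) \<Rightarrow> real ^ 'n" where
  "half_contraction J z = (\<chi> j. 1/2 * (\<Sum>i\<in>UNIV. J z $ i $ j * snd z $ i))"

definition trace_defect ::
  "((real ^ 'n::finite) \<times> (real ^ 'n) \<Rightarrow> real ^ 'n ^ 'n) \<Rightarrow> (real ^ 'n) \<times> (real ^ 'n) \<Rightarrow> real" where
  "trace_defect J z = 2 / (real CARD('n) - 1) *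
     ((\<Sum>a\<in>UNIV. dy a (\<lambda>w. half_contraction J w $ a) z) - (\<Sum>a\<in>UNIV. J z $ a $ a))"

definition potential ::
  "((real ^ 'n::finite) \<times> (real ^ 'n) \<Rightarrow> real ^ 'n ^ 'n) \<Rightarrow> (real ^ 'n) \<times> (real ^ 'n) \<Rightarrow> real ^ 'n" where
  "potential J z = (\<chi> j. half_contraction J z $ j - 1/2 * (trace_defect J z * snd z $ j))"

definition radial_covector ::
  "((real ^ 'n::finite) \<times> (real ^ 'n) \<Rightarrow> real ^ 'n ^ 'n) \<Rightarrow> (real ^ 'n) \<times> (real ^ 'n) \<Rightarrow> real ^ 'n" where
  "radial_covector J z = (\<chi> i. (\<Sum>j\<in>UNIV. (J z $ i $ j - dy i (\<lambda>w. potential J w $ j) z) * snd z $ j)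
     * inverse (\<Sum>j\<in>UNIV. snd z $ j * snd z $ j))"

lemma smooth_ext_at_half_contraction:
  assumes "smooth_ext_at S z J"
  shows "smooth_ext_at S z (half_contraction J)"
  unfolding half_contraction_def
  by (rule smooth_ext_at_vec)
    (simp only: vec_lambda_beta, intro smooth_ext_at_mult smooth_ext_at_sum smooth_ext_at_const smooth_ext_at_snd_nth
      smooth_ext_at_nth[OF smooth_ext_at_nth[OF assms]])

lemma smooth_ext_at_trace_defect:
  assumes "open S" "smooth_ext_at S z J"
  shows "smooth_ext_at S z (trace_defect J)"
  unfolding trace_defect_def
  by (intro smooth_ext_at_mult smooth_ext_at_diff smooth_ext_at_sum smooth_ext_at_const
      smooth_ext_at_nth[OF smooth_ext_at_nth[OF assms(2)]]
      smooth_ext_at_dy[OF assms(1) smooth_ext_at_nth[OF smooth_ext_at_half_contraction[OF assms(2)]]])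

lemma smooth_ext_at_potential:
  assumes "open S" "smooth_ext_at S z J"
  shows "smooth_ext_at S z (potential J)"
  unfolding potential_def
  by (rule smooth_ext_at_vec)
    (simp only: vec_lambda_beta, intro smooth_ext_at_mult smooth_ext_at_diff smooth_ext_at_const smooth_ext_at_snd_nth
      smooth_ext_at_nth[OF smooth_ext_at_half_contraction[OF assms(2)]]
      smooth_ext_at_trace_defect[OF assms])

lemma smooth_ext_at_radial_covector:
  assumes "open S" "smooth_ext_at S z J" "snd z \<noteq> 0"
  shows "smooth_ext_at S z (radial_covector J)"
  unfolding radial_covector_def
  by (rule smooth_ext_at_vec)
    (simp only: vec_lambda_beta, intro smooth_ext_at_mult smooth_ext_at_sum smooth_ext_at_diff smooth_ext_at_snd_nth
      smooth_ext_at_inverse_norm_fibre[OF assms(3)]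
      smooth_ext_at_nth[OF smooth_ext_at_nth[OF assms(2)]]
      smooth_ext_at_dy[OF assms(1) smooth_ext_at_nth[OF smooth_ext_at_potential[OF assms(1,2)]]])

lemma fibre_square_nonzero:
  fixes y :: "real ^ 'n::finite"
  assumes "y \<noteq> 0"
  shows "(\<Sum>j\<in>UNIV. y $ j * y $ j) \<noteq> 0"
  using assms by (simp add: sum_nonneg_eq_0_iff vec_eq_iff)

lemma radial_covector_eq:
  assumes "snd z \<noteq> 0" "\<And>i j. J z $ i $ j = dy i (\<lambda>w. potential J w $ j) z + b i * snd z $ j"
  shows "radial_covector J z $ i = b i"
proof -
  have "(\<Sum>j\<in>UNIV. (J z $ i $ j - dy i (\<lambda>w. potential J w $ j) z) * snd z $ j)
      = b i * (\<Sum>j\<in>UNIV. snd z $ j * snd z $ j)"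
    unfolding assms(2) by (simp add: sum_distrib_left mult.assoc)
  then show ?thesis
    using fibre_square_nonzero[OF assms(1)] by (simp add: radial_covector_def)
qed

lemma sum_antisymmetrizer:
  fixes y :: "real ^ 'n::finite"
  shows "(\<Sum>b\<in>UNIV. g b * (of_bool (b = i) * y $ j - y $ b * of_bool (j = i)))
       = g i * y $ j - (\<Sum>b\<in>UNIV. g b * y $ b) * of_bool (j = i)"
proof -
  have "g b * (of_bool (b = i) * y $ j - y $ b * of_bool (j = i))
      = (if b = i then g b * y $ j else 0) - (g b * y $ b) * of_bool (j = i)" for b
    by (simp add: algebra_simps)
  then show ?thesis
    by (simp only: sum_subtractf sum_distrib_right[symmetric]) simp
qed

text \<open>
  Contracting \<open>J = \<partial>Z + A \<otimes> C\<close> with \<open>y\<close> gives \<open>2 Z + f y\<close> with \<open>f = A\<^sub>ay\<^sup>a\<close>, because \<open>Z\<close> is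
  homogeneous of degree two. The function \<open>f\<close> enters the trace of \<open>J\<close> with the factor \<open>1\<close> and the
  divergence of half of the contraction with the factor \<open>(n + 1) / 2\<close>, so it can be isolated.
\<close>

lemma decomposition_recovers:
  fixes J :: "(real ^ 'n::finite) \<times> (real ^ 'n) \<Rightarrow> real ^ 'n ^ 'n"
  assumes n: "CARD('n) \<ge> 2" and S: "open S" "\<And>w. w \<in> S \<Longrightarrow> snd w \<noteq> 0"
    and Z: "\<And>w k. w \<in> S \<Longrightarrow> (\<lambda>u. Z u $ k) differentiable (at w)" "homogeneous_on S 2 Z"
    and A: "\<And>w k. w \<in> S \<Longrightarrow> (\<lambda>u. A u $ k) differentiable (at w)" "homogeneous_on S 0 A"
    and J: "\<And>w i j. w \<in> S \<Longrightarrow> J w $ i $ j = dy i (\<lambda>u. Z u $ j) w + A w $ i * snd w $ j"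
    and z: "z \<in> S"
  shows "potential J z = Z z" "radial_covector J z = A z"
proof -
  define f where "f = (\<lambda>w. \<Sum>a\<in>UNIV. A w $ a * snd w $ a)"
  have f_diff: "f differentiable (at w)" if "w \<in> S" for w
    unfolding f_def using A(1)[OF that] by (intro differentiable_sum differentiable_mult) auto
  have f_hom: "homogeneous_on S 1 f"
    using A(2) by (auto simp: homogeneous_on_def f_def sum_distrib_left mult_ac)
  have W: "half_contraction J w $ j = Z w $ j + 1/2 * (f w * snd w $ j)" if w: "w \<in> S" for w j
  proof -
    have "(\<Sum>i\<in>UNIV. J w $ i $ j * snd w $ i)
        = (\<Sum>i\<in>UNIV. dy i (\<lambda>u. Z u $ j) w * snd w $ i) + f w * snd w $ j"
      unfolding J[OF w] f_def by (simp add: algebra_simps sum.distrib sum_distrib_left)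
    also have "(\<Sum>i\<in>UNIV. dy i (\<lambda>u. Z u $ j) w * snd w $ i) = 2 * Z w $ j"
      by (rule euler_homogeneous[OF Z(1)[OF w] w homogeneous_on_nth[OF Z(2)]])
    finally show ?thesis by (simp add: half_contraction_def)
  qed
  have T: "trace_defect J w = f w" if w: "w \<in> S" for w
  proof -
    have "dy a (\<lambda>u. half_contraction J u $ a) w
        = dy a (\<lambda>u. Z u $ a) w + 1/2 * (dy a f w * snd w $ a + f w)" for a
    proof -
      have "dy a (\<lambda>u. half_contraction J u $ a) w = dy a (\<lambda>u. Z u $ a + 1/2 * (f u * snd u $ a)) w"
        by (rule dy_cong_open[OF S(1) w W])
      also have "\<dots> = dy a (\<lambda>u. Z u $ a) w + dy a (\<lambda>u. 1/2 * (f u * snd u $ a)) w"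
        by (rule dy_add[OF Z(1)[OF w]]) (intro differentiable_mult differentiable_const f_diff[OF w] differentiable_snd_nth)
      also have "dy a (\<lambda>u. 1/2 * (f u * snd u $ a)) w = 1/2 * dy a (\<lambda>u. f u * snd u $ a) w"
        by (rule dy_cmult) (intro differentiable_mult f_diff[OF w] differentiable_snd_nth)
      also have "dy a (\<lambda>u. f u * snd u $ a) w = dy a f w * snd w $ a + f w"
        by (subst dy_mult[OF f_diff[OF w] differentiable_snd_nth]) (simp add: dy_snd_nth)
      finally show ?thesis by simp
    qed
    then have "(\<Sum>a\<in>UNIV. dy a (\<lambda>u. half_contraction J u $ a) w)
        = (\<Sum>a\<in>UNIV. dy a (\<lambda>u. Z u $ a) w) + 1/2 * ((\<Sum>a\<in>UNIV. dy a f w * snd w $ a) + real CARD('n) * f w)"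
      by (simp add: sum.distrib flip: sum_divide_distrib)
    also have "(\<Sum>a\<in>UNIV. dy a f w * snd w $ a) = 1 * f w"
      by (rule euler_homogeneous[OF f_diff[OF w] w f_hom])
    finally have defect: "(\<Sum>a\<in>UNIV. dy a (\<lambda>u. half_contraction J u $ a) w) - (\<Sum>a\<in>UNIV. J w $ a $ a)
        = (real CARD('n) - 1) / 2 * f w"
      unfolding J[OF w] by (simp add: sum.distrib f_def[symmetric] field_simps fun_cong[OF f_def, symmetric])
    show ?thesis
      unfolding trace_defect_def defect using n by simp
  qed
  have pot: "potential J w = Z w" if "w \<in> S" for w
    using W[OF that] T[OF that] by (simp add: potential_def vec_eq_iff)
  then show "potential J z = Z z" using z by blast
  have "dy i (\<lambda>w. potential J w $ j) z = dy i (\<lambda>w. Z w $ j) z" for i j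
    by (rule dy_cong_open[OF S(1) z]) (simp add: pot)
  then show "radial_covector J z = A z"
    using radial_covector_eq[OF S(2)[OF z], of J "\<lambda>i. A z $ i"] J[OF z] by (simp add: vec_eq_iff)
qed

text \<open>
  By homogeneity the last term of the affine equation is \<open>2 J - 2 \<partial>W\<close> with \<open>W\<close> half of the
  contraction of \<open>J\<close> with \<open>y\<close>. So, whatever the value of the bracket, the equation expresses
  \<open>J - \<partial>W\<close> as a combination of \<open>B \<otimes> C\<close> and of the identity; the multiple of the identity is
  the trace defect, and it is absorbed by correcting \<open>W\<close> by a multiple of \<open>y\<close>.
\<close>

lemma affine_equation_imp_decomposition:
  fixes J :: "(real ^ 'n::finite) \<times> (real ^ 'n) \<Rightarrow> real ^ 'n ^ 'n"
  assumes n: "CARD('n) \<ge> 2" and S: "open S" "\<And>w. w \<in> S \<Longrightarrow> snd w \<noteq> 0"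
    and J: "\<And>w. w \<in> S \<Longrightarrow> smooth_ext_at S w J" "homogeneous_on S 1 J"
    and eq: "\<And>w. w \<in> S \<Longrightarrow> affine_equation F J w"
    and z: "z \<in> S"
  shows "J z $ i $ j = dy i (\<lambda>w. potential J w $ j) z + radial_covector J z $ i * snd z $ j"
proof -
  define B where "B = (\<lambda>w b. affine_bracket F J b w)"
  define Bs where "Bs = (\<lambda>w. \<Sum>b\<in>UNIV. B w b * snd w $ b)"
  define W where "W = half_contraction J"
  have Jd: "(\<lambda>u. J u $ i $ j) differentiable (at w)" if "w \<in> S" for w i j
    by (rule smooth_ext_at_differentiable[OF S(1) that smooth_ext_at_nth[OF smooth_ext_at_nth[OF J(1)[OF that]]]])
  have Wd: "(\<lambda>u. W u $ j) differentiable (at w)" if "w \<in> S" for w j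
    unfolding W_def
    by (rule smooth_ext_at_differentiable[OF S(1) that smooth_ext_at_nth[OF smooth_ext_at_half_contraction[OF J(1)[OF that]]]])
  have Td: "trace_defect J differentiable (at w)" if "w \<in> S" for w
    by (rule smooth_ext_at_differentiable[OF S(1) that smooth_ext_at_trace_defect[OF S(1) J(1)[OF that]]])
  have main: "2 * J w $ i $ j - 2 * dy i (\<lambda>u. W u $ j) w = B w i * snd w $ j - Bs w * of_bool (j = i)"
    if w: "w \<in> S" for w i j
  proof -
    have "(\<Sum>b\<in>UNIV. B w b * (of_bool (b = i) * snd w $ j - snd w $ b * of_bool (j = i)))
        = B w i * snd w $ j - Bs w * of_bool (j = i)"
      unfolding Bs_def by (rule sum_antisymmetrizer)
    moreover have "(\<Sum>a\<in>UNIV. (dy a (\<lambda>u. J u $ i $ j) w - dy i (\<lambda>u. J u $ a $ j) w) * snd w $ a)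
        = 2 * J w $ i $ j - 2 * dy i (\<lambda>u. W u $ j) w"
    proof -
      have "(\<Sum>a\<in>UNIV. dy a (\<lambda>u. J u $ i $ j) w * snd w $ a) = 1 * J w $ i $ j"
        by (rule euler_homogeneous[OF Jd[OF w] w homogeneous_on_nth[OF homogeneous_on_nth[OF J(2)]]])
      moreover have "dy i (\<lambda>u. W u $ j) w
          = 1/2 * (\<Sum>a\<in>UNIV. dy i (\<lambda>u. J u $ a $ j) w * snd w $ a + J w $ a $ j * of_bool (i = a))"
      proof -
        have "dy i (\<lambda>u. W u $ j) w = dy i (\<lambda>u. 1/2 * (\<Sum>a\<in>UNIV. J u $ a $ j * snd u $ a)) w"
          by (simp add: W_def half_contraction_def)
        also have "\<dots> = 1/2 * (\<Sum>a\<in>UNIV. dy i (\<lambda>u. J u $ a $ j * snd u $ a) w)"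
          using Jd[OF w] by (subst dy_cmult dy_sum; simp add: differentiable_sum differentiable_mult)+
        finally show ?thesis
          using Jd[OF w] by (simp add: dy_mult dy_snd_nth)
      qed
      ultimately show ?thesis
        by (simp add: left_diff_distrib sum_subtractf sum.distrib)
    qed
    ultimately show ?thesis
      using eq[OF w] unfolding affine_equation_def B_def by simp
  qed
  have TB: "trace_defect J w = Bs w" if w: "w \<in> S" for w
  proof -
    have "(\<Sum>a\<in>UNIV. 2 * J w $ a $ a - 2 * dy a (\<lambda>u. W u $ a) w) = (\<Sum>a\<in>UNIV. B w a * snd w $ a - Bs w)"
      using main[OF w] by simp
    then have "2 * ((\<Sum>a\<in>UNIV. dy a (\<lambda>u. W u $ a) w) - (\<Sum>a\<in>UNIV. J w $ a $ a)) = (real CARD('n) - 1) * Bs w"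
      by (simp add: sum_subtractf Bs_def[symmetric] fun_cong[OF Bs_def, symmetric] algebra_simps flip: sum_distrib_left)
    then show ?thesis
      using n by (simp add: trace_defect_def W_def field_simps)
  qed
  have dP: "dy i (\<lambda>w. potential J w $ j) z
      = dy i (\<lambda>w. W w $ j) z - 1/2 * (dy i (trace_defect J) z * snd z $ j + trace_defect J z * of_bool (i = j))" for i j
  proof -
    have "dy i (\<lambda>w. potential J w $ j) z = dy i (\<lambda>w. W w $ j - 1/2 * (trace_defect J w * snd w $ j)) z"
      by (simp add: potential_def W_def)
    also have "\<dots> = dy i (\<lambda>w. W w $ j) z - dy i (\<lambda>w. 1/2 * (trace_defect J w * snd w $ j)) z"
      by (rule dy_diff[OF Wd[OF z]]) (intro differentiable_mult differentiable_const Td[OF z] differentiable_snd_nth)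
    also have "dy i (\<lambda>w. 1/2 * (trace_defect J w * snd w $ j)) z = 1/2 * dy i (\<lambda>w. trace_defect J w * snd w $ j) z"
      by (rule dy_cmult) (intro differentiable_mult Td[OF z] differentiable_snd_nth)
    also have "dy i (\<lambda>w. trace_defect J w * snd w $ j) z
        = dy i (trace_defect J) z * snd z $ j + trace_defect J z * of_bool (i = j)"
      by (subst dy_mult[OF Td[OF z] differentiable_snd_nth]) (simp add: dy_snd_nth)
    finally show ?thesis .
  qed
  have key: "J z $ i $ j = dy i (\<lambda>w. potential J w $ j) z + (1/2 * (B z i + dy i (trace_defect J) z)) * snd z $ j" for i j
    using main[OF z, of i j] unfolding dP TB[OF z] by (auto simp: algebra_simps)
  show ?thesis
    using radial_covector_eq[OF S(2)[OF z], of J "\<lambda>i. 1/2 * (B z i + dy i (trace_defect J) z)", OF key] key by simp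
qed

text \<open>
  The symmetry moves the derivative of the contraction \<open>J\<^sub>a\<^sup>jy\<^sup>a\<close> into the direction of \<open>y\<close>, where it is
  given by homogeneity; the derivative of \<open>y\<^sup>a\<close> gives a second copy of \<open>J\<close>.
\<close>

lemma symmetric_imp_vertical_derivative:
  fixes J :: "(real ^ 'n::finite) \<times> (real ^ 'n) \<Rightarrow> real ^ 'n ^ 'n"
  assumes J: "\<And>i j. (\<lambda>u. J u $ i $ j) differentiable (at z)" "homogeneous_on S 1 J" and z: "z \<in> S"
    and sym: "\<And>i j k. dy j (\<lambda>w. J w $ i $ k) z = dy i (\<lambda>w. J w $ j $ k) z"
  shows "J z $ i $ j = dy i (\<lambda>w. half_contraction J w $ j) z"
proof -
  have "dy i (\<lambda>w. half_contraction J w $ j) z = dy i (\<lambda>w. 1/2 * (\<Sum>a\<in>UNIV. J w $ a $ j * snd w $ a)) z"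
    by (simp add: half_contraction_def)
  also have "\<dots> = 1/2 * dy i (\<lambda>w. \<Sum>a\<in>UNIV. J w $ a $ j * snd w $ a) z"
    by (rule dy_cmult) (simp add: J(1) differentiable_sum differentiable_mult)
  also have "dy i (\<lambda>w. \<Sum>a\<in>UNIV. J w $ a $ j * snd w $ a) z
      = (\<Sum>a\<in>UNIV. dy i (\<lambda>w. J w $ a $ j * snd w $ a) z)"
    by (rule dy_sum) (simp add: J(1) differentiable_mult)
  also have "\<dots> = (\<Sum>a\<in>UNIV. dy a (\<lambda>w. J w $ i $ j) z * snd z $ a) + J z $ i $ j"
    using sym[of i _ j] by (simp add: dy_mult J(1) dy_snd_nth sum.distrib)
  also have "(\<Sum>a\<in>UNIV. dy a (\<lambda>w. J w $ i $ j) z * snd z $ a) = 1 * J z $ i $ j"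
    by (rule euler_homogeneous[OF J(1) z homogeneous_on_nth[OF homogeneous_on_nth[OF J(2)]]])
  finally show ?thesis by simp
qed

section \<open>Invariance of the affine equation\<close>

text \<open>
  Euler's identity is used for the derivatives of \<open>F\<close>, of degree one, and then for \<open>F\<close> itself.
\<close>

lemma y_low_contraction:
  fixes F :: "(real ^ 'n::finite) \<times> (real ^ 'n) \<Rightarrow> real"
  assumes S: "open S" "conic_set S" and F: "C_inf_on S F" "homogeneous_on S 2 F" and z: "z \<in> S"
  shows "(\<Sum>a\<in>UNIV. y_low F a z * snd z $ a) = F z"
proof -
  have Fd: "F differentiable (at w)" "dy i F differentiable (at w)" if "w \<in> S" for w i
    using that C_inf_on_differentiable[OF F(1)] C_inf_on_differentiable[OF C_inf_on_derivative[OF F(1)]]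
    by (auto simp: dy_def[abs_def])
  have hom: "homogeneous_on S 1 (dy i F)" for i
    using homogeneous_on_dy[OF S Fd(1) F(2)] by simp
  have y_low: "y_low F a z = 1/2 * dy a F z" for a
    using euler_homogeneous[OF Fd(2)[OF z] z hom, of a]
    by (simp add: y_low_def fund_def flip: sum_divide_distrib)
  have "(\<Sum>a\<in>UNIV. y_low F a z * snd z $ a) = 1/2 * (\<Sum>a\<in>UNIV. dy a F z * snd z $ a)"
    unfolding y_low by (simp add: sum_divide_distrib)
  also have "\<dots> = F z"
    using euler_homogeneous[OF Fd(1)[OF z] z F(2)] by simp
  finally show ?thesis .
qed

text \<open>
  The fundamental tensor is homogeneous of degree zero, so its derivative in direction \<open>y\<close> vanishes.
\<close>

lemma mean_cartan_contraction:
  fixes F :: "(real ^ 'n::finite) \<times> (real ^ 'n) \<Rightarrow> real"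
  assumes S: "open S" "conic_set S" and F: "C_inf_on S F" "homogeneous_on S 2 F" and z: "z \<in> S"
  shows "(\<Sum>a\<in>UNIV. mean_cartan F a z * snd z $ a) = 0"
proof -
  have smooth: "C_inf_on S (dy i F)" "C_inf_on S (dy j (dy i F))" for i j
    unfolding dy_def[abs_def] by (intro C_inf_on_derivative F(1))+
  have "homogeneous_on S (2 - 1) (dy i F)" for i
    by (rule homogeneous_on_dy[OF S C_inf_on_differentiable[OF F(1)] F(2)])
  from homogeneous_on_dy[OF S C_inf_on_differentiable[OF smooth(1)] this]
  have hom: "homogeneous_on S 0 (dy j (dy i F))" for i j by simp
  have fund: "(\<lambda>w. fund F w $ i $ j) = (\<lambda>w. 1/2 * dy j (dy i F) w)" for i j
    by (simp add: fund_def)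
  have cartan: "cartan F i j k z = 1/4 * dy k (dy j (dy i F)) z" for i j k
    unfolding cartan_def fund dy_cmult[OF C_inf_on_differentiable[OF smooth(2) z]] by simp
  have "(\<Sum>k\<in>UNIV. cartan F i j k z * snd z $ k) = 1/4 * (\<Sum>k\<in>UNIV. dy k (dy j (dy i F)) z * snd z $ k)" for i j
    unfolding cartan by (simp add: sum_divide_distrib)
  moreover have "(\<Sum>k\<in>UNIV. dy k (dy j (dy i F)) z * snd z $ k) = 0" for i j
    using euler_homogeneous[OF C_inf_on_differentiable[OF smooth(2) z] z hom] by simp
  ultimately have C0: "(\<Sum>k\<in>UNIV. cartan F i j k z * snd z $ k) = 0" for i j by simp
  have "(\<Sum>k\<in>UNIV. mean_cartan F k z * snd z $ k)
      = (\<Sum>a\<in>UNIV. \<Sum>b\<in>UNIV. cofund F z $ a $ b * (\<Sum>k\<in>UNIV. cartan F a b k z * snd z $ k))"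
    unfolding mean_cartan_def sum_distrib_right sum_distrib_left
    by (subst sum.swap, rule sum.cong, simp, subst sum.swap) (simp add: mult.assoc)
  then show ?thesis by (simp add: C0)
qed

text \<open>
  Adding \<open>A \<otimes> C\<close> to \<open>J\<close> changes the bracket by \<open>A\<^sub>b - A\<^bsub>a\<cdot>b\<^esub>y\<^sup>a\<close>: this uses \<open>y\<^sub>ay\<^sup>a = L\<close>,
  \<open>C\<^sub>ay\<^sup>a = 0\<close> and that the coefficient \<open>n + 2\<close> exceeds the contribution \<open>n + 1\<close> of the
  divergence terms by one. The two expressions whose difference is the left-hand side of the
  equation change by the same amount.
\<close>

lemma affine_equation_radial_invariance:
  fixes P :: "(real ^ 'n::finite) \<times> (real ^ 'n) \<Rightarrow> real ^ 'n ^ 'n"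
  assumes S: "open S" "z \<in> S"
    and F: "(\<Sum>a\<in>UNIV. y_low F a z * snd z $ a) = F z" "(\<Sum>a\<in>UNIV. mean_cartan F a z * snd z $ a) = 0" "F z \<noteq> 0"
    and P: "\<And>i j. (\<lambda>w. P w $ i $ j) differentiable (at z)"
    and A: "\<And>i. (\<lambda>w. A w $ i) differentiable (at z)" "homogeneous_on S 0 A"
    and J: "\<And>w i j. w \<in> S \<Longrightarrow> J w $ i $ j = P w $ i $ j + A w $ i * snd w $ j"
  shows "affine_equation F J z \<longleftrightarrow> affine_equation F P z"
proof -
  define f where "f = (\<Sum>a\<in>UNIV. A z $ a * snd z $ a)"
  define K where "K = (\<lambda>b. \<Sum>a\<in>UNIV. dy b (\<lambda>w. A w $ a) z * snd z $ a)"
  have eA: "(\<Sum>a\<in>UNIV. dy a (\<lambda>w. A w $ b) z * snd z $ a) = 0" for b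
    using euler_homogeneous[OF A(1) S(2) homogeneous_on_nth[OF A(2)]] by simp
  have K0: "(\<Sum>b\<in>UNIV. K b * snd z $ b) = 0"
  proof -
    have "(\<Sum>b\<in>UNIV. K b * snd z $ b) = (\<Sum>a\<in>UNIV. \<Sum>b\<in>UNIV. dy b (\<lambda>w. A w $ a) z * snd z $ a * snd z $ b)"
      unfolding K_def sum_distrib_right by (rule sum.swap)
    also have "\<dots> = (\<Sum>a\<in>UNIV. (\<Sum>b\<in>UNIV. dy b (\<lambda>w. A w $ a) z * snd z $ b) * snd z $ a)"
      by (simp add: sum_distrib_right sum_distrib_left mult_ac)
    finally show ?thesis by (simp add: eA)
  qed
  have dJ: "dy c (\<lambda>w. J w $ i $ j) z
      = dy c (\<lambda>w. P w $ i $ j) z + (dy c (\<lambda>w. A w $ i) z * snd z $ j + A z $ i * of_bool (c = j))" for c i j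
  proof -
    have "dy c (\<lambda>w. J w $ i $ j) z = dy c (\<lambda>w. P w $ i $ j + A w $ i * snd w $ j) z"
      by (rule dy_cong_open[OF S J])
    also have "\<dots> = dy c (\<lambda>w. P w $ i $ j) z + dy c (\<lambda>w. A w $ i * snd w $ j) z"
      by (rule dy_add[OF P]) (intro differentiable_mult A(1) differentiable_snd_nth)
    also have "dy c (\<lambda>w. A w $ i * snd w $ j) z = dy c (\<lambda>w. A w $ i) z * snd z $ j + A z $ i * of_bool (c = j)"
      by (subst dy_mult[OF A(1) differentiable_snd_nth]) (simp add: dy_snd_nth)
    finally show ?thesis .
  qed
  have bracket: "affine_bracket F J b z = affine_bracket F P b z + A z $ b - K b" for b
  proof -
    have "(\<Sum>a\<in>UNIV. y_low F a z / F z * J z $ b $ a)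
        = (\<Sum>a\<in>UNIV. y_low F a z / F z * P z $ b $ a) + (\<Sum>a\<in>UNIV. y_low F a z * snd z $ a) / F z * A z $ b"
      unfolding J[OF S(2)] by (simp add: sum.distrib sum_divide_distrib sum_distrib_right sum_distrib_left algebra_simps)
    also have "\<dots> = (\<Sum>a\<in>UNIV. y_low F a z / F z * P z $ b $ a) + A z $ b"
      using F by simp
    finally have 1: "(\<Sum>a\<in>UNIV. y_low F a z / F z * J z $ b $ a)
        = (\<Sum>a\<in>UNIV. y_low F a z / F z * P z $ b $ a) + A z $ b" .
    have "(\<Sum>a\<in>UNIV. mean_cartan F a z * J z $ b $ a)
        = (\<Sum>a\<in>UNIV. mean_cartan F a z * P z $ b $ a) + (\<Sum>a\<in>UNIV. mean_cartan F a z * snd z $ a) * A z $ b"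
      unfolding J[OF S(2)] by (simp add: sum.distrib sum_distrib_right sum_distrib_left algebra_simps)
    then have 2: "(\<Sum>a\<in>UNIV. mean_cartan F a z * J z $ b $ a) = (\<Sum>a\<in>UNIV. mean_cartan F a z * P z $ b $ a)"
      using F by simp
    have 3: "(\<Sum>a\<in>UNIV. dy a (\<lambda>w. J w $ b $ a) z + dy b (\<lambda>w. J w $ a $ a) z)
        = (\<Sum>a\<in>UNIV. dy a (\<lambda>w. P w $ b $ a) z + dy b (\<lambda>w. P w $ a $ a) z)
          + (real CARD('n) + 1) * A z $ b + K b"
      unfolding dJ using eA[of b] by (simp add: sum.distrib K_def algebra_simps)
    show ?thesis
      unfolding affine_bracket_def 1 2 3 by (simp add: algebra_simps)
  qed
  have "(\<Sum>b\<in>UNIV. affine_bracket F J b z * (of_bool (b = i) * snd z $ j - snd z $ b * of_bool (j = i)))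
      = (\<Sum>b\<in>UNIV. affine_bracket F P b z * (of_bool (b = i) * snd z $ j - snd z $ b * of_bool (j = i)))
        + (A z $ i * snd z $ j - K i * snd z $ j - f * of_bool (j = i))" (is "?BJ i j = ?BP i j + ?d i j") for i j
  proof -
    have "?BJ i j = ?BP i j + (\<Sum>b\<in>UNIV. (A z $ b - K b) * (of_bool (b = i) * snd z $ j - snd z $ b * of_bool (j = i)))"
      unfolding bracket sum.distrib[symmetric] by (simp add: algebra_simps)
    also have "(\<Sum>b\<in>UNIV. (A z $ b - K b) * (of_bool (b = i) * snd z $ j - snd z $ b * of_bool (j = i)))
        = (A z $ i - K i) * snd z $ j - (\<Sum>b\<in>UNIV. (A z $ b - K b) * snd z $ b) * of_bool (j = i)"
      by (rule sum_antisymmetrizer)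
    finally show ?thesis by (simp add: K0 f_def left_diff_distrib sum_subtractf)
  qed
  moreover have "(\<Sum>a\<in>UNIV. (dy a (\<lambda>w. J w $ i $ j) z - dy i (\<lambda>w. J w $ a $ j) z) * snd z $ a)
      = (\<Sum>a\<in>UNIV. (dy a (\<lambda>w. P w $ i $ j) z - dy i (\<lambda>w. P w $ a $ j) z) * snd z $ a)
        + (A z $ i * snd z $ j - K i * snd z $ j - f * of_bool (j = i))" for i j
  proof -
    have "(\<Sum>a\<in>UNIV. (dy a (\<lambda>w. J w $ i $ j) z - dy i (\<lambda>w. J w $ a $ j) z) * snd z $ a)
      = (\<Sum>a\<in>UNIV. (dy a (\<lambda>w. P w $ i $ j) z - dy i (\<lambda>w. P w $ a $ j) z) * snd z $ a
         + (dy a (\<lambda>w. A w $ i) z * snd z $ a) * snd z $ j + A z $ i * (of_bool (a = j) * snd z $ a)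
         - (dy i (\<lambda>w. A w $ a) z * snd z $ a) * snd z $ j - (A z $ a * snd z $ a) * of_bool (i = j))"
      unfolding dJ by (rule sum.cong) (simp_all add: algebra_simps)
    also have "\<dots> = (\<Sum>a\<in>UNIV. (dy a (\<lambda>w. P w $ i $ j) z - dy i (\<lambda>w. P w $ a $ j) z) * snd z $ a)
       + (\<Sum>a\<in>UNIV. dy a (\<lambda>w. A w $ i) z * snd z $ a) * snd z $ j + A z $ i * snd z $ j
       - K i * snd z $ j - f * of_bool (i = j)"
      unfolding K_def f_def sum_subtractf sum.distrib sum_distrib_right[symmetric] sum_distrib_left[symmetric] by simp
    finally show ?thesis by (simp add: eA eq_commute[of i j])
  qed
  ultimately show ?thesis
    unfolding affine_equation_def by simp
qed


section \<open>Smoothness of the metric connection\<close>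

lemma smooth_ext_at_fund:
  assumes "open S" "smooth_ext_at S z F"
  shows "smooth_ext_at S z (\<lambda>w. fund F w $ i $ j)"
proof -
  have "smooth_ext_at S z (\<lambda>w. 1/2 * dy j (dy i F) w)"
    by (intro smooth_ext_at_mult smooth_ext_at_const smooth_ext_at_dy assms)
  then show ?thesis by (simp add: fund_def)
qed

lemma fund_cong_open:
  assumes "open S" "z \<in> S" "\<And>w. w \<in> S \<Longrightarrow> F w = G w"
  shows "fund F z = fund G z"
proof -
  have "dy i F w = dy i G w" if "w \<in> S" for i w
    by (rule dy_cong_open[OF assms(1) that assms(3)])
  then have "dy j (dy i F) z = dy j (dy i G) z" for i j
    by (rule dy_cong_open[OF assms(1,2)])
  then show ?thesis by (simp add: fund_def)
qed

text \<open>
  Non-degeneracy is an open condition, so the inverse of the fundamental tensor of a local extension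
  \<open>G\<close> is smooth on a neighbourhood of \<open>z\<close> once \<open>G\<close> is non-degenerate at \<open>z\<close>.
\<close>

lemma smooth_ext_at_cofund:
  fixes F :: "(real ^ 'n::finite) \<times> (real ^ 'n) \<Rightarrow> real"
  assumes S: "open S" and G: "open U" "z \<in> U" "C_inf_on U G" "\<And>u. u \<in> U \<Longrightarrow> u \<in> S \<Longrightarrow> G u = F u"
    and inv: "invertible (fund G z)"
  shows "smooth_ext_at S z (\<lambda>w. cofund F w $ a $ b)"
proof -
  have "C_inf_on U (dy j (dy i G))" for i j
    unfolding dy_def[abs_def] by (intro C_inf_on_derivative G(3))
  then have fund: "C_inf_on U (\<lambda>w. fund G w $ i $ j)" for i j
    using C_inf_on_mult[OF G(1) C_inf_on_const, of "dy j (dy i G)" "1/2"] by (simp add: fund_def)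
  define V where "V = U \<inter> (\<lambda>w. det (fund G w)) -` (- {0})"
  have "continuous_on U (\<lambda>w. det (fund G w))"
    by (intro continuous_at_imp_continuous_on ballI C_inf_on_continuous[OF C_inf_on_det[OF G(1) fund]])
  then have V: "open V"
    unfolding V_def by (intro continuous_open_preimage G(1)) auto
  show ?thesis
  proof (rule smooth_ext_atI[OF V])
    show "z \<in> V" using G(2) inv by (simp add: V_def invertible_det_nz)
    show "C_inf_on V (\<lambda>w. cofund G w $ a $ b)"
      unfolding cofund_def
      by (rule C_inf_on_matrix_inv[OF V C_inf_on_subset[OF fund]]) (auto simp: V_def invertible_det_nz)
    fix u assume u: "u \<in> V" "u \<in> S"
    have "fund G u = fund F u"
      by (rule fund_cong_open[OF open_Int[OF G(1) S]]) (use u G(4) in \<open>auto simp: V_def\<close>)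
    then show "cofund G u $ a $ b = cofund F u $ a $ b"
      by (simp add: cofund_def)
  qed
qed

lemma smooth_ext_at_spray:
  assumes S: "open S" and G: "open U" "z \<in> U" "C_inf_on U G" "\<And>u. u \<in> U \<Longrightarrow> u \<in> S \<Longrightarrow> G u = F u"
    and inv: "invertible (fund G z)"
  shows "smooth_ext_at S z (spray F k)"
proof -
  have F: "smooth_ext_at S z F"
    by (rule smooth_ext_atI[OF G])
  have "smooth_ext_at S z (\<lambda>w. spray F k w)"
    unfolding spray_def
    by (intro smooth_ext_at_mult smooth_ext_at_sum smooth_ext_at_diff smooth_ext_at_const
        smooth_ext_at_cofund[OF S G inv] smooth_ext_at_dx[OF S smooth_ext_at_fund[OF S F]] smooth_ext_at_snd_nth)
  then show ?thesis by simp
qed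

lemma smooth_ext_at_nl:
  assumes S: "open S" and G: "open U" "z \<in> U" "C_inf_on U G" "\<And>u. u \<in> U \<Longrightarrow> u \<in> S \<Longrightarrow> G u = F u"
    and inv: "invertible (fund G z)"
  shows "smooth_ext_at S z (nl F i k)"
proof -
  have "smooth_ext_at S z (dy i (spray F k))"
    by (rule smooth_ext_at_dy[OF S smooth_ext_at_spray[OF S G inv]])
  then show ?thesis by (simp add: nl_def[abs_def] dy_def[abs_def])
qed

lemma dy_commute:
  assumes "open S" "z \<in> S" "smooth_ext_at S z f"
  shows "dy i (dy j f) z = dy j (dy i f) z"
proof -
  obtain U F where U: "open U" "z \<in> U" "C_inf_on U F" "\<And>u. u \<in> U \<Longrightarrow> u \<in> S \<Longrightarrow> F u = f u"
    using assms(3) by (rule smooth_ext_atE) (rule that)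
  have o: "open (U \<inter> S)" and zo: "z \<in> U \<inter> S" using U assms by auto
  have 1: "dy k F w = dy k f w" if "w \<in> U \<inter> S" for k w
    by (rule dy_cong_open[OF o that]) (use U in auto)
  have 2: "dy l (dy k F) z = dy l (dy k f) z" for k l
    by (rule dy_cong_open[OF o zo 1])
  have "dy i (dy j F) z = dy j (dy i F) z"
    unfolding dy_def by (rule symmetric_second_derivative[OF U(1-3)])
  then show ?thesis unfolding 2 .
qed

section \<open>Changes of charts of the tangent bundle\<close>

abbreviation overlap :: "('m, 'n::finite) chart \<Rightarrow> ('m, 'n) chart \<Rightarrow> (real ^ 'n) set" where
  "overlap c c' \<equiv> snd c ` (fst c \<inter> fst c')"

abbreviation Jac :: "('m, 'n::finite) chart \<Rightarrow> ('m, 'n) chart \<Rightarrow> real ^ 'n \<Rightarrow> real ^ 'n ^ 'n" where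
  "Jac c c' x \<equiv> jacobian (transition c c') (at x)"

text \<open>
  The change of induced charts of the tangent bundle; it is meaningful where the base point is in the
  overlap.
\<close>

definition tchange ::
  "('m, 'n::finite) chart \<Rightarrow> ('m, 'n) chart \<Rightarrow> (real ^ 'n) \<times> (real ^ 'n) \<Rightarrow> (real ^ 'n) \<times> (real ^ 'n)" where
  "tchange c c' z = (transition c c' (fst z), Jac c c' (fst z) *v snd z)"

lemma isCont_vecI:
  fixes f :: "'a::t2_space \<Rightarrow> 'b::topological_space ^ 'n::finite"
  assumes "\<And>i. isCont (\<lambda>u. f u $ i) z"
  shows "isCont f z"
  using assms unfolding isCont_def by (intro vec_tendstoI)

locale smooth_charts =
  fixes \<Phi> :: "('m::t2_space, 'n::finite) chart set"
  assumes atlas: "smooth_atlas \<Phi>"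
begin

lemma chart_homeomorphism:
  assumes "c \<in> \<Phi>"
  obtains g where "homeomorphism (fst c) (snd c ` fst c) (snd c) g" "open (fst c)" "open (snd c ` fst c)"
  using assms atlas unfolding smooth_atlas_def is_chart_def by blast

lemma chart_inj: "c \<in> \<Phi> \<Longrightarrow> inj_on (snd c) (fst c)"
  by (rule chart_homeomorphism) (auto simp: homeomorphism_def intro: inj_on_inverseI)

lemma open_chart_domain: "c \<in> \<Phi> \<Longrightarrow> open (fst c)"
  by (rule chart_homeomorphism)

lemma open_chart_image:
  assumes "c \<in> \<Phi>" "open V" "V \<subseteq> fst c"
  shows "open (snd c ` V)"
proof -
  obtain g where g: "homeomorphism (fst c) (snd c ` fst c) (snd c) g" "open (fst c)" "open (snd c ` fst c)"
    by (rule chart_homeomorphism[OF assms(1)])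
  have "openin (top_of_set (snd c ` fst c)) (snd c ` V)"
    using homeomorphism_imp_open_map[OF g(1), of V] assms openin_open_eq[OF g(2)] by auto
  then show ?thesis
    using g(3) openin_open_eq by blast
qed

lemma open_overlap: "c \<in> \<Phi> \<Longrightarrow> c' \<in> \<Phi> \<Longrightarrow> open (overlap c c')"
  by (intro open_chart_image open_Int open_chart_domain) auto

lemma transition_chart: "c \<in> \<Phi> \<Longrightarrow> p \<in> fst c \<Longrightarrow> transition c c' (snd c p) = snd c' p"
  unfolding transition_def using the_inv_into_f_f[OF chart_inj] by simp

lemma transition_smooth:
  assumes "c \<in> \<Phi>" "c' \<in> \<Phi>"
  shows "C_inf_on (overlap c c') (transition c c')"
proof (rule smooth_on_imp_C_inf_on[OF open_overlap[OF assms]])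
  show "smooth_on (overlap c c') (transition c c')"
    using atlas assms unfolding smooth_atlas_def by blast
qed

lemma transition_has_derivative:
  assumes "c \<in> \<Phi>" "c' \<in> \<Phi>" "x \<in> overlap c c'"
  shows "(transition c c' has_derivative (\<lambda>h. Jac c c' x *v h)) (at x)"
  using C_inf_on_differentiable[OF transition_smooth[OF assms(1,2)] assms(3)] by (simp add: jacobian_works)

lemma jacobianI:
  assumes "(f has_derivative (\<lambda>h. M *v h)) (at x)"
  shows "jacobian f (at x) = (M :: real ^ 'a::finite ^ 'b::finite)"
  unfolding jacobian_def frechet_derivative_at[OF assms, symmetric] by (rule matrix_of_matrix_vector_mul)

lemma Jac_cocycle:
  assumes c: "c \<in> \<Phi>" "c' \<in> \<Phi>" "c'' \<in> \<Phi>" and p: "p \<in> fst c" "p \<in> fst c'" "p \<in> fst c''"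
  shows "Jac c' c'' (snd c' p) ** Jac c c' (snd c p) = Jac c c'' (snd c p)"
proof -
  have 1: "(transition c c' has_derivative (\<lambda>h. Jac c c' (snd c p) *v h)) (at (snd c p))"
    using p by (intro transition_has_derivative c) auto
  have 2: "(transition c' c'' has_derivative (\<lambda>h. Jac c' c'' (snd c' p) *v h)) (at (transition c c' (snd c p)))"
    unfolding transition_chart[OF c(1) p(1)] using p by (intro transition_has_derivative c) auto
  have "((\<lambda>x. transition c' c'' (transition c c' x)) has_derivative
      (\<lambda>h. (Jac c' c'' (snd c' p) ** Jac c c' (snd c p)) *v h)) (at (snd c p))"
    using has_derivative_compose[OF 1 2] by (simp add: matrix_vector_mul_assoc)
  then have "(transition c c'' has_derivative (\<lambda>h. (Jac c' c'' (snd c' p) ** Jac c c' (snd c p)) *v h)) (at (snd c p))"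
  proof (rule has_derivative_transform_within_open)
    show "open (snd c ` (fst c \<inter> fst c' \<inter> fst c''))"
      using c by (intro open_chart_image open_Int open_chart_domain) auto
    show "snd c p \<in> snd c ` (fst c \<inter> fst c' \<inter> fst c'')" using p by blast
    fix x assume "x \<in> snd c ` (fst c \<inter> fst c' \<inter> fst c'')"
    then show "transition c' c'' (transition c c' x) = transition c c'' x"
      using c by (auto simp: transition_chart)
  qed
  then show ?thesis by (rule jacobianI[symmetric])
qed

lemma Jac_self:
  assumes "c \<in> \<Phi>" "p \<in> fst c"
  shows "Jac c c (snd c p) = mat 1"
proof (rule jacobianI)
  have "((\<lambda>x. x) has_derivative (\<lambda>h. mat 1 *v h)) (at (snd c p))"
    by simp
  then show "(transition c c has_derivative (\<lambda>h. mat 1 *v h)) (at (snd c p))"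
  proof (rule has_derivative_transform_within_open)
    show "open (snd c ` fst c)" by (rule open_chart_image[OF assms(1) open_chart_domain[OF assms(1)] subset_refl])
    show "snd c p \<in> snd c ` fst c" using assms by blast
    show "x = transition c c x" if "x \<in> snd c ` fst c" for x
      using that assms(1) by (auto simp: transition_chart)
  qed
qed

lemma Jac_inverse:
  assumes "c \<in> \<Phi>" "c' \<in> \<Phi>" "p \<in> fst c" "p \<in> fst c'"
  shows "Jac c' c (snd c' p) ** Jac c c' (snd c p) = mat 1"
  using Jac_cocycle[OF assms(1,2,1,3,4,3)] Jac_self[OF assms(1,3)] by simp

lemma Jac_entry:
  "Jac c c' x $ i $ j = frechet_derivative (transition c c') (at x) (axis j 1) $ i"
  by (simp add: jacobian_def matrix_def)

lemma Jac_smooth: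
  assumes "c \<in> \<Phi>" "c' \<in> \<Phi>"
  shows "C_inf_on (overlap c c') (\<lambda>x. Jac c c' x $ i $ j)"
  unfolding Jac_entry
  by (rule C_inf_on_vec_nth[OF open_overlap[OF assms] C_inf_on_derivative[OF transition_smooth[OF assms]]])

lemma isCont_transition_fst:
  assumes "c \<in> \<Phi>" "c' \<in> \<Phi>" "fst z \<in> overlap c c'"
  shows "isCont (\<lambda>u. transition c c' (fst u)) z"
  using isCont_o2[where a=z and f=fst and g="transition c c'"] C_inf_on_continuous[OF transition_smooth[OF assms(1,2)] assms(3)]
  by (simp add: isCont_fst)

lemma isCont_Jac_fst:
  assumes "c \<in> \<Phi>" "c' \<in> \<Phi>" "fst z \<in> overlap c c'"
  shows "isCont (\<lambda>u. Jac c c' (fst u) $ i $ j) z"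
  using isCont_o2[where a=z and f=fst and g="\<lambda>x. Jac c c' x $ i $ j"] C_inf_on_continuous[OF Jac_smooth[OF assms(1,2)] assms(3)]
  by (simp add: isCont_fst)

lemma transition_in_overlap:
  assumes "c \<in> \<Phi>" "x \<in> overlap c c'"
  shows "transition c c' x \<in> overlap c' c"
  using assms by (auto simp: transition_chart)

lemma isCont_Jac_transition:
  assumes "c \<in> \<Phi>" "c' \<in> \<Phi>" "fst z \<in> overlap c c'"
  shows "isCont (\<lambda>u. Jac c' c (transition c c' (fst u)) $ i $ j) z"
  using isCont_o2[OF isCont_transition_fst[OF assms], of "\<lambda>x. Jac c' c x $ i $ j"]
    C_inf_on_continuous[OF Jac_smooth[OF assms(2,1)] transition_in_overlap[OF assms(1,3)]]
  by simp

lemma isCont_tchange: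
  assumes "c \<in> \<Phi>" "c' \<in> \<Phi>" "fst z \<in> overlap c c'"
  shows "isCont (tchange c c') z"
proof -
  have "isCont (\<lambda>u. Jac c c' (fst u) *v snd u) z"
  proof (rule isCont_vecI)
    fix i
    have "isCont (\<lambda>u. \<Sum>j\<in>UNIV. Jac c c' (fst u) $ i $ j * snd u $ j) z"
      by (intro isCont_sum ballI isCont_mult isCont_Jac_fst[OF assms] isCont_vec_nth isCont_snd continuous_ident)
    then show "isCont (\<lambda>u. (Jac c c' (fst u) *v snd u) $ i) z"
      by (simp add: matrix_vector_mult_def)
  qed
  then have "isCont (\<lambda>u. (transition c c' (fst u), Jac c c' (fst u) *v snd u)) z"
    by (intro isCont_Pair isCont_transition_fst[OF assms])
  then show ?thesis by (simp add: tchange_def[abs_def])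
qed

lemma tangent_bundle_iff:
  "w \<in> tangent_bundle \<Phi> \<longleftrightarrow>
     (\<forall>c\<in>\<Phi>. \<forall>c'\<in>\<Phi>. fst w \<in> fst c \<longrightarrow> fst w \<in> fst c' \<longrightarrow> snd w c' = Jac c c' (snd c (fst w)) *v snd w c) \<and>
     (\<forall>c. \<not> (c \<in> \<Phi> \<and> fst w \<in> fst c) \<longrightarrow> snd w c = 0)"
  unfolding tangent_bundle_def mem_Collect_eq case_prod_beta ..

lemma tangent_bundle_component:
  assumes "w \<in> tangent_bundle \<Phi>" "c \<in> \<Phi>" "c' \<in> \<Phi>" "fst w \<in> fst c" "fst w \<in> fst c'"
  shows "snd w c' = Jac c c' (snd c (fst w)) *v snd w c"
  using assms unfolding tangent_bundle_iff by blast

lemma tangent_bundle_default: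
  assumes "w \<in> tangent_bundle \<Phi>" "\<not> (c \<in> \<Phi> \<and> fst w \<in> fst c)"
  shows "snd w c = 0"
  using assms unfolding tangent_bundle_iff by blast

lemma tchart_tchange:
  assumes "c \<in> \<Phi>" "c' \<in> \<Phi>" "w \<in> tangent_bundle \<Phi>" "fst w \<in> fst c" "fst w \<in> fst c'"
  shows "tchart c' w = tchange c c' (tchart c w)"
  unfolding tchart_def tchange_def fst_conv snd_conv transition_chart[OF assms(1,4)]
    tangent_bundle_component[OF assms(3,1,2,4,5)] ..

lemma tchart_inj:
  assumes "c \<in> \<Phi>"
  shows "inj_on (tchart c) {w \<in> tangent_bundle \<Phi>. fst w \<in> fst c}"
proof (rule inj_onI)
  fix w u
  assume w: "w \<in> {w \<in> tangent_bundle \<Phi>. fst w \<in> fst c}" and u: "u \<in> {w \<in> tangent_bundle \<Phi>. fst w \<in> fst c}"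
    and eq: "tchart c w = tchart c u"
  have fst: "fst w = fst u"
    using inj_onD[OF chart_inj[OF assms], of "fst w" "fst u"] eq w u by (simp add: tchart_def)
  have "snd w c' = snd u c'" for c'
  proof (cases "c' \<in> \<Phi> \<and> fst w \<in> fst c'")
    case True
    have "snd w c = snd u c" using eq by (simp add: tchart_def)
    then show ?thesis
      using True w u fst tangent_bundle_component[of w c c'] tangent_bundle_component[of u c c'] assms by simp
  next
    case False
    then show ?thesis
      using w u fst tangent_bundle_default[of w c'] tangent_bundle_default[of u c'] by simp
  qed
  then show "w = u" using fst by (simp add: prod_eq_iff fun_eq_iff)
qed

text \<open>
  The components in the other charts are defined by the Jacobians; the cocycle rule makes them a
  tangent vector.
\<close>

lemma tchart_surj:
  assumes "c \<in> \<Phi>" "fst z \<in> snd c ` fst c"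
  obtains w where "w \<in> tangent_bundle \<Phi>" "fst w \<in> fst c" "tchart c w = z"
proof -
  obtain p where p: "p \<in> fst c" "fst z = snd c p" using assms by blast
  define v where "v = (\<lambda>c'. if c' \<in> \<Phi> \<and> p \<in> fst c' then Jac c c' (snd c p) *v snd z else 0)"
  have "(p, v) \<in> tangent_bundle \<Phi>"
    unfolding tangent_bundle_iff fst_conv snd_conv
  proof (intro conjI ballI allI impI)
    fix c' c'' assume c: "c' \<in> \<Phi>" "c'' \<in> \<Phi>" and pc: "p \<in> fst c'" "p \<in> fst c''"
    then show "v c'' = Jac c' c'' (snd c' p) *v v c'"
      using Jac_cocycle[OF assms(1) c p(1) pc] by (simp add: v_def matrix_vector_mul_assoc)
  next
    fix c' assume "\<not> (c' \<in> \<Phi> \<and> p \<in> fst c')"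
    then show "v c' = 0" unfolding v_def by (rule if_not_P)
  qed
  moreover have "tchart c (p, v) = z"
    using assms p by (simp add: tchart_def v_def Jac_self prod_eq_iff)
  ultimately show ?thesis using that[of "(p, v)"] p by simp
qed

lemma timg_Int:
  assumes "c \<in> \<Phi>" "U \<subseteq> tangent_bundle \<Phi>" "V \<subseteq> tangent_bundle \<Phi>"
  shows "timg c (U \<inter> V) = timg c U \<inter> timg c V"
proof -
  have "{w \<in> U \<inter> V. fst w \<in> fst c} = {w \<in> U. fst w \<in> fst c} \<inter> {w \<in> V. fst w \<in> fst c}" by blast
  then show ?thesis
    unfolding timg_def using assms by (simp add: inj_on_image_Int[OF tchart_inj[OF assms(1)]] subset_iff)
qed

text \<open>
  Stability under finite intersections rests on the injectivity of the induced charts.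
\<close>

lemma openin_tangent_topology:
  "openin (tangent_topology \<Phi>) U \<longleftrightarrow> U \<subseteq> tangent_bundle \<Phi> \<and> (\<forall>c\<in>\<Phi>. open (timg c U))"
proof -
  have "timg c (\<Union>\<U>) = (\<Union>U\<in>\<U>. timg c U)" for c :: "('m, 'n) chart" and \<U>
    by (auto simp: timg_def)
  then have "istopology (\<lambda>U. U \<subseteq> tangent_bundle \<Phi> \<and> (\<forall>c\<in>\<Phi>. open (timg c U)))"
    unfolding istopology_def by (auto simp: timg_Int)
  then show ?thesis
    unfolding tangent_topology_def by (simp add: topology_inverse')
qed

lemma timg_mem_iff:
  assumes "c \<in> \<Phi>" "D \<subseteq> tangent_bundle \<Phi>" "w \<in> tangent_bundle \<Phi>" "fst w \<in> fst c"
  shows "tchart c w \<in> timg c D \<longleftrightarrow> w \<in> D"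
proof
  assume "tchart c w \<in> timg c D"
  then obtain u where u: "u \<in> D" "fst u \<in> fst c" "tchart c w = tchart c u"
    unfolding timg_def by blast
  have "w = u"
    using assms(2-4) u by (intro inj_onD[OF tchart_inj[OF assms(1)] u(3)]) auto
  then show "w \<in> D" using u by simp
qed (use assms(4) in \<open>simp add: timg_def\<close>)

lemma timgE:
  assumes "z \<in> timg c D"
  obtains w where "w \<in> D" "fst w \<in> fst c" "z = tchart c w"
  using assms by (auto simp: timg_def)

text \<open>
  Read in another chart the set is the preimage of \<open>V\<close> under the change of charts, which is continuous.
\<close>

lemma openin_chart_preimage:
  assumes "c \<in> \<Phi>" "open V"
  shows "openin (tangent_topology \<Phi>) {w \<in> tangent_bundle \<Phi>. fst w \<in> fst c \<and> tchart c w \<in> V}" (is "openin _ ?T")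
  unfolding openin_tangent_topology
proof (intro conjI ballI)
  fix c' assume c': "c' \<in> \<Phi>"
  let ?O = "overlap c' c \<times> (UNIV :: (real ^ 'n) set)"
  have "timg c' ?T = ?O \<inter> tchange c' c -` V"
  proof (intro equalityI subsetI)
    fix z assume "z \<in> timg c' ?T"
    then obtain w where w: "w \<in> ?T" "fst w \<in> fst c'" "z = tchart c' w" by (rule timgE)
    then have "tchange c' c z \<in> V"
      using tchart_tchange[OF c' assms(1), of w] by auto
    then show "z \<in> ?O \<inter> tchange c' c -` V"
      using w by (auto simp: tchart_def)
  next
    fix z assume z: "z \<in> ?O \<inter> tchange c' c -` V"
    then obtain p where p: "p \<in> fst c'" "p \<in> fst c" "fst z = snd c' p" by auto
    obtain w where w: "w \<in> tangent_bundle \<Phi>" "fst w \<in> fst c'" "tchart c' w = z"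
      using tchart_surj[OF c', of z] p by auto
    have "fst w = p"
      using inj_onD[OF chart_inj[OF c'], of "fst w" p] w p by (auto simp: tchart_def)
    then have "w \<in> ?T"
      using tchart_tchange[OF c' assms(1), of w] w p z by auto
    then show "z \<in> timg c' ?T"
      using w unfolding timg_def by blast
  qed
  moreover have "continuous_on ?O (tchange c' c)"
    by (intro continuous_at_imp_continuous_on ballI isCont_tchange[OF c' assms(1)]) auto
  then have "open (?O \<inter> tchange c' c -` V)"
    by (rule continuous_open_preimage[OF _ open_Times[OF open_overlap[OF c' assms(1)] open_UNIV] assms(2)])
  ultimately show "open (timg c' ?T)" by simp
qed auto

lemma slit_component_nonzero:
  assumes "c \<in> \<Phi>" "w \<in> tangent_bundle \<Phi>" "fst w \<in> fst c"
  shows "w \<in> slit_bundle \<Phi> \<longleftrightarrow> snd w c \<noteq> 0"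
proof -
  have "snd w = (\<lambda>_. 0)" if "snd w c = 0"
  proof
    fix c'
    show "snd w c' = 0"
    proof (cases "c' \<in> \<Phi> \<and> fst w \<in> fst c'")
      case True
      then show ?thesis
        using tangent_bundle_component[OF assms(2,1), of c'] assms(3) that by simp
    qed (rule tangent_bundle_default[OF assms(2)])
  qed
  then show ?thesis using assms(2) by (auto simp: slit_bundle_def)
qed

end

locale conic_charts = smooth_charts \<Phi> for \<Phi> :: "('m::t2_space, 'n::finite) chart set" +
  fixes A :: "('m, 'n) tvec set"
  assumes conic: "conic_domain \<Phi> A"
begin

abbreviation "clA \<equiv> slit_closure \<Phi> A"

lemma A_subset: "A \<subseteq> slit_bundle \<Phi>" "A \<subseteq> tangent_bundle \<Phi>"
  using conic by (auto simp: conic_domain_def slit_bundle_def)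

lemma open_timg: "c \<in> \<Phi> \<Longrightarrow> open (timg c A)"
  using conic by (simp add: conic_domain_def openin_tangent_topology)

lemma timg_fst: "z \<in> timg c D \<Longrightarrow> fst z \<in> snd c ` fst c"
  by (auto simp: timg_def tchart_def)

lemma timg_snd_nonzero:
  assumes "c \<in> \<Phi>" "z \<in> timg c A"
  shows "snd z \<noteq> 0"
  using assms(2)
proof (rule timgE)
  fix w assume w: "w \<in> A" "fst w \<in> fst c" "z = tchart c w"
  then show ?thesis
    using slit_component_nonzero[OF assms(1), of w] A_subset by (auto simp: tchart_def)
qed

lemma conic_timg:
  assumes "c \<in> \<Phi>"
  shows "conic_set (timg c A)"
  unfolding conic_set_def
proof (clarify)
  fix x y and r :: real assume xy: "(x, y) \<in> timg c A" and r: "r > 0"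
  from xy obtain w where w: "w \<in> A" "fst w \<in> fst c" "(x, y) = tchart c w" by (rule timgE)
  have "scale_tvec r w \<in> A" using conic w r by (simp add: conic_domain_def)
  moreover have "tchart c (scale_tvec r w) = (x, r *\<^sub>R y)" "fst (scale_tvec r w) = fst w"
    using w by (simp_all add: tchart_def scale_tvec_def)
  ultimately show "(x, r *\<^sub>R y) \<in> timg c A"
    using w unfolding timg_def by (metis (mono_tags, lifting) image_eqI mem_Collect_eq)
qed

lemma clA_subset: "clA \<subseteq> slit_bundle \<Phi>" "clA \<subseteq> tangent_bundle \<Phi>"
proof -
  show "clA \<subseteq> slit_bundle \<Phi>"
    unfolding slit_closure_def
    using closure_of_subset_topspace[of "subtopology (tangent_topology \<Phi>) (slit_bundle \<Phi>)" A] by auto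
  then show "clA \<subseteq> tangent_bundle \<Phi>" by (auto simp: slit_bundle_def)
qed

text \<open>
  The induced charts are open and continuous, so the closure can be computed in coordinates. This makes
  the density arguments below statements about closures in \<open>\<real>\<^sup>n \<times> \<real>\<^sup>n\<close>.
\<close>

lemma timg_closure:
  assumes c: "c \<in> \<Phi>"
  shows "timg c clA = {z. fst z \<in> snd c ` fst c \<and> snd z \<noteq> 0 \<and> z \<in> closure (timg c A)}"
proof (intro equalityI subsetI CollectI conjI)
  fix z assume z: "z \<in> timg c clA"
  then show "fst z \<in> snd c ` fst c" by (rule timg_fst)
  from z obtain w where w: "w \<in> clA" "fst w \<in> fst c" "z = tchart c w" by (rule timgE)
  then have wT: "w \<in> slit_bundle \<Phi>" "w \<in> tangent_bundle \<Phi>" using clA_subset by auto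
  then show "snd z \<noteq> 0"
    using slit_component_nonzero[OF c wT(2) w(2)] w by (simp add: tchart_def)
  show "z \<in> closure (timg c A)"
  proof (rule ccontr)
    assume "z \<notin> closure (timg c A)"
    define T where "T = {w \<in> tangent_bundle \<Phi>. fst w \<in> fst c \<and> tchart c w \<in> - closure (timg c A)}"
    have "openin (tangent_topology \<Phi>) T"
      unfolding T_def by (rule openin_chart_preimage[OF c]) (rule open_Compl[OF closed_closure])
    then have op: "openin (subtopology (tangent_topology \<Phi>) (slit_bundle \<Phi>)) (T \<inter> slit_bundle \<Phi>)"
      by (rule openin_subtopology_Int)
    have "w \<in> T \<inter> slit_bundle \<Phi>" using wT w(2,3) \<open>z \<notin> _\<close> by (simp add: T_def)
    with op have "\<exists>y. y \<in> A \<and> y \<in> T \<inter> slit_bundle \<Phi>"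
      using w(1) unfolding slit_closure_def in_closure_of by blast
    then obtain a where a: "a \<in> A" "a \<in> T" by blast
    then have "tchart c a \<in> timg c A" unfolding timg_def T_def by blast
    then have "tchart c a \<in> closure (timg c A)" using closure_subset by (rule rev_subsetD)
    then show False using a(2) unfolding T_def by blast
  qed
next
  fix z assume z: "z \<in> {z. fst z \<in> snd c ` fst c \<and> snd z \<noteq> 0 \<and> z \<in> closure (timg c A)}"
  then obtain w where w: "w \<in> tangent_bundle \<Phi>" "fst w \<in> fst c" "tchart c w = z"
    using tchart_surj[OF c, of z] by auto
  have slit: "w \<in> slit_bundle \<Phi>"
    using slit_component_nonzero[OF c w(1,2)] w z by (auto simp: tchart_def)
  have "w \<in> clA"
    unfolding slit_closure_def in_closure_of
  proof (intro conjI allI impI)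
    have "openin (tangent_topology \<Phi>) {w \<in> tangent_bundle \<Phi>. fst w \<in> fst c \<and> tchart c w \<in> UNIV}"
      by (rule openin_chart_preimage[OF c open_UNIV])
    then have "w \<in> topspace (tangent_topology \<Phi>)"
      using w unfolding topspace_def by blast
    then show "w \<in> topspace (subtopology (tangent_topology \<Phi>) (slit_bundle \<Phi>))"
      using slit by simp
    fix T assume T: "w \<in> T \<and> openin (subtopology (tangent_topology \<Phi>) (slit_bundle \<Phi>)) T"
    then obtain T' where T': "openin (tangent_topology \<Phi>) T'" "T = T' \<inter> slit_bundle \<Phi>"
      unfolding openin_subtopology by blast
    have sub: "T' \<subseteq> tangent_bundle \<Phi>" and op: "open (timg c T')"
      using T'(1) c unfolding openin_tangent_topology by auto
    have "z \<in> timg c T'"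
      using T T' w timg_mem_iff[OF c sub w(1,2)] by blast
    then have "timg c A \<inter> timg c T' \<noteq> {}"
      using z open_Int_closure_eq_empty[OF op, of "timg c A"] by blast
    then have "timg c (A \<inter> T') \<noteq> {}"
      using timg_Int[OF c A_subset(2) sub] by simp
    then obtain a where "a \<in> A" "a \<in> T'" unfolding timg_def by blast
    then show "\<exists>y. y \<in> A \<and> y \<in> T"
      using T' A_subset by blast
  qed
  then show "z \<in> timg c clA"
    using w unfolding timg_def by blast
qed

lemma A_subset_clA: "A \<subseteq> clA"
proof
  fix w assume w: "w \<in> A"
  obtain c where c: "c \<in> \<Phi>" "fst w \<in> fst c"
    using atlas unfolding smooth_atlas_def by blast
  have "tchart c w \<in> timg c A" using w c unfolding timg_def by blast
  then have "tchart c w \<in> timg c clA"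
    unfolding timg_closure[OF c(1)]
    using timg_fst timg_snd_nonzero[OF c(1)] closure_subset by blast
  then show "w \<in> clA"
    using timg_mem_iff[OF c(1) clA_subset(2) _ c(2)] w A_subset by blast
qed

lemma timg_subset_closure: "timg c A \<subseteq> timg c clA"
  using A_subset_clA unfolding timg_def by blast

lemma conic_timg_closure:
  assumes c: "c \<in> \<Phi>"
  shows "conic_set (timg c clA)"
  unfolding conic_set_def
proof (clarify)
  fix x y and r :: real assume xy: "(x, y) \<in> timg c clA" and r: "r > 0"
  then have cl: "(x, y) \<in> closure (timg c A)" unfolding timg_closure[OF c] by simp
  let ?h = "\<lambda>w :: (real ^ 'n) \<times> (real ^ 'n). (fst w, r *\<^sub>R snd w)"
  have "?h ` closure (timg c A) \<subseteq> closure (timg c A)"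
  proof (rule image_closure_subset)
    show "continuous_on (closure (timg c A)) ?h" by (intro continuous_intros)
    show "?h ` timg c A \<subseteq> closure (timg c A)"
      using conic_timg[OF c] r closure_subset[of "timg c A"] unfolding conic_set_def by fastforce
  qed simp
  then have "?h (x, y) \<in> closure (timg c A)" using cl by blast
  then show "(x, r *\<^sub>R y) \<in> timg c clA"
    using xy r unfolding timg_closure[OF c] by simp
qed

end

section \<open>Fields with a transformation law\<close>

text \<open>
  Vector fields, covector fields, fields of type (1,1) and connections are treated uniformly: the
  components in the chart \<open>c'\<close> are a function of the point and of the components in the chart \<open>c\<close>.
  The extension of fields to the closure then has a single proof. In \<open>law_connection\<close> the
  transformation is affine, with linear part \<open>law_1_1\<close>.
\<close>

type_synonym ('m, 'n, 'b) law =
  "('m, 'n) chart \<Rightarrow> ('m, 'n) chart \<Rightarrow> (real ^ 'n) \<times> (real ^ 'n) \<Rightarrow> 'b \<Rightarrow> 'b"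

definition law_1_0 :: "('m, 'n::finite, real ^ 'n) law" where
  "law_1_0 c c' z t = Jac c c' (fst z) *v t"

definition law_0_1 :: "('m, 'n::finite, real ^ 'n) law" where
  "law_0_1 c c' z t = (\<chi> i. \<Sum>a\<in>UNIV. Jac c' c (transition c c' (fst z)) $ a $ i * t $ a)"

definition law_1_1 :: "('m, 'n::finite, real ^ 'n ^ 'n) law" where
  "law_1_1 c c' z t = (\<chi> i k. \<Sum>d\<in>UNIV. \<Sum>a\<in>UNIV.
     Jac c c' (fst z) $ k $ d * Jac c' c (transition c c' (fst z)) $ a $ i * t $ a $ d)"

definition law_connection :: "('m, 'n::finite, real ^ 'n ^ 'n) law" where
  "law_connection c c' z t = (\<chi> i k.
     (\<Sum>d\<in>UNIV. \<Sum>b\<in>UNIV. Jac c c' (fst z) $ k $ d *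
        frechet_derivative (\<lambda>u. Jac c' c u $ d $ b) (at (transition c c' (fst z))) (axis i 1) *
        (Jac c c' (fst z) *v snd z) $ b) +
     law_1_1 c c' z t $ i $ k)"

definition fields ::
  "('m, 'n::finite, 'b::real_normed_vector) law \<Rightarrow> ('m, 'n) chart set \<Rightarrow> ('m, 'n) tvec set \<Rightarrow> real
     \<Rightarrow> ('m, 'n, 'b) fld set" where
  "fields R \<Phi> D \<alpha> = {T. h_smooth \<Phi> D \<alpha> T \<and>
     (\<forall>c\<in>\<Phi>. \<forall>c'\<in>\<Phi>. \<forall>w\<in>D. fst w \<in> fst c \<longrightarrow> fst w \<in> fst c' \<longrightarrow>
       T c' (tchart c' w) = R c c' (tchart c w) (T c (tchart c w)))}"

lemma h_smooth_iff:
  "h_smooth \<Phi> D \<alpha> T \<longleftrightarrow> restrict_fld \<Phi> D T = T \<and>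
     (\<forall>c\<in>\<Phi>. (\<forall>z\<in>timg c D. smooth_ext_at (timg c D) z (T c)) \<and> homogeneous_on (timg c D) \<alpha> (T c))"
  unfolding h_smooth_def smooth_on_iff_smooth_ext_at homogeneous_on_def ..

lemma fieldsI:
  assumes "restrict_fld \<Phi> D T = T"
    and "\<And>c z. c \<in> \<Phi> \<Longrightarrow> z \<in> timg c D \<Longrightarrow> smooth_ext_at (timg c D) z (T c)"
    and "\<And>c. c \<in> \<Phi> \<Longrightarrow> homogeneous_on (timg c D) \<alpha> (T c)"
    and "\<And>c c' w. c \<in> \<Phi> \<Longrightarrow> c' \<in> \<Phi> \<Longrightarrow> w \<in> D \<Longrightarrow> fst w \<in> fst c \<Longrightarrow> fst w \<in> fst c' \<Longrightarrow>
       T c' (tchart c' w) = R c c' (tchart c w) (T c (tchart c w))"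
  shows "T \<in> fields R \<Phi> D \<alpha>"
  unfolding fields_def h_smooth_iff using assms by blast

lemma fieldsD:
  assumes "T \<in> fields R \<Phi> D \<alpha>"
  shows "restrict_fld \<Phi> D T = T"
    and "\<And>c z. c \<in> \<Phi> \<Longrightarrow> z \<in> timg c D \<Longrightarrow> smooth_ext_at (timg c D) z (T c)"
    and "\<And>c. c \<in> \<Phi> \<Longrightarrow> homogeneous_on (timg c D) \<alpha> (T c)"
    and "\<And>c c' w. c \<in> \<Phi> \<Longrightarrow> c' \<in> \<Phi> \<Longrightarrow> w \<in> D \<Longrightarrow> fst w \<in> fst c \<Longrightarrow> fst w \<in> fst c' \<Longrightarrow>
       T c' (tchart c' w) = R c c' (tchart c w) (T c (tchart c w))"
  using assms unfolding fields_def h_smooth_iff by blast+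

lemma restrict_fld_apply:
  "c \<in> \<Phi> \<Longrightarrow> z \<in> timg c D \<Longrightarrow> restrict_fld \<Phi> D T c z = T c z"
  by (simp add: restrict_fld_def)

lemma restrict_fld_idem: "restrict_fld \<Phi> D (restrict_fld \<Phi> D T) = restrict_fld \<Phi> D T"
  unfolding restrict_fld_def by (intro ext) simp

lemma restrict_fld_fixedI:
  assumes "\<And>c z. \<not> (c \<in> \<Phi> \<and> z \<in> timg c D) \<Longrightarrow> T c z = 0"
  shows "restrict_fld \<Phi> D T = T"
proof (intro ext)
  show "restrict_fld \<Phi> D T c z = T c z" for c z
    using assms[of c z] by (cases "c \<in> \<Phi> \<and> z \<in> timg c D") (simp_all add: restrict_fld_def)
qed

lemma restrict_fld_fixedD:
  assumes "restrict_fld \<Phi> D T = T" "\<not> (c \<in> \<Phi> \<and> z \<in> timg c D)"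
  shows "T c z = 0"
proof -
  have "T c z = restrict_fld \<Phi> D T c z" using assms(1) by simp
  also have "\<dots> = 0" unfolding restrict_fld_def by (rule if_not_P[OF assms(2)])
  finally show ?thesis .
qed

context smooth_charts
begin

lemma tensors_1_0_eq: "tensors_1_0 \<Phi> D \<alpha> = fields law_1_0 \<Phi> D \<alpha>"
  unfolding tensors_1_0_def fields_def Let_def
  by (intro Collect_cong conj_cong refl ball_cong imp_cong)
    (simp add: law_1_0_def tchart_def vec_eq_iff matrix_vector_mult_def)

lemma tensors_0_1_eq: "tensors_0_1 \<Phi> D \<alpha> = fields law_0_1 \<Phi> D \<alpha>"
  unfolding tensors_0_1_def fields_def Let_def
  by (intro Collect_cong conj_cong refl ball_cong imp_cong)
    (simp add: law_0_1_def tchart_def vec_eq_iff transition_chart)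

lemma tensors_1_1_eq: "tensors_1_1 \<Phi> D \<alpha> = fields law_1_1 \<Phi> D \<alpha>"
  unfolding tensors_1_1_def fields_def Let_def
  by (intro Collect_cong conj_cong refl ball_cong imp_cong)
    (simp add: law_1_1_def tchart_def vec_eq_iff transition_chart)

lemma connections_eq:
  assumes "D \<subseteq> tangent_bundle \<Phi>"
  shows "connections \<Phi> D = fields law_connection \<Phi> D 1"
  unfolding connections_def fields_def Let_def
proof (intro Collect_cong conj_cong refl ball_cong imp_cong)
  fix T :: "('m, 'n, real ^ 'n ^ 'n) fld" and c c' w
  assume c: "c \<in> \<Phi>" "c' \<in> \<Phi>" "fst w \<in> fst c" "fst w \<in> fst c'" and w: "w \<in> D"
  have "snd w c' = Jac c c' (snd c (fst w)) *v snd w c"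
    using assms w by (intro tangent_bundle_component c) auto
  then show "(\<forall>i k. T c' (tchart c' w) $ i $ k =
            (\<Sum>d\<in>UNIV. \<Sum>b\<in>UNIV. Jac c c' (snd c (fst w)) $ k $ d *
                frechet_derivative (\<lambda>u. Jac c' c u $ d $ b) (at (snd c' (fst w))) (axis i 1) * snd w c' $ b) +
            (\<Sum>d\<in>UNIV. \<Sum>a\<in>UNIV. Jac c c' (snd c (fst w)) $ k $ d * Jac c' c (snd c' (fst w)) $ a $ i *
                T c (tchart c w) $ a $ d)) =
        (T c' (tchart c' w) = law_connection c c' (tchart c w) (T c (tchart c w)))"
    by (simp add: law_connection_def law_1_1_def tchart_def vec_eq_iff transition_chart[OF c(1,3)])
qed

end

section \<open>Extension of fields to the closure\<close>

lemma continuous_agree_closure: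
  fixes F G :: "'a::metric_space \<Rightarrow> 'b::t2_space"
  assumes "isCont F z" "isCont G z" "z \<in> closure S" "eventually (\<lambda>u. u \<in> S \<longrightarrow> F u = G u) (nhds z)"
  shows "F z = G z"
proof -
  obtain x where x: "\<And>n. x n \<in> S" "x \<longlonglongrightarrow> z"
    using assms(3) unfolding closure_sequential by blast
  have "eventually (\<lambda>n. x n \<in> S \<longrightarrow> F (x n) = G (x n)) sequentially"
    using x(2) assms(4) by (rule eventually_compose_filterlim[rotated])
  then have "eventually (\<lambda>n. F (x n) = G (x n)) sequentially"
    using x(1) by simp
  then have "(\<lambda>n. G (x n)) \<longlonglongrightarrow> F z"
    using isCont_tendsto_compose[OF assms(1) x(2)] by (rule Lim_transform_eventually[rotated])
  then show ?thesis
    using isCont_tendsto_compose[OF assms(2) x(2)] by (rule LIMSEQ_unique)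
qed

definition law_continuous :: "('m, 'n::finite) chart set \<Rightarrow> ('m, 'n, 'b::topological_space) law \<Rightarrow> bool" where
  "law_continuous \<Phi> R \<longleftrightarrow> (\<forall>c\<in>\<Phi>. \<forall>c'\<in>\<Phi>. \<forall>z. fst z \<in> overlap c c' \<longrightarrow>
     (\<forall>f. isCont f z \<longrightarrow> isCont (\<lambda>u. R c c' u (f u)) z))"

context smooth_charts
begin

lemma law_1_0_continuous: "law_continuous \<Phi> law_1_0"
  unfolding law_continuous_def law_1_0_def
proof (intro ballI allI impI isCont_vecI)
  fix c c' z and f :: "(real ^ 'n) \<times> (real ^ 'n) \<Rightarrow> real ^ 'n" and i
  assume c: "c \<in> \<Phi>" "c' \<in> \<Phi>" "fst z \<in> overlap c c'" and f: "isCont f z"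
  have "isCont (\<lambda>u. \<Sum>j\<in>UNIV. Jac c c' (fst u) $ i $ j * f u $ j) z"
    by (intro isCont_sum ballI isCont_mult isCont_Jac_fst[OF c] isCont_vec_nth f)
  then show "isCont (\<lambda>u. (Jac c c' (fst u) *v f u) $ i) z"
    by (simp add: matrix_vector_mult_def)
qed

lemma law_0_1_continuous: "law_continuous \<Phi> law_0_1"
  unfolding law_continuous_def law_0_1_def
proof (intro ballI allI impI isCont_vecI)
  fix c c' z and f :: "(real ^ 'n) \<times> (real ^ 'n) \<Rightarrow> real ^ 'n" and i
  assume c: "c \<in> \<Phi>" "c' \<in> \<Phi>" "fst z \<in> overlap c c'" and f: "isCont f z"
  show "isCont (\<lambda>u. (\<chi> i. \<Sum>a\<in>UNIV. Jac c' c (transition c c' (fst u)) $ a $ i * f u $ a) $ i) z"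
    unfolding vec_lambda_beta
    by (intro isCont_sum ballI isCont_mult isCont_Jac_transition[OF c] isCont_vec_nth f)
qed

lemma law_1_1_isCont:
  assumes "c \<in> \<Phi>" "c' \<in> \<Phi>" "fst z \<in> overlap c c'" and f: "isCont f z"
  shows "isCont (\<lambda>u. law_1_1 c c' u (f u) $ i $ k) z"
  unfolding law_1_1_def vec_lambda_beta
  by (intro isCont_sum ballI isCont_mult isCont_Jac_transition[OF assms(1-3)] isCont_Jac_fst[OF assms(1-3)]
      isCont_vec_nth f)

lemma isCont_second_derivative_transition:
  assumes "c \<in> \<Phi>" "c' \<in> \<Phi>" "fst z \<in> overlap c c'"
  shows "isCont (\<lambda>u. frechet_derivative (\<lambda>x. Jac c' c x $ d $ b) (at (transition c c' (fst u))) e) z"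
  using isCont_o2[OF isCont_transition_fst[OF assms], of "\<lambda>x. frechet_derivative (\<lambda>x. Jac c' c x $ d $ b) (at x) e"]
    C_inf_on_continuous[OF C_inf_on_derivative[OF Jac_smooth[OF assms(2,1)]] transition_in_overlap[OF assms(1,3)]]
  by simp

lemma law_connection_continuous: "law_continuous \<Phi> law_connection"
  unfolding law_continuous_def
proof (intro ballI allI impI isCont_vecI)
  fix c c' z and f :: "(real ^ 'n) \<times> (real ^ 'n) \<Rightarrow> real ^ 'n ^ 'n" and i k
  assume c: "c \<in> \<Phi>" "c' \<in> \<Phi>" "fst z \<in> overlap c c'" and f: "isCont f z"
  show "isCont (\<lambda>u. law_connection c c' u (f u) $ i $ k) z"
    unfolding law_connection_def vec_lambda_beta matrix_vector_mult_def
    by (intro isCont_add law_1_1_isCont[OF c f] isCont_sum ballI isCont_mult isCont_Jac_fst[OF c]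
        isCont_second_derivative_transition[OF c] isCont_vec_nth isCont_snd continuous_ident)
qed

end

context conic_charts
begin

definition extendable :: "('m, 'n, 'b::real_normed_vector) fld \<Rightarrow> bool" where
  "extendable T \<longleftrightarrow> (\<forall>c\<in>\<Phi>. \<forall>z\<in>timg c clA. smooth_ext_at (timg c A) z (T c))"

lemma extends_in_imp_extendable:
  assumes "extends_in \<Phi> A (fields R \<Phi> clA \<alpha>) T"
  shows "extendable T"
  unfolding extendable_def
proof (intro ballI)
  fix c z assume c: "c \<in> \<Phi>" and z: "z \<in> timg c clA"
  obtain T' where T': "T' \<in> fields R \<Phi> clA \<alpha>" "restrict_fld \<Phi> A T' = T"
    using assms unfolding extends_in_def by blast
  have "smooth_ext_at (timg c A) z (T' c)"
    by (rule smooth_ext_at_subset[OF fieldsD(2)[OF T'(1) c z] timg_subset_closure])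
  then show "smooth_ext_at (timg c A) z (T c)"
    by (rule smooth_ext_at_cong) (simp add: c restrict_fld_apply flip: T'(2))
qed

text \<open>
  At every point of the closure the value of a local extension is the limit of \<open>T\<close>, so it does not
  depend on the extension, and these values define a smooth field. Homogeneity and the transformation
  law equate continuous functions that agree on the dense part coming from \<open>A\<close>.
\<close>

lemma extendable_imp_extends_in:
  assumes T: "T \<in> fields R \<Phi> A \<alpha>" and R: "law_continuous \<Phi> R" and exT: "extendable T"
  shows "extends_in \<Phi> A (fields R \<Phi> clA \<alpha>) T"
proof -
  define good where "good = (\<lambda>c z U F. open U \<and> z \<in> U \<and> C_inf_on U F \<and> (\<forall>u\<in>U \<inter> timg c A. F u = T c u))"
  have "\<forall>c z. \<exists>UF. c \<in> \<Phi> \<longrightarrow> z \<in> timg c clA \<longrightarrow> good c z (fst UF) (snd UF)"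
    using exT unfolding extendable_def smooth_ext_at_def good_def by fastforce
  then obtain UF where UF: "\<And>c z. c \<in> \<Phi> \<Longrightarrow> z \<in> timg c clA \<Longrightarrow> good c z (fst (UF c z)) (snd (UF c z))"
    unfolding choice_iff by blast
  define T' where "T' = (\<lambda>c z. if c \<in> \<Phi> \<and> z \<in> timg c clA then snd (UF c z) z else 0)"
  have near: "eventually (\<lambda>u. u \<in> U \<and> (u \<in> timg c A \<longrightarrow> F u = T c u)) (nhds z)" if "good c z U F" for c z U F
    using that unfolding good_def eventually_nhds by (intro exI[of _ U]) auto
  have cont: "isCont F u" if "good c z U F" "u \<in> U" for c z U F u
    using that C_inf_on_continuous unfolding good_def by blast
  have T'_eq: "T' c u = F u" if c: "c \<in> \<Phi>" and g: "good c z U F" and u: "u \<in> U" "u \<in> timg c clA" for c z U F u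
  proof -
    have gu: "good c u U F" using g u(1) unfolding good_def by blast
    have gu': "good c u (fst (UF c u)) (snd (UF c u))" by (rule UF[OF c u(2)])
    have "snd (UF c u) u = F u"
    proof (rule continuous_agree_closure[where F="snd (UF c u)" and z=u and G=F])
      show "isCont (snd (UF c u)) u" using cont[OF gu'] gu' unfolding good_def by blast
      show "isCont F u" by (rule cont[OF g u(1)])
      show "u \<in> closure (timg c A)" using u(2) unfolding timg_closure[OF c] by blast
      show "eventually (\<lambda>v. v \<in> timg c A \<longrightarrow> snd (UF c u) v = F v) (nhds u)"
        using near[OF gu] near[OF gu'] by eventually_elim simp
    qed
    then show ?thesis by (simp add: T'_def c u(2))
  qed
  have T'_self: "T' c z = snd (UF c z) z" if "c \<in> \<Phi>" "z \<in> timg c clA" for c z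
    by (simp add: T'_def that)
  have T'_T: "T' c z = T c z" if c: "c \<in> \<Phi>" and z: "z \<in> timg c A" for c z
  proof -
    have z': "z \<in> timg c clA" using z timg_subset_closure by blast
    show ?thesis using UF[OF c z'] z unfolding T'_self[OF c z'] good_def by blast
  qed
  have "T' \<in> fields R \<Phi> clA \<alpha>"
  proof (rule fieldsI)
    show "restrict_fld \<Phi> clA T' = T'"
      by (rule restrict_fld_fixedI) (auto simp: T'_def)
  next
    fix c z assume c: "c \<in> \<Phi>" and z: "z \<in> timg c clA"
    have g: "good c z (fst (UF c z)) (snd (UF c z))" by (rule UF[OF c z])
    show "smooth_ext_at (timg c clA) z (T' c)"
    proof (rule smooth_ext_atI)
      show "open (fst (UF c z))" "z \<in> fst (UF c z)" "C_inf_on (fst (UF c z)) (snd (UF c z))"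
        using g unfolding good_def by blast+
      show "snd (UF c z) u = T' c u" if "u \<in> fst (UF c z)" "u \<in> timg c clA" for u
        by (rule T'_eq[OF c g that, symmetric])
    qed
  next
    fix c assume c: "c \<in> \<Phi>"
    show "homogeneous_on (timg c clA) \<alpha> (T' c)"
      unfolding homogeneous_on_def
    proof (clarify)
      fix x y and r :: real assume z: "(x, y) \<in> timg c clA" and r: "r > 0"
      have rz: "(x, r *\<^sub>R y) \<in> timg c clA"
        using conic_timg_closure[OF c] z r unfolding conic_set_def by blast
      define F G where "F = snd (UF c (x, y))" and "G = snd (UF c (x, r *\<^sub>R y))"
      have gF: "good c (x, y) (fst (UF c (x, y))) F" and gG: "good c (x, r *\<^sub>R y) (fst (UF c (x, r *\<^sub>R y))) G"
        unfolding F_def G_def by (rule UF[OF c z], rule UF[OF c rz])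
      define h where "h = (\<lambda>u :: (real ^ 'n) \<times> (real ^ 'n). (fst u, r *\<^sub>R snd u))"
      have h: "isCont h (x, y)" unfolding h_def by (intro continuous_intros)
      have hz: "h (x, y) = (x, r *\<^sub>R y)" by (simp add: h_def)
      have "G (h (x, y)) = r powr \<alpha> *\<^sub>R F (x, y)"
      proof (rule continuous_agree_closure[where F="\<lambda>u. G (h u)" and G="\<lambda>u. r powr \<alpha> *\<^sub>R F u"])
        have "isCont G (h (x, y))" unfolding hz using cont[OF gG] gG unfolding good_def by blast
        then show "isCont (\<lambda>u. G (h u)) (x, y)" by (rule isCont_o2[OF h])
        have "isCont F (x, y)" using cont[OF gF] gF unfolding good_def by blast
        then show "isCont (\<lambda>u. r powr \<alpha> *\<^sub>R F u) (x, y)" by (intro isCont_scaleR continuous_const)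
        show "(x, y) \<in> closure (timg c A)" using z unfolding timg_closure[OF c] by blast
        have "eventually (\<lambda>u. h u \<in> fst (UF c (x, r *\<^sub>R y)) \<and> (h u \<in> timg c A \<longrightarrow> G (h u) = T c (h u))) (nhds (x, y))"
        proof (rule eventually_compose_filterlim[OF near[OF gG]])
          show "filterlim h (nhds (x, r *\<^sub>R y)) (nhds (x, y))"
            using h[unfolded isCont_def tendsto_at_iff_tendsto_nhds] unfolding hz .
        qed
        with near[OF gF] show "eventually (\<lambda>u. u \<in> timg c A \<longrightarrow> G (h u) = r powr \<alpha> *\<^sub>R F u) (nhds (x, y))"
        proof eventually_elim
          case (elim u)
          show ?case
          proof
            assume u: "u \<in> timg c A"
            obtain a b where ab: "u = (a, b)" by (cases u)
            have hu: "h u \<in> timg c A"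
              using conic_timg[OF c] u r unfolding conic_set_def h_def ab by auto
            have "T c (h u) = r powr \<alpha> *\<^sub>R T c u"
              using fieldsD(3)[OF T c] u r unfolding homogeneous_on_def h_def ab by auto
            then show "G (h u) = r powr \<alpha> *\<^sub>R F u"
              using elim u hu by metis
          qed
        qed
      qed
      then show "T' c (x, r *\<^sub>R y) = r powr \<alpha> *\<^sub>R T' c (x, y)"
        unfolding T'_self[OF c z] T'_self[OF c rz] hz F_def G_def .
    qed
  next
    fix c c' w assume c: "c \<in> \<Phi>" "c' \<in> \<Phi>" and w: "w \<in> clA" "fst w \<in> fst c" "fst w \<in> fst c'"
    have wT: "w \<in> tangent_bundle \<Phi>" using w clA_subset by blast
    define z z' where "z = tchart c w" and "z' = tchart c' w"
    have z: "z \<in> timg c clA" and z': "z' \<in> timg c' clA"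
      using w unfolding z_def z'_def timg_def by blast+
    have tz: "tchange c c' z = z'"
      unfolding z_def z'_def using tchart_tchange[OF c wT w(2,3)] by simp
    have ov: "fst z \<in> overlap c c'" using w by (simp add: z_def tchart_def)
    define F G where "F = snd (UF c z)" and "G = snd (UF c' z')"
    have gF: "good c z (fst (UF c z)) F" and gG: "good c' z' (fst (UF c' z')) G"
      unfolding F_def G_def by (rule UF[OF c(1) z], rule UF[OF c(2) z'])
    have t: "isCont (tchange c c') z" by (rule isCont_tchange[OF c ov])
    have "G (tchange c c' z) = R c c' z (F z)"
    proof (rule continuous_agree_closure[where F="\<lambda>u. G (tchange c c' u)" and G="\<lambda>u. R c c' u (F u)"])
      have "isCont G (tchange c c' z)" unfolding tz using cont[OF gG] gG unfolding good_def by blast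
      then show "isCont (\<lambda>u. G (tchange c c' u)) z" by (rule isCont_o2[OF t])
      have "isCont F z" using cont[OF gF] gF unfolding good_def by blast
      then show "isCont (\<lambda>u. R c c' u (F u)) z" using R c ov unfolding law_continuous_def by blast
      show "z \<in> closure (timg c A)" using z unfolding timg_closure[OF c(1)] by blast
      have "eventually (\<lambda>u. tchange c c' u \<in> fst (UF c' z') \<and>
          (tchange c c' u \<in> timg c' A \<longrightarrow> G (tchange c c' u) = T c' (tchange c c' u))) (nhds z)"
      proof (rule eventually_compose_filterlim[OF near[OF gG]])
        show "filterlim (tchange c c') (nhds z') (nhds z)"
          using t[unfolded isCont_def tendsto_at_iff_tendsto_nhds] unfolding tz .
      qed
      moreover have "eventually (\<lambda>u. fst u \<in> overlap c c') (nhds z)"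
      proof -
        have "open (overlap c c' \<times> (UNIV :: (real ^ 'n) set))"
          by (intro open_Times open_overlap c open_UNIV)
        then show ?thesis
          unfolding eventually_nhds using ov
          by (intro exI[of _ "overlap c c' \<times> UNIV"] conjI ballI) (simp_all only: mem_Times_iff UNIV_I simp_thms)
      qed
      ultimately show "eventually (\<lambda>u. u \<in> timg c A \<longrightarrow> G (tchange c c' u) = R c c' u (F u)) (nhds z)"
        using near[OF gF]
      proof eventually_elim
        case (elim u)
        show ?case
        proof
          assume u: "u \<in> timg c A"
          then obtain a where a: "a \<in> A" "fst a \<in> fst c" "u = tchart c a" by (rule timgE)
          obtain q where q: "q \<in> fst c" "q \<in> fst c'" "fst u = snd c q" using elim by blast
          have "fst a = q"
            using inj_onD[OF chart_inj[OF c(1)], of "fst a" q] a q by (simp add: tchart_def)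
          then have a': "fst a \<in> fst c'" using q by simp
          have tu: "tchange c c' u = tchart c' a"
            using tchart_tchange[OF c _ a(2) a'] a A_subset by auto
          then have "tchange c c' u \<in> timg c' A" using a a' unfolding timg_def by blast
          then have "G (tchange c c' u) = T c' (tchart c' a)" using elim tu by simp
          also have "\<dots> = R c c' u (T c u)"
            unfolding a(3) by (rule fieldsD(4)[OF T c a(1,2) a'])
          also have "T c u = F u" using elim u by simp
          finally show "G (tchange c c' u) = R c c' u (F u)" .
        qed
      qed
    qed
    then show "T' c' (tchart c' w) = R c c' (tchart c w) (T' c (tchart c w))"
      unfolding z_def[symmetric] z'_def[symmetric] T'_self[OF c(1) z] T'_self[OF c(2) z'] tz F_def G_def .
  qed
  moreover have "restrict_fld \<Phi> A T' = T"
  proof (intro ext)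
    fix c z
    show "restrict_fld \<Phi> A T' c z = T c z"
    proof (cases "c \<in> \<Phi> \<and> z \<in> timg c A")
      case True
      then show ?thesis by (simp add: restrict_fld_apply T'_T)
    next
      case False
      then show ?thesis
        using restrict_fld_fixedD[OF fieldsD(1)[OF T] False] by (auto simp: restrict_fld_def)
    qed
  qed
  ultimately show ?thesis unfolding extends_in_def by blast
qed

lemma extends_in_iff_extendable:
  assumes "T \<in> fields R \<Phi> A \<alpha>" "law_continuous \<Phi> R"
  shows "extends_in \<Phi> A (fields R \<Phi> clA \<alpha>) T \<longleftrightarrow> extendable T"
  using extendable_imp_extends_in[OF assms] extends_in_imp_extendable by blast

end

section \<open>Tensoriality of the decomposition\<close>

lemma law_1_1_contraction:
  assumes "Jac c' c (transition c c' (fst z)) *v y' = y"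
  shows "(\<Sum>i\<in>UNIV. law_1_1 c c' z M $ i $ k * y' $ i)
       = (\<Sum>d\<in>UNIV. Jac c c' (fst z) $ k $ d * (\<Sum>a\<in>UNIV. M $ a $ d * y $ a))"
proof -
  define B E where "B = Jac c c' (fst z)" and "E = Jac c' c (transition c c' (fst z))"
  have y: "y $ a = (\<Sum>i\<in>UNIV. E $ a $ i * y' $ i)" for a
    unfolding E_def assms[symmetric] by (simp add: matrix_vector_mult_def)
  have "(\<Sum>i\<in>UNIV. law_1_1 c c' z M $ i $ k * y' $ i)
      = (\<Sum>i\<in>UNIV. \<Sum>d\<in>UNIV. \<Sum>a\<in>UNIV. B $ k $ d * E $ a $ i * M $ a $ d * y' $ i)"
    by (simp add: law_1_1_def B_def E_def sum_distrib_right)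
  also have "\<dots> = (\<Sum>d\<in>UNIV. \<Sum>i\<in>UNIV. \<Sum>a\<in>UNIV. B $ k $ d * E $ a $ i * M $ a $ d * y' $ i)"
    by (rule sum.swap)
  also have "\<dots> = (\<Sum>d\<in>UNIV. \<Sum>a\<in>UNIV. \<Sum>i\<in>UNIV. B $ k $ d * E $ a $ i * M $ a $ d * y' $ i)"
    by (rule sum.cong[OF refl], rule sum.swap)
  also have "\<dots> = (\<Sum>d\<in>UNIV. B $ k $ d * (\<Sum>a\<in>UNIV. M $ a $ d * y $ a))"
    unfolding y by (simp add: sum_distrib_left mult_ac)
  finally show ?thesis by (simp add: B_def)
qed

lemma law_1_1_trace:
  assumes "Jac c' c (transition c c' (fst z)) ** Jac c c' (fst z) = mat 1"
  shows "(\<Sum>i\<in>UNIV. law_1_1 c c' z M $ i $ i) = (\<Sum>a\<in>UNIV. M $ a $ a)"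
proof -
  define B E where "B = Jac c c' (fst z)" and "E = Jac c' c (transition c c' (fst z))"
  have "(\<Sum>i\<in>UNIV. law_1_1 c c' z M $ i $ i)
      = (\<Sum>i\<in>UNIV. \<Sum>d\<in>UNIV. \<Sum>a\<in>UNIV. B $ i $ d * E $ a $ i * M $ a $ d)"
    by (simp add: law_1_1_def B_def E_def)
  also have "\<dots> = (\<Sum>d\<in>UNIV. \<Sum>i\<in>UNIV. \<Sum>a\<in>UNIV. B $ i $ d * E $ a $ i * M $ a $ d)"
    by (rule sum.swap)
  also have "\<dots> = (\<Sum>d\<in>UNIV. \<Sum>a\<in>UNIV. \<Sum>i\<in>UNIV. B $ i $ d * E $ a $ i * M $ a $ d)"
    by (rule sum.cong[OF refl], rule sum.swap)
  also have "\<dots> = (\<Sum>d\<in>UNIV. \<Sum>a\<in>UNIV. (E ** B) $ a $ d * M $ a $ d)"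
    by (simp add: matrix_matrix_mult_def sum_distrib_right sum_distrib_left mult_ac)
  also have "\<dots> = (\<Sum>d\<in>UNIV. \<Sum>a\<in>UNIV. if a = d then M $ a $ d else 0)"
    unfolding E_def B_def assms by (intro sum.cong refl) (simp add: mat_def)
  finally show ?thesis by simp
qed

lemma has_derivative_vertical_line:
  fixes f :: "(real ^ 'n::finite) \<times> (real ^ 'n) \<Rightarrow> real"
  assumes "f differentiable (at (x, y))"
  shows "((\<lambda>s. f (x, y + s *\<^sub>R v)) has_derivative (\<lambda>s. s * frechet_derivative f (at (x, y)) (0, v))) (at 0)"
proof -
  have line: "((\<lambda>s. (x, y + s *\<^sub>R v)) has_derivative (\<lambda>s. (0, s *\<^sub>R v))) (at 0)"
    by (auto intro!: derivative_eq_intros)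
  have "(f has_derivative frechet_derivative f (at (x, y))) (at (x, y + 0 *\<^sub>R v))"
    using assms by (simp add: frechet_derivative_works)
  from has_derivative_compose[OF line this]
  have "((\<lambda>s. f (x, y + s *\<^sub>R v)) has_derivative (\<lambda>s. frechet_derivative f (at (x, y)) (0, s *\<^sub>R v))) (at 0)" .
  moreover have "frechet_derivative f (at (x, y)) (0, s *\<^sub>R v) = s * frechet_derivative f (at (x, y)) (0, v)" for s
    using linear_cmul[OF linear_frechet_derivative[OF assms], of s "(0, v)"] by simp
  ultimately show ?thesis by simp
qed

lemma homogeneous_on_vecI:
  fixes f :: "_ \<Rightarrow> 'b::real_vector ^ 'n::finite"
  assumes "\<And>i. homogeneous_on S \<alpha> (\<lambda>w. f w $ i)"
  shows "homogeneous_on S \<alpha> f"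
  using assms unfolding homogeneous_on_def vec_eq_iff by (simp add: case_prod_beta)

context conic_charts
begin

lemma fields_eqI:
  assumes "restrict_fld \<Phi> A S = S" "restrict_fld \<Phi> A T = T"
    and "\<And>c z. c \<in> \<Phi> \<Longrightarrow> z \<in> timg c A \<Longrightarrow> S c z = T c z"
  shows "S = T"
proof (intro ext)
  show "S c z = T c z" for c z
    using assms(3)[of c z] restrict_fld_fixedD[OF assms(1), of c z] restrict_fld_fixedD[OF assms(2), of c z]
    by (cases "c \<in> \<Phi> \<and> z \<in> timg c A") auto
qed

lemma restrict_fieldsI:
  assumes smooth: "\<And>c z. c \<in> \<Phi> \<Longrightarrow> z \<in> timg c A \<Longrightarrow> smooth_ext_at (timg c A) z (T c)"
    and hom: "\<And>c. c \<in> \<Phi> \<Longrightarrow> homogeneous_on (timg c A) \<alpha> (T c)"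
    and law: "\<And>c c' w. c \<in> \<Phi> \<Longrightarrow> c' \<in> \<Phi> \<Longrightarrow> w \<in> A \<Longrightarrow> fst w \<in> fst c \<Longrightarrow> fst w \<in> fst c' \<Longrightarrow>
       T c' (tchart c' w) = R c c' (tchart c w) (T c (tchart c w))"
  shows "restrict_fld \<Phi> A T \<in> fields R \<Phi> A \<alpha>"
proof (rule fieldsI)
  show "restrict_fld \<Phi> A (restrict_fld \<Phi> A T) = restrict_fld \<Phi> A T"
    by (rule restrict_fld_idem)
  show "smooth_ext_at (timg c A) z (restrict_fld \<Phi> A T c)" if "c \<in> \<Phi>" "z \<in> timg c A" for c z
    by (rule smooth_ext_at_cong[OF smooth[OF that]]) (simp add: restrict_fld_apply that)
  show "homogeneous_on (timg c A) \<alpha> (restrict_fld \<Phi> A T c)" if "c \<in> \<Phi>" for c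
    using hom[OF that] conic_timg[OF that] that unfolding homogeneous_on_def conic_set_def
    by (simp add: case_prod_beta restrict_fld_apply)
  fix c c' w assume c: "c \<in> \<Phi>" "c' \<in> \<Phi>" and w: "w \<in> A" "fst w \<in> fst c" "fst w \<in> fst c'"
  have "tchart c w \<in> timg c A" "tchart c' w \<in> timg c' A" using w unfolding timg_def by blast+
  then show "restrict_fld \<Phi> A T c' (tchart c' w) = R c c' (tchart c w) (restrict_fld \<Phi> A T c (tchart c w))"
    using law[OF c w] c by (simp add: restrict_fld_apply)
qed

lemma chart_change_data:
  assumes c: "c \<in> \<Phi>" "c' \<in> \<Phi>" and w: "w \<in> A" "fst w \<in> fst c" "fst w \<in> fst c'"
  shows "tchart c w \<in> timg c A" "tchart c' w \<in> timg c' A"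
    and "transition c c' (fst (tchart c w)) = fst (tchart c' w)"
    and "snd (tchart c' w) = Jac c c' (fst (tchart c w)) *v snd (tchart c w)"
    and "Jac c' c (fst (tchart c' w)) ** Jac c c' (fst (tchart c w)) = mat 1"
    and "Jac c c' (fst (tchart c w)) ** Jac c' c (fst (tchart c' w)) = mat 1"
    and "Jac c' c (fst (tchart c' w)) *v snd (tchart c' w) = snd (tchart c w)"
proof -
  have wT: "w \<in> tangent_bundle \<Phi>" using w A_subset by blast
  show "tchart c w \<in> timg c A" "tchart c' w \<in> timg c' A" using w unfolding timg_def by blast+
  show "transition c c' (fst (tchart c w)) = fst (tchart c' w)"
    by (simp add: tchart_def transition_chart[OF c(1) w(2)])
  show "snd (tchart c' w) = Jac c c' (fst (tchart c w)) *v snd (tchart c w)"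
    using tangent_bundle_component[OF wT c w(2,3)] by (simp add: tchart_def)
  show "Jac c' c (fst (tchart c' w)) ** Jac c c' (fst (tchart c w)) = mat 1"
    using Jac_inverse[OF c w(2,3)] by (simp add: tchart_def)
  show "Jac c c' (fst (tchart c w)) ** Jac c' c (fst (tchart c' w)) = mat 1"
    using Jac_inverse[OF c(2,1) w(3,2)] by (simp add: tchart_def)
  show "Jac c' c (fst (tchart c' w)) *v snd (tchart c' w) = snd (tchart c w)"
    using tangent_bundle_component[OF wT c(2,1) w(3,2)] by (simp add: tchart_def)
qed

lemma fields_component_differentiable:
  assumes "T \<in> fields R \<Phi> A \<alpha>" "c \<in> \<Phi>" "z \<in> timg c A"
  shows "(\<lambda>w. T c w $ k) differentiable (at z)"
  by (rule smooth_ext_at_differentiable[OF open_timg[OF assms(2)] assms(3) smooth_ext_at_nth[OF fieldsD(2)[OF assms]]])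

lemma fields_entry_differentiable:
  assumes "T \<in> fields R \<Phi> A \<alpha>" "c \<in> \<Phi>" "z \<in> timg c A"
  shows "(\<lambda>w. T c w $ i $ k) differentiable (at z)"
  by (rule smooth_ext_at_differentiable[OF open_timg[OF assms(2)] assms(3)
      smooth_ext_at_nth[OF smooth_ext_at_nth[OF fieldsD(2)[OF assms]]]])

text \<open>
  In a fixed fibre the components of a vector field in two charts are related by constant matrices,
  so its derivatives along the fibre form a tensor.
\<close>

lemma dy_transformation:
  assumes T: "T \<in> fields law_1_0 \<Phi> A \<alpha>" and c: "c \<in> \<Phi>" "c' \<in> \<Phi>"
    and w: "w \<in> A" "fst w \<in> fst c" "fst w \<in> fst c'"
  shows "dy i (\<lambda>u. T c' u $ k) (tchart c' w)
       = law_1_1 c c' (tchart c w) (\<chi> a d. dy a (\<lambda>u. T c u $ d) (tchart c w)) $ i $ k"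
proof -
  note data = chart_change_data[OF c w]
  define x y x' y' where "x = fst (tchart c w)" and "y = snd (tchart c w)"
    and "x' = fst (tchart c' w)" and "y' = snd (tchart c' w)"
  have xy: "tchart c w = (x, y)" "tchart c' w = (x', y')"
    by (simp_all add: x_def y_def x'_def y'_def)
  define B E where "B = Jac c c' x" and "E = Jac c' c x'"
  have BE: "B ** E = mat 1" and Ey: "E *v y' = y" and tx: "transition c c' x = x'" and By: "y' = B *v y"
    using data(3,4,6,7) by (simp_all add: B_def E_def xy)
  \<comment> \<open>The direction in the chart \<open>c\<close> that becomes the \<open>i\<close>-th coordinate direction in \<open>c'\<close>.\<close>
  define v where "v = E *v axis i 1"
  have v: "v $ a = E $ a $ i" for a
    by (simp add: v_def matrix_vector_mult_def axis_def if_distrib cong: if_cong)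
  have Bv: "B *v v = axis i 1"
    by (simp add: v_def matrix_vector_mul_assoc BE)
  have D1: "((\<lambda>s. T c' (x', y' + s *\<^sub>R axis i 1) $ k) has_derivative
      (\<lambda>s. s * dy i (\<lambda>u. T c' u $ k) (x', y'))) (at 0)"
    unfolding dy_def
    by (rule has_derivative_vertical_line) (use fields_component_differentiable[OF T c(2) data(2)] in \<open>simp add: xy\<close>)
  have "((\<lambda>s. \<Sum>d\<in>UNIV. B $ k $ d * T c (x, y + s *\<^sub>R v) $ d) has_derivative
      (\<lambda>s. \<Sum>d\<in>UNIV. B $ k $ d * (s * frechet_derivative (\<lambda>u. T c u $ d) (at (x, y)) (0, v)))) (at 0)"
    by (intro has_derivative_sum has_derivative_mult_right has_derivative_vertical_line)
      (use fields_component_differentiable[OF T c(1) data(1)] in \<open>simp add: xy\<close>)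
  moreover define S where "S = (\<lambda>s. (x, y + s *\<^sub>R v)) -` timg c A"
  have "open S"
    unfolding S_def by (intro open_vimage open_timg[OF c(1)] continuous_intros)
  moreover have "0 \<in> S" using data(1) by (simp add: S_def xy)
  moreover have "(\<Sum>d\<in>UNIV. B $ k $ d * T c (x, y + s *\<^sub>R v) $ d) = T c' (x', y' + s *\<^sub>R axis i 1) $ k" if "s \<in> S" for s
  proof -
    have "(x, y + s *\<^sub>R v) \<in> timg c A" using that by (simp add: S_def)
    then obtain a where a: "a \<in> A" "fst a \<in> fst c" "(x, y + s *\<^sub>R v) = tchart c a" by (rule timgE)
    have "snd c (fst a) = snd c (fst w)"
      using a(3) xy(1) by (simp add: tchart_def)
    then have aw: "fst a = fst w"
      using inj_onD[OF chart_inj[OF c(1)], of "fst a" "fst w"] a(2) w(2) by simp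
    have a': "fst a \<in> fst c'" using aw w by simp
    have "tchart c' a = tchange c c' (x, y + s *\<^sub>R v)"
      using tchart_tchange[OF c _ a(2) a'] a A_subset by auto
    also have "\<dots> = (x', y' + s *\<^sub>R axis i 1)"
      by (simp add: tchange_def tx matrix_vector_right_distrib matrix_vector_mult_scaleR Bv By flip: B_def)
    finally have "T c' (x', y' + s *\<^sub>R axis i 1) = law_1_0 c c' (x, y + s *\<^sub>R v) (T c (x, y + s *\<^sub>R v))"
      using fieldsD(4)[OF T c a(1,2) a'] a(3) by simp
    then show ?thesis
      by (simp add: law_1_0_def matrix_vector_mult_def B_def)
  qed
  ultimately have "((\<lambda>s. T c' (x', y' + s *\<^sub>R axis i 1) $ k) has_derivative
      (\<lambda>s. \<Sum>d\<in>UNIV. B $ k $ d * (s * frechet_derivative (\<lambda>u. T c u $ d) (at (x, y)) (0, v)))) (at 0)"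
    by (rule has_derivative_transform_within_open)
  from fun_cong[OF has_derivative_unique[OF D1 this], of 1]
  have "dy i (\<lambda>u. T c' u $ k) (x', y')
      = (\<Sum>d\<in>UNIV. B $ k $ d * frechet_derivative (\<lambda>u. T c u $ d) (at (x, y)) (0, v))" by simp
  also have "\<dots> = (\<Sum>d\<in>UNIV. B $ k $ d * (\<Sum>a\<in>UNIV. E $ a $ i * dy a (\<lambda>u. T c u $ d) (x, y)))"
    using frechet_derivative_vertical[OF fields_component_differentiable[OF T c(1) data(1)]] by (simp add: xy v)
  finally show ?thesis
    by (simp add: xy law_1_1_def tx sum_distrib_left mult.assoc flip: B_def E_def)
qed

lemma vdiff_apply:
  "c \<in> \<Phi> \<Longrightarrow> z \<in> timg c A \<Longrightarrow> vdiff \<Phi> A Z c z $ i $ k = dy i (\<lambda>w. Z c w $ k) z"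
  by (simp add: vdiff_def restrict_fld_apply)

lemma smooth_ext_at_vdiff:
  assumes c: "c \<in> \<Phi>" and Z: "smooth_ext_at (timg c A) z (Z c)"
  shows "smooth_ext_at (timg c A) z (vdiff \<Phi> A Z c)"
proof -
  have "smooth_ext_at (timg c A) z (\<lambda>w. \<chi> i k. dy i (\<lambda>u. Z c u $ k) w)"
    by (rule smooth_ext_at_vec, rule smooth_ext_at_vec, unfold vec_lambda_beta)
      (rule smooth_ext_at_dy[OF open_timg[OF c] smooth_ext_at_nth[OF Z]])
  then show ?thesis
    by (rule smooth_ext_at_cong) (simp add: vdiff_def restrict_fld_apply c)
qed

lemma vdiff_tensor:
  assumes T: "T \<in> fields law_1_0 \<Phi> A \<alpha>"
  shows "vdiff \<Phi> A T \<in> fields law_1_1 \<Phi> A (\<alpha> - 1)"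
  unfolding vdiff_def
proof (rule restrict_fieldsI)
  fix c z assume c: "c \<in> \<Phi>" and z: "z \<in> timg c A"
  show "smooth_ext_at (timg c A) z (\<lambda>w. \<chi> i k. dy i (\<lambda>u. T c u $ k) w)"
    by (rule smooth_ext_at_vec, rule smooth_ext_at_vec, unfold vec_lambda_beta)
      (rule smooth_ext_at_dy[OF open_timg[OF c] smooth_ext_at_nth[OF fieldsD(2)[OF T c z]]])
next
  fix c assume c: "c \<in> \<Phi>"
  show "homogeneous_on (timg c A) (\<alpha> - 1) (\<lambda>w. \<chi> i k. dy i (\<lambda>u. T c u $ k) w)"
    by (rule homogeneous_on_vecI, rule homogeneous_on_vecI, unfold vec_lambda_beta)
      (rule homogeneous_on_dy[OF open_timg[OF c] conic_timg[OF c]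
          fields_component_differentiable[OF T c] homogeneous_on_nth[OF fieldsD(3)[OF T c]]])
next
  fix c c' w assume a: "c \<in> \<Phi>" "c' \<in> \<Phi>" "w \<in> A" "fst w \<in> fst c" "fst w \<in> fst c'"
  show "(\<chi> i k. dy i (\<lambda>u. T c' u $ k) (tchart c' w))
      = law_1_1 c c' (tchart c w) (\<chi> i k. dy i (\<lambda>u. T c u $ k) (tchart c w))"
    by (simp add: vec_eq_iff dy_transformation[OF T a])
qed

lemma half_contraction_tensor:
  assumes J: "J \<in> fields law_1_1 \<Phi> A 1"
  shows "restrict_fld \<Phi> A (\<lambda>c. half_contraction (J c)) \<in> fields law_1_0 \<Phi> A 2"
proof (rule restrict_fieldsI)
  show "smooth_ext_at (timg c A) z (half_contraction (J c))" if "c \<in> \<Phi>" "z \<in> timg c A" for c z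
    by (rule smooth_ext_at_half_contraction[OF fieldsD(2)[OF J that]])
next
  fix c assume c: "c \<in> \<Phi>"
  show "homogeneous_on (timg c A) 2 (half_contraction (J c))"
    unfolding homogeneous_on_def
  proof (clarify)
    fix x y and r :: real assume "(x, y) \<in> timg c A" "r > 0"
    then have "J c (x, r *\<^sub>R y) = r *\<^sub>R J c (x, y)"
      using fieldsD(3)[OF J c] unfolding homogeneous_on_def by auto
    then show "half_contraction (J c) (x, r *\<^sub>R y) = r powr 2 *\<^sub>R half_contraction (J c) (x, y)"
      using \<open>r > 0\<close> by (simp add: half_contraction_def vec_eq_iff sum_distrib_left power2_eq_square mult_ac)
  qed
next
  fix c c' w assume a: "c \<in> \<Phi>" "c' \<in> \<Phi>" "w \<in> A" "fst w \<in> fst c" "fst w \<in> fst c'"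
  note data = chart_change_data[OF a]
  have "half_contraction (J c') (tchart c' w) $ k
      = 1/2 * (\<Sum>i\<in>UNIV. law_1_1 c c' (tchart c w) (J c (tchart c w)) $ i $ k * snd (tchart c' w) $ i)" for k
    unfolding half_contraction_def fieldsD(4)[OF J a] by simp
  also have "\<dots> k = 1/2 * (\<Sum>d\<in>UNIV. Jac c c' (fst (tchart c w)) $ k $ d *
      (\<Sum>a\<in>UNIV. J c (tchart c w) $ a $ d * snd (tchart c w) $ a))" for k
    using law_1_1_contraction[of c' c "tchart c w" "snd (tchart c' w)" "snd (tchart c w)" "J c (tchart c w)" k] data(7)
    unfolding data(3) by simp
  finally show "half_contraction (J c') (tchart c' w) = law_1_0 c c' (tchart c w) (half_contraction (J c) (tchart c w))"
    by (simp add: vec_eq_iff law_1_0_def matrix_vector_mult_def half_contraction_def sum_divide_distrib sum_distrib_left)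
qed

lemma homogeneous_on_half_contraction:
  assumes J: "J \<in> fields law_1_1 \<Phi> A 1" and c: "c \<in> \<Phi>"
  shows "homogeneous_on (timg c A) 2 (half_contraction (J c))"
  using fieldsD(3)[OF half_contraction_tensor[OF J] c] conic_timg[OF c] c
  unfolding homogeneous_on_def conic_set_def by (simp add: case_prod_beta restrict_fld_apply)

lemma dy_restrict_fld:
  assumes "c \<in> \<Phi>" "z \<in> timg c A"
  shows "dy i (\<lambda>w. restrict_fld \<Phi> A T c w $ k) z = dy i (\<lambda>w. T c w $ k) z"
  by (rule dy_cong_open[OF open_timg[OF assms(1)] assms(2)]) (simp add: restrict_fld_apply assms(1))

text \<open>
  Both terms of the difference are traces of tensors of type (1,1): of the vertical derivative of a
  vector field and of \<open>J\<close>.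
\<close>

lemma trace_defect_invariant:
  assumes J: "J \<in> fields law_1_1 \<Phi> A 1" and a: "c \<in> \<Phi>" "c' \<in> \<Phi>" "w \<in> A" "fst w \<in> fst c" "fst w \<in> fst c'"
  shows "trace_defect (J c') (tchart c' w) = trace_defect (J c) (tchart c w)"
proof -
  note data = chart_change_data[OF a]
  define W where "W = restrict_fld \<Phi> A (\<lambda>c. half_contraction (J c))"
  have EB: "Jac c' c (transition c c' (fst (tchart c w))) ** Jac c c' (fst (tchart c w)) = mat 1"
    unfolding data(3) by (rule data(5))
  have W: "W \<in> fields law_1_0 \<Phi> A 2"
    unfolding W_def by (rule half_contraction_tensor[OF J])
  have "(\<Sum>i\<in>UNIV. dy i (\<lambda>u. W c' u $ i) (tchart c' w)) = (\<Sum>i\<in>UNIV. dy i (\<lambda>u. W c u $ i) (tchart c w))"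
    unfolding dy_transformation[OF W a] law_1_1_trace[OF EB] by simp
  moreover have "(\<Sum>i\<in>UNIV. J c' (tchart c' w) $ i $ i) = (\<Sum>i\<in>UNIV. J c (tchart c w) $ i $ i)"
    unfolding fieldsD(4)[OF J a] law_1_1_trace[OF EB] ..
  ultimately show ?thesis
    unfolding W_def trace_defect_def dy_restrict_fld[OF a(1) data(1)] dy_restrict_fld[OF a(2) data(2)] by simp
qed

lemma homogeneous_on_trace_defect:
  assumes J: "J \<in> fields law_1_1 \<Phi> A 1" and c: "c \<in> \<Phi>"
  shows "homogeneous_on (timg c A) 1 (trace_defect (J c))"
  unfolding homogeneous_on_def
proof (clarify)
  fix x y and r :: real assume z: "(x, y) \<in> timg c A" and r: "r > 0"
  have hom: "homogeneous_on (timg c A) (2 - 1) (dy a (\<lambda>w. half_contraction (J c) w $ a))" for a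
    by (rule homogeneous_on_dy[OF open_timg[OF c] conic_timg[OF c] _
          homogeneous_on_nth[OF homogeneous_on_half_contraction[OF J c]]])
      (rule smooth_ext_at_differentiable[OF open_timg[OF c] _
          smooth_ext_at_nth[OF smooth_ext_at_half_contraction[OF fieldsD(2)[OF J c]]]])
  have "dy a (\<lambda>w. half_contraction (J c) w $ a) (x, r *\<^sub>R y) = r * dy a (\<lambda>w. half_contraction (J c) w $ a) (x, y)" for a
    using hom[of a] z r unfolding homogeneous_on_def by auto
  moreover have "J c (x, r *\<^sub>R y) = r *\<^sub>R J c (x, y)"
    using fieldsD(3)[OF J c] z r unfolding homogeneous_on_def by auto
  ultimately show "trace_defect (J c) (x, r *\<^sub>R y) = r powr 1 *\<^sub>R trace_defect (J c) (x, y)"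
    using r by (simp add: trace_defect_def algebra_simps flip: sum_distrib_left)
qed

lemma potential_tensor:
  assumes J: "J \<in> fields law_1_1 \<Phi> A 1"
  shows "restrict_fld \<Phi> A (\<lambda>c. potential (J c)) \<in> fields law_1_0 \<Phi> A 2"
proof (rule restrict_fieldsI)
  show "smooth_ext_at (timg c A) z (potential (J c))" if "c \<in> \<Phi>" "z \<in> timg c A" for c z
    by (rule smooth_ext_at_potential[OF open_timg[OF that(1)] fieldsD(2)[OF J that]])
next
  fix c assume c: "c \<in> \<Phi>"
  show "homogeneous_on (timg c A) 2 (potential (J c))"
    unfolding homogeneous_on_def
  proof (clarify)
    fix x y and r :: real assume z: "(x, y) \<in> timg c A" and r: "r > 0"
    have "half_contraction (J c) (x, r *\<^sub>R y) = r\<^sup>2 *\<^sub>R half_contraction (J c) (x, y)"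
      using homogeneous_on_half_contraction[OF J c] z r unfolding homogeneous_on_def by auto
    moreover have "trace_defect (J c) (x, r *\<^sub>R y) = r * trace_defect (J c) (x, y)"
      using homogeneous_on_trace_defect[OF J c] z r unfolding homogeneous_on_def by auto
    ultimately show "potential (J c) (x, r *\<^sub>R y) = r powr 2 *\<^sub>R potential (J c) (x, y)"
      using r by (simp add: potential_def vec_eq_iff power2_eq_square algebra_simps)
  qed
next
  fix c c' w assume a: "c \<in> \<Phi>" "c' \<in> \<Phi>" "w \<in> A" "fst w \<in> fst c" "fst w \<in> fst c'"
  note data = chart_change_data[OF a]
  have vec: "potential (J c) z = half_contraction (J c) z - (1/2 * trace_defect (J c) z) *\<^sub>R snd z" for c z
    by (simp add: potential_def vec_eq_iff)
  have "half_contraction (J c') (tchart c' w) = Jac c c' (fst (tchart c w)) *v half_contraction (J c) (tchart c w)"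
    using fieldsD(4)[OF half_contraction_tensor[OF J] a] data(1,2) a(1,2)
    by (simp add: restrict_fld_apply law_1_0_def)
  then show "potential (J c') (tchart c' w) = law_1_0 c c' (tchart c w) (potential (J c) (tchart c w))"
    unfolding vec law_1_0_def trace_defect_invariant[OF J a] data(4)
    by (simp add: matrix_vector_mult_diff_distrib matrix_vector_mult_scaleR)
qed

lemma law_1_1_tensor_C:
  assumes "y' = Jac c c' (fst z) *v y"
  shows "law_1_1 c c' z (\<chi> i k. a $ i * y $ k) $ i $ k = law_0_1 c c' z a $ i * y' $ k"
proof -
  have "law_1_1 c c' z (\<chi> i k. a $ i * y $ k) $ i $ k
      = (\<Sum>d\<in>UNIV. \<Sum>e\<in>UNIV. (Jac c c' (fst z) $ k $ d * y $ d) * (Jac c' c (transition c c' (fst z)) $ e $ i * a $ e))"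
    by (simp add: law_1_1_def mult_ac)
  also have "\<dots> = y' $ k * law_0_1 c c' z a $ i"
    unfolding assms law_0_1_def matrix_vector_mult_def by (simp add: sum_product)
  finally show ?thesis by (simp add: mult.commute)
qed

lemma tensor_C_tensor:
  assumes a: "a \<in> fields law_0_1 \<Phi> A 0"
  shows "tensor_C a \<in> fields law_1_1 \<Phi> A 1"
proof (rule fieldsI)
  show "restrict_fld \<Phi> A (tensor_C a) = tensor_C a"
  proof (rule restrict_fld_fixedI)
    fix c z assume "\<not> (c \<in> \<Phi> \<and> z \<in> timg c A)"
    then have "a c z = 0" by (rule restrict_fld_fixedD[OF fieldsD(1)[OF a]])
    then show "tensor_C a c z = 0" by (simp add: tensor_C_def vec_eq_iff)
  qed
next
  fix c z assume c: "c \<in> \<Phi>" and z: "z \<in> timg c A"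
  show "smooth_ext_at (timg c A) z (tensor_C a c)"
    unfolding tensor_C_def
    by (rule smooth_ext_at_vec, rule smooth_ext_at_vec, unfold vec_lambda_beta)
      (intro smooth_ext_at_mult smooth_ext_at_snd_nth smooth_ext_at_nth[OF fieldsD(2)[OF a c z]])
next
  fix c assume c: "c \<in> \<Phi>"
  show "homogeneous_on (timg c A) 1 (tensor_C a c)"
    unfolding homogeneous_on_def
  proof (clarify)
    fix x y and r :: real assume "(x, y) \<in> timg c A" "r > 0"
    then have "a c (x, r *\<^sub>R y) = a c (x, y)"
      using fieldsD(3)[OF a c] unfolding homogeneous_on_def by auto
    then show "tensor_C a c (x, r *\<^sub>R y) = r powr 1 *\<^sub>R tensor_C a c (x, y)"
      using \<open>r > 0\<close> by (simp add: tensor_C_def vec_eq_iff)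
  qed
next
  fix c c' w assume b: "c \<in> \<Phi>" "c' \<in> \<Phi>" "w \<in> A" "fst w \<in> fst c" "fst w \<in> fst c'"
  show "tensor_C a c' (tchart c' w) = law_1_1 c c' (tchart c w) (tensor_C a c (tchart c w))"
    unfolding tensor_C_def fieldsD(4)[OF a b]
    using law_1_1_tensor_C[OF chart_change_data(4)[OF b]] by (simp add: vec_eq_iff)
qed

text \<open>As the fibre coordinates do not vanish simultaneously, \<open>A \<otimes> C\<close> determines \<open>A\<close> and its transformation law.\<close>

lemma tensor_C_factor_tensor:
  assumes Q: "Q \<in> fields law_1_1 \<Phi> A 1"
    and smooth: "\<And>c z. c \<in> \<Phi> \<Longrightarrow> z \<in> timg c A \<Longrightarrow> smooth_ext_at (timg c A) z (b c)"
    and Qb: "\<And>c z i k. c \<in> \<Phi> \<Longrightarrow> z \<in> timg c A \<Longrightarrow> Q c z $ i $ k = b c z $ i * snd z $ k"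
  shows "restrict_fld \<Phi> A b \<in> fields law_0_1 \<Phi> A 0"
proof (rule restrict_fieldsI)
  show "smooth_ext_at (timg c A) z (b c)" if "c \<in> \<Phi>" "z \<in> timg c A" for c z
    by (rule smooth[OF that])
next
  fix c assume c: "c \<in> \<Phi>"
  show "homogeneous_on (timg c A) 0 (b c)"
    unfolding homogeneous_on_def
  proof (clarify)
    fix x y and r :: real assume z: "(x, y) \<in> timg c A" and r: "r > 0"
    have rz: "(x, r *\<^sub>R y) \<in> timg c A"
      using conic_timg[OF c] z r unfolding conic_set_def by blast
    obtain k where k: "y $ k \<noteq> 0"
      using timg_snd_nonzero[OF c z] by (auto simp: vec_eq_iff)
    have "Q c (x, r *\<^sub>R y) = r *\<^sub>R Q c (x, y)"
      using fieldsD(3)[OF Q c] z r unfolding homogeneous_on_def by auto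
    then have "b c (x, r *\<^sub>R y) $ i * (r * y $ k) = r * (b c (x, y) $ i * y $ k)" for i
      using Qb[OF c rz, of i k] Qb[OF c z, of i k] by auto
    then show "b c (x, r *\<^sub>R y) = r powr 0 *\<^sub>R b c (x, y)"
      using r k by (simp add: vec_eq_iff)
  qed
next
  fix c c' w assume a: "c \<in> \<Phi>" "c' \<in> \<Phi>" "w \<in> A" "fst w \<in> fst c" "fst w \<in> fst c'"
  note data = chart_change_data[OF a]
  obtain k where k: "snd (tchart c' w) $ k \<noteq> 0"
    using timg_snd_nonzero[OF a(2) data(2)] by (auto simp: vec_eq_iff)
  have Qc: "Q c (tchart c w) = (\<chi> i k. b c (tchart c w) $ i * snd (tchart c w) $ k)"
    using Qb[OF a(1) data(1)] by (simp add: vec_eq_iff)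
  have "b c' (tchart c' w) $ i * snd (tchart c' w) $ k
      = law_0_1 c c' (tchart c w) (b c (tchart c w)) $ i * snd (tchart c' w) $ k" for i
    using Qb[OF a(2) data(2), of i k] fieldsD(4)[OF Q a] law_1_1_tensor_C[OF data(4)] unfolding Qc by auto
  then show "b c' (tchart c' w) = law_0_1 c c' (tchart c w) (b c (tchart c w))"
    using k by (simp add: vec_eq_iff)
qed

text \<open>
  For \<open>R' = R\<close> this is the linearity of a tensor law; with the law of connections as \<open>R\<close> and the
  law of tensors of type (1,1) as \<open>R'\<close>, it subtracts a tensor from a connection.
\<close>

lemma fields_diff:
  assumes S: "S \<in> fields R \<Phi> A \<alpha>" and T: "T \<in> fields R' \<Phi> A \<alpha>"
    and R: "\<And>c c' z s t. R c c' z (s - t) = R c c' z s - R' c c' z t"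
  shows "S - T \<in> fields R \<Phi> A \<alpha>"
proof (rule fieldsI)
  show "restrict_fld \<Phi> A (S - T) = S - T"
    by (rule restrict_fld_fixedI)
      (simp add: restrict_fld_fixedD[OF fieldsD(1)[OF S]] restrict_fld_fixedD[OF fieldsD(1)[OF T]])
  show "smooth_ext_at (timg c A) z ((S - T) c)" if "c \<in> \<Phi>" "z \<in> timg c A" for c z
    using smooth_ext_at_diff[OF fieldsD(2)[OF S that] fieldsD(2)[OF T that]] by (simp add: fun_diff_def)
  show "homogeneous_on (timg c A) \<alpha> ((S - T) c)" if "c \<in> \<Phi>" for c
    using fieldsD(3)[OF S that] fieldsD(3)[OF T that] unfolding homogeneous_on_def
    by (simp add: case_prod_beta scaleR_right_diff_distrib)
  show "(S - T) c' (tchart c' w) = R c c' (tchart c w) ((S - T) c (tchart c w))"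
    if "c \<in> \<Phi>" "c' \<in> \<Phi>" "w \<in> A" "fst w \<in> fst c" "fst w \<in> fst c'" for c c' w
    using fieldsD(4)[OF S that] fieldsD(4)[OF T that] by (simp add: R)
qed

lemma law_1_1_diff: "law_1_1 c c' z (s - t) = law_1_1 c c' z s - law_1_1 c c' z t"
  by (simp add: law_1_1_def vec_eq_iff right_diff_distrib sum_subtractf)

lemma law_connection_diff: "law_connection c c' z (s - t) = law_connection c c' z s - law_1_1 c c' z t"
  by (simp add: law_connection_def vec_eq_iff law_1_1_diff)

end

section \<open>Proper solutions\<close>

locale finsler_charts = conic_charts \<Phi> A for \<Phi> :: "('m::t2_space, 'n::finite) chart set" and A +
  fixes L :: "('m, 'n) tvec \<Rightarrow> real"
  assumes dimension: "CARD('n) \<ge> 2" and proper: "proper_pseudo_finsler \<Phi> A L"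
begin

abbreviation "Lc \<equiv> \<lambda>c. coord_fun \<Phi> c L"

abbreviation "Nm \<equiv> N_metric \<Phi> A L"

lemma coord_fun_tchart:
  assumes "c \<in> \<Phi>" "w \<in> tangent_bundle \<Phi>" "fst w \<in> fst c"
  shows "coord_fun \<Phi> c f (tchart c w) = f w"
  using assms by (simp add: coord_fun_def the_inv_into_f_f[OF tchart_inj[OF assms(1)]])

lemma metric_facts:
  shows "smooth_fun \<Phi> A L"
    and "\<And>w r. w \<in> A \<Longrightarrow> r > 0 \<Longrightarrow> L (scale_tvec r w) = r\<^sup>2 * L w"
    and "\<And>c z. c \<in> \<Phi> \<Longrightarrow> z \<in> timg c A \<Longrightarrow> invertible (fund (Lc c) z)"
    and "\<And>w. w \<in> A \<Longrightarrow> L w > 0"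
  using proper unfolding proper_pseudo_finsler_def pseudo_finsler_def by blast+

lemma L_smooth:
  assumes "c \<in> \<Phi>"
  shows "C_inf_on (timg c A) (Lc c)"
  by (rule smooth_on_imp_C_inf_on[OF open_timg[OF assms]])
    (use metric_facts(1) assms in \<open>simp add: smooth_fun_def\<close>)

lemma L_positive:
  assumes c: "c \<in> \<Phi>" and z: "z \<in> timg c A"
  shows "Lc c z > 0"
proof -
  obtain w where w: "w \<in> A" "fst w \<in> fst c" "z = tchart c w" using z by (rule timgE)
  then show ?thesis
    using coord_fun_tchart[OF c _ w(2), of L] metric_facts(4)[OF w(1)] A_subset by auto
qed

lemma L_homogeneous:
  assumes c: "c \<in> \<Phi>"
  shows "homogeneous_on (timg c A) 2 (Lc c)"
  unfolding homogeneous_on_def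
proof (clarify)
  fix x y and r :: real assume "(x, y) \<in> timg c A" and r: "r > 0"
  then obtain w where w: "w \<in> A" "fst w \<in> fst c" "(x, y) = tchart c w" by (elim timgE) (rule that)
  have sw: "scale_tvec r w \<in> A" using conic w r by (simp add: conic_domain_def)
  have sf: "fst (scale_tvec r w) \<in> fst c" using w by (simp add: scale_tvec_def)
  have "(x, r *\<^sub>R y) = tchart c (scale_tvec r w)"
    using w(3) by (simp add: tchart_def scale_tvec_def)
  then have "Lc c (x, r *\<^sub>R y) = L (scale_tvec r w)"
    using coord_fun_tchart[OF c _ sf, of L] sw A_subset by auto
  moreover have "Lc c (x, y) = L w"
    unfolding w(3) using w(1) A_subset by (intro coord_fun_tchart[OF c _ w(2)]) auto
  ultimately show "Lc c (x, r *\<^sub>R y) = r powr 2 *\<^sub>R Lc c (x, y)"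
    using metric_facts(2)[OF w(1) r] r by simp
qed

lemma N_metric_apply: "c \<in> \<Phi> \<Longrightarrow> z \<in> timg c A \<Longrightarrow> Nm c z $ i $ k = nl (Lc c) i k z"
  by (simp add: N_metric_def restrict_fld_apply)

text \<open>
  At a boundary point the local extension of \<open>L\<close> with invertible fundamental tensor provides a local
  extension of the connection; at a point of \<open>A\<close> the coordinate expression of \<open>L\<close> itself does.
\<close>

lemma N_metric_extendable: "extendable Nm"
  unfolding extendable_def
proof (intro ballI)
  fix c z assume c: "c \<in> \<Phi>" and z: "z \<in> timg c clA"
  obtain U F where U: "open U" "z \<in> U" "C_inf_on U F" "invertible (fund F z)"
    "\<And>u. u \<in> U \<Longrightarrow> u \<in> timg c A \<Longrightarrow> F u = Lc c u"
  proof (cases "z \<in> timg c A")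
    case True
    show ?thesis
      by (rule that[OF open_timg[OF c] True L_smooth[OF c] metric_facts(3)[OF c True]]) simp
  next
    case False
    obtain w where w: "w \<in> clA" "fst w \<in> fst c" "z = tchart c w" using z by (rule timgE)
    have "w \<notin> A" using False w unfolding timg_def by blast
    then have zb: "z \<in> timg c (clA - A)" using w unfolding timg_def by blast
    obtain L' where L': "\<forall>w\<in>A. L' w = L w"
      "\<forall>c\<in>\<Phi>. \<forall>z\<in>timg c (clA - A). \<exists>U F. open U \<and> z \<in> U \<and> (\<forall>k. C_k_on k U F) \<and>
             (\<forall>u\<in>U \<inter> timg c clA. F u = coord_fun \<Phi> c L' u) \<and> invertible (fund F z)"
      using proper unfolding proper_pseudo_finsler_def by (elim exE conjE) (rule that, assumption+)
    obtain U F where U: "open U" "z \<in> U" "\<forall>k. C_k_on k U F"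
      "\<forall>u\<in>U \<inter> timg c clA. F u = coord_fun \<Phi> c L' u" "invertible (fund F z)"
      using bspec[OF bspec[OF L'(2) c] zb] by (elim exE conjE) (rule that, assumption+)
    have "F u = Lc c u" if u: "u \<in> U" "u \<in> timg c A" for u
    proof -
      obtain a where a: "a \<in> A" "fst a \<in> fst c" "u = tchart c a" using u(2) by (rule timgE)
      have aT: "a \<in> tangent_bundle \<Phi>" using a A_subset by blast
      have "F u = coord_fun \<Phi> c L' u" using U(4) u timg_subset_closure by blast
      also have "\<dots> = L a" unfolding a(3) coord_fun_tchart[OF c aT a(2)] using L'(1) a(1) by blast
      finally show ?thesis unfolding a(3) coord_fun_tchart[OF c aT a(2)] .
    qed
    moreover have "C_inf_on U F" using U(3) by (simp add: C_inf_on_def)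
    ultimately show ?thesis using that[OF U(1,2) _ U(5)] by blast
  qed
  have "smooth_ext_at (timg c A) z (\<lambda>w. \<chi> i k. nl (Lc c) i k w)"
    by (rule smooth_ext_at_vec, rule smooth_ext_at_vec, unfold vec_lambda_beta)
      (rule smooth_ext_at_nl[OF open_timg[OF c] U(1-3,5,4)])
  then show "smooth_ext_at (timg c A) z (Nm c)"
    by (rule smooth_ext_at_cong) (simp add: N_metric_def restrict_fld_apply c)
qed

lemma N_metric_differentiable:
  assumes "c \<in> \<Phi>" "z \<in> timg c A"
  shows "(\<lambda>w. Nm c w $ i $ k) differentiable (at z)"
proof (rule smooth_ext_at_differentiable[OF open_timg[OF assms(1)] assms(2)])
  have "smooth_ext_at (timg c A) z (Nm c)"
    using N_metric_extendable assms timg_subset_closure unfolding extendable_def by blast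
  then show "smooth_ext_at (timg c A) z (\<lambda>w. Nm c w $ i $ k)"
    by (intro smooth_ext_at_nth)
qed

lemma N_metric_symmetric:
  assumes c: "c \<in> \<Phi>" and z: "z \<in> timg c A"
  shows "dy j (\<lambda>w. Nm c w $ i $ k) z = dy i (\<lambda>w. Nm c w $ j $ k) z"
proof -
  have "dy j (\<lambda>w. Nm c w $ i $ k) z = dy j (dy i (spray (Lc c) k)) z" for i j
    by (rule dy_cong_open[OF open_timg[OF c] z]) (simp add: N_metric_apply c nl_def)
  moreover have "smooth_ext_at (timg c A) z (spray (Lc c) k)"
    by (rule smooth_ext_at_spray[OF open_timg[OF c] open_timg[OF c] z L_smooth[OF c] refl metric_facts(3)[OF c z]])
  ultimately show ?thesis
    using dy_commute[OF open_timg[OF c] z, of "spray (Lc c) k" j i] by simp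
qed

lemma vdiff_symmetric:
  assumes Z: "Z \<in> fields law_1_0 \<Phi> A \<alpha>" and c: "c \<in> \<Phi>" and z: "z \<in> timg c A"
  shows "dy j (\<lambda>w. vdiff \<Phi> A Z c w $ i $ k) z = dy i (\<lambda>w. vdiff \<Phi> A Z c w $ j $ k) z"
proof -
  have "dy j (\<lambda>w. vdiff \<Phi> A Z c w $ i $ k) z = dy j (dy i (\<lambda>u. Z c u $ k)) z" for i j
    by (rule dy_cong_open[OF open_timg[OF c] z]) (simp add: vdiff_apply c)
  then show ?thesis
    using dy_commute[OF open_timg[OF c] z smooth_ext_at_nth[OF fieldsD(2)[OF Z c z]], of j i k] by simp
qed

lemma affine_equation_radial_part:
  assumes Z: "Z \<in> fields law_1_0 \<Phi> A 2" and a: "a \<in> fields law_0_1 \<Phi> A 0"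
    and c: "c \<in> \<Phi>" and z: "z \<in> timg c A"
  shows "affine_equation (Lc c) ((vdiff \<Phi> A Z + tensor_C a) c) z \<longleftrightarrow> affine_equation (Lc c) (vdiff \<Phi> A Z c) z"
proof (rule affine_equation_radial_invariance[OF open_timg[OF c] z])
  show "(\<Sum>b\<in>UNIV. y_low (Lc c) b z * snd z $ b) = Lc c z"
    by (rule y_low_contraction[OF open_timg[OF c] conic_timg[OF c] L_smooth[OF c] L_homogeneous[OF c] z])
  show "(\<Sum>b\<in>UNIV. mean_cartan (Lc c) b z * snd z $ b) = 0"
    by (rule mean_cartan_contraction[OF open_timg[OF c] conic_timg[OF c] L_smooth[OF c] L_homogeneous[OF c] z])
  show "Lc c z \<noteq> 0" using L_positive[OF c z] by simp
  show "(\<lambda>w. vdiff \<Phi> A Z c w $ i $ j) differentiable (at z)" for i j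
    by (rule fields_entry_differentiable[OF vdiff_tensor[OF Z] c z])
  show "(\<lambda>w. a c w $ i) differentiable (at z)" for i
    by (rule fields_component_differentiable[OF a c z])
  show "homogeneous_on (timg c A) 0 (a c)"
    by (rule fieldsD(3)[OF a c])
  show "(vdiff \<Phi> A Z + tensor_C a) c w $ i $ j = vdiff \<Phi> A Z c w $ i $ j + a c w $ i * snd w $ j" for w i j
    by (simp add: tensor_C_def)
qed

lemma connections_A: "connections \<Phi> A = fields law_connection \<Phi> A 1"
  by (rule connections_eq[OF A_subset(2)])

lemma SolE:
  assumes "N \<in> Sol \<Phi> A L"
  obtains J where "N \<in> fields law_connection \<Phi> A 1" "J \<in> fields law_1_1 \<Phi> A 1" "N = Nm + J"
    "\<And>c z. c \<in> \<Phi> \<Longrightarrow> z \<in> timg c A \<Longrightarrow> affine_equation (Lc c) (J c) z"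
  using assms unfolding Sol_def connections_A tensors_1_1_eq by blast

text \<open>
  The potential of \<open>J\<close> is a vector field, and what remains of \<open>J\<close> after subtracting its vertical
  derivative is radial by the affine equation.
\<close>

lemma Sol_decomposition:
  assumes "N \<in> Sol \<Phi> A L"
  shows "\<exists>Z\<in>fields law_1_0 \<Phi> A 2. \<exists>a\<in>fields law_0_1 \<Phi> A 0. N = Nm + vdiff \<Phi> A Z + tensor_C a"
proof -
  obtain J where J: "J \<in> fields law_1_1 \<Phi> A 1" and N: "N = Nm + J"
    and eq: "\<And>c z. c \<in> \<Phi> \<Longrightarrow> z \<in> timg c A \<Longrightarrow> affine_equation (Lc c) (J c) z"
    using assms by (rule SolE) (rule that)
  define Z where "Z = restrict_fld \<Phi> A (\<lambda>c. potential (J c))"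
  have Z: "Z \<in> fields law_1_0 \<Phi> A 2"
    unfolding Z_def by (rule potential_tensor[OF J])
  define Q where "Q = J - vdiff \<Phi> A Z"
  have V: "vdiff \<Phi> A Z \<in> fields law_1_1 \<Phi> A 1"
    using vdiff_tensor[OF Z] by simp
  have Q: "Q \<in> fields law_1_1 \<Phi> A 1"
    unfolding Q_def by (rule fields_diff[OF J V law_1_1_diff])
  have Qz: "Q c z $ i $ k = radial_covector (J c) z $ i * snd z $ k" if c: "c \<in> \<Phi>" and z: "z \<in> timg c A" for c z i k
  proof -
    have "J c z $ i $ k = dy i (\<lambda>w. potential (J c) w $ k) z + radial_covector (J c) z $ i * snd z $ k"
      by (rule affine_equation_imp_decomposition[OF dimension open_timg[OF c] timg_snd_nonzero[OF c]
            fieldsD(2)[OF J c] fieldsD(3)[OF J c] eq[OF c] z])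
    moreover have "vdiff \<Phi> A Z c z $ i $ k = dy i (\<lambda>w. potential (J c) w $ k) z"
      unfolding vdiff_apply[OF c z] Z_def by (rule dy_restrict_fld[OF c z])
    ultimately show ?thesis by (simp add: Q_def)
  qed
  define a where "a = restrict_fld \<Phi> A (\<lambda>c. radial_covector (J c))"
  have a: "a \<in> fields law_0_1 \<Phi> A 0"
    unfolding a_def
    by (rule tensor_C_factor_tensor[OF Q _ Qz])
      (rule smooth_ext_at_radial_covector[OF open_timg fieldsD(2)[OF J] timg_snd_nonzero])
  have "Q = tensor_C a"
  proof (rule fields_eqI[OF fieldsD(1)[OF Q] fieldsD(1)[OF tensor_C_tensor[OF a]]])
    fix c z assume c: "c \<in> \<Phi>" and z: "z \<in> timg c A"
    then show "Q c z = tensor_C a c z"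
      using Qz[OF c z] by (simp add: tensor_C_def a_def restrict_fld_apply vec_eq_iff)
  qed
  then have "N = Nm + vdiff \<Phi> A Z + tensor_C a"
    using N unfolding Q_def by (simp add: algebra_simps)
  with Z a show ?thesis by blast
qed

lemma decomposition_parts:
  assumes Z: "Z \<in> fields law_1_0 \<Phi> A 2" and a: "a \<in> fields law_0_1 \<Phi> A 0"
    and c: "c \<in> \<Phi>" and z: "z \<in> timg c A"
  shows "potential ((vdiff \<Phi> A Z + tensor_C a) c) z = Z c z"
    and "radial_covector ((vdiff \<Phi> A Z + tensor_C a) c) z = a c z"
proof -
  have J: "(vdiff \<Phi> A Z + tensor_C a) c w $ i $ j = dy i (\<lambda>u. Z c u $ j) w + a c w $ i * snd w $ j"
    if "w \<in> timg c A" for w i j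
    using vdiff_apply[OF c that] by (simp add: tensor_C_def)
  note rec = decomposition_recovers[OF dimension open_timg[OF c] timg_snd_nonzero[OF c]
      fields_component_differentiable[OF Z c] fieldsD(3)[OF Z c]
      fields_component_differentiable[OF a c] fieldsD(3)[OF a c] J z]
  show "potential ((vdiff \<Phi> A Z + tensor_C a) c) z = Z c z" by (rule rec(1))
  show "radial_covector ((vdiff \<Phi> A Z + tensor_C a) c) z = a c z" by (rule rec(2))
qed

lemma decomposition_unique:
  assumes Z: "Z \<in> fields law_1_0 \<Phi> A 2" "Z' \<in> fields law_1_0 \<Phi> A 2"
    and a: "a \<in> fields law_0_1 \<Phi> A 0" "a' \<in> fields law_0_1 \<Phi> A 0"
    and eq: "vdiff \<Phi> A Z + tensor_C a = vdiff \<Phi> A Z' + tensor_C a'"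
  shows "Z = Z'"
  by (rule fields_eqI[OF fieldsD(1)[OF Z(1)] fieldsD(1)[OF Z(2)]])
    (metis decomposition_parts(1)[OF Z(1) a(1)] decomposition_parts(1)[OF Z(2) a(2)] eq)

lemma sym_proj_eq:
  assumes Z: "Z \<in> fields law_1_0 \<Phi> A 2" and a: "a \<in> fields law_0_1 \<Phi> A 0"
  shows "sym_proj \<Phi> A L (Nm + vdiff \<Phi> A Z + tensor_C a) = Nm + vdiff \<Phi> A Z"
  unfolding sym_proj_def tensors_1_0_eq tensors_0_1_eq
proof (rule the_equality)
  show "\<exists>Z'\<in>fields law_1_0 \<Phi> A 2. \<exists>a'\<in>fields law_0_1 \<Phi> A 0.
      Nm + vdiff \<Phi> A Z + tensor_C a = Nm + vdiff \<Phi> A Z' + tensor_C a' \<and> Nm + vdiff \<Phi> A Z = Nm + vdiff \<Phi> A Z'"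
    using Z a by blast
next
  fix S assume "\<exists>Z'\<in>fields law_1_0 \<Phi> A 2. \<exists>a'\<in>fields law_0_1 \<Phi> A 0.
      Nm + vdiff \<Phi> A Z + tensor_C a = Nm + vdiff \<Phi> A Z' + tensor_C a' \<and> S = Nm + vdiff \<Phi> A Z'"
  then obtain Z' a' where Z': "Z' \<in> fields law_1_0 \<Phi> A 2" "a' \<in> fields law_0_1 \<Phi> A 0"
    and eq: "Nm + vdiff \<Phi> A Z + tensor_C a = Nm + vdiff \<Phi> A Z' + tensor_C a'" and S: "S = Nm + vdiff \<Phi> A Z'"
    by blast
  have "vdiff \<Phi> A Z + tensor_C a = vdiff \<Phi> A Z' + tensor_C a'"
    using eq by (simp add: add.assoc)
  then have "Z = Z'" by (rule decomposition_unique[OF Z Z'(1) a Z'(2)])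
  then show "S = Nm + vdiff \<Phi> A Z" using S by simp
qed

text \<open>
  Subtracting the tensor \<open>A \<otimes> C\<close> from the connection \<open>N\<close> leaves a connection, and the affine
  equation is invariant under this. Both \<open>N\<^sup>L\<close> and \<open>\<partial>Z\<close> are vertical derivatives of smooth functions,
  hence symmetric.
\<close>

lemma symmetric_part_in_Sol_sym:
  assumes N: "Nm + vdiff \<Phi> A Z + tensor_C a \<in> Sol \<Phi> A L"
    and Z: "Z \<in> fields law_1_0 \<Phi> A 2" and a: "a \<in> fields law_0_1 \<Phi> A 0"
  shows "Nm + vdiff \<Phi> A Z \<in> Sol_sym \<Phi> A L"
proof -
  have V: "vdiff \<Phi> A Z \<in> fields law_1_1 \<Phi> A 1"
    using vdiff_tensor[OF Z] by simp
  obtain J where Nc: "Nm + vdiff \<Phi> A Z + tensor_C a \<in> fields law_connection \<Phi> A 1"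
    and J: "Nm + vdiff \<Phi> A Z + tensor_C a = Nm + J"
    and eq: "\<And>c z. c \<in> \<Phi> \<Longrightarrow> z \<in> timg c A \<Longrightarrow> affine_equation (Lc c) (J c) z"
    using N by (rule SolE) (rule that)
  have J': "J = vdiff \<Phi> A Z + tensor_C a"
    using J by (simp add: add.assoc)
  have "Nm + vdiff \<Phi> A Z + tensor_C a - tensor_C a \<in> fields law_connection \<Phi> A 1"
    by (rule fields_diff[OF Nc tensor_C_tensor[OF a] law_connection_diff])
  then have "Nm + vdiff \<Phi> A Z \<in> connections \<Phi> A"
    unfolding connections_A by simp
  moreover have "affine_equation (Lc c) (vdiff \<Phi> A Z c) z" if "c \<in> \<Phi>" "z \<in> timg c A" for c z
    using eq[OF that] affine_equation_radial_part[OF Z a that] unfolding J' by simp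
  ultimately have "Nm + vdiff \<Phi> A Z \<in> Sol \<Phi> A L"
    using V unfolding Sol_def tensors_1_1_eq by blast
  moreover have "dy j (\<lambda>w. (Nm + vdiff \<Phi> A Z) c w $ i $ k) z = dy i (\<lambda>w. (Nm + vdiff \<Phi> A Z) c w $ j $ k) z"
    if c: "c \<in> \<Phi>" and z: "z \<in> timg c A" for c z i j k
    using N_metric_symmetric[OF c z, of j i k] vdiff_symmetric[OF Z c z, of j i k]
    by (simp add: dy_add[OF N_metric_differentiable[OF c z] fields_entry_differentiable[OF V c z]])
  ultimately show ?thesis unfolding Sol_sym_def by blast
qed

text \<open>A symmetric solution differs from the metric connection by the derivative of half of its contraction.\<close>

lemma Sol_sym_decomposition:
  assumes N: "N \<in> Sol_sym \<Phi> A L"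
  shows "\<exists>Z\<in>fields law_1_0 \<Phi> A 2. N = Nm + vdiff \<Phi> A Z"
proof -
  have NS: "N \<in> Sol \<Phi> A L" using N unfolding Sol_sym_def by blast
  obtain J where J: "J \<in> fields law_1_1 \<Phi> A 1" and NJ: "N = Nm + J" using NS by (rule SolE) (rule that)
  define Z where "Z = restrict_fld \<Phi> A (\<lambda>c. half_contraction (J c))"
  have Z: "Z \<in> fields law_1_0 \<Phi> A 2"
    unfolding Z_def by (rule half_contraction_tensor[OF J])
  have "J = vdiff \<Phi> A Z"
  proof (rule fields_eqI[OF fieldsD(1)[OF J] fieldsD(1)[OF vdiff_tensor[OF Z]]])
    fix c z assume c: "c \<in> \<Phi>" and z: "z \<in> timg c A"
    have "dy j (\<lambda>w. N c w $ i $ k) z = dy i (\<lambda>w. N c w $ j $ k) z" for i j k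
      using N c z unfolding Sol_sym_def by blast
    moreover have "dy j (\<lambda>w. N c w $ i $ k) z = dy j (\<lambda>w. Nm c w $ i $ k) z + dy j (\<lambda>w. J c w $ i $ k) z" for i j k
      unfolding NJ using dy_add[OF N_metric_differentiable[OF c z] fields_entry_differentiable[OF J c z]] by simp
    ultimately have sym: "dy j (\<lambda>w. J c w $ i $ k) z = dy i (\<lambda>w. J c w $ j $ k) z" for i j k
      using N_metric_symmetric[OF c z, of j i k] by (metis add_left_cancel)
    have "J c z $ i $ k = dy i (\<lambda>w. half_contraction (J c) w $ k) z" for i k
      by (rule symmetric_imp_vertical_derivative[OF fields_entry_differentiable[OF J c z] fieldsD(3)[OF J c] z sym])
    then show "J c z = vdiff \<Phi> A Z c z"
      unfolding vec_eq_iff vdiff_apply[OF c z] Z_def dy_restrict_fld[OF c z] by blast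
  qed
  then show ?thesis using Z NJ by blast
qed

lemma zero_covector: "0 \<in> fields law_0_1 \<Phi> A 0"
proof (rule fieldsI)
  show "restrict_fld \<Phi> A 0 = 0" by (rule restrict_fld_fixedI) simp
  show "smooth_ext_at (timg c A) z (0 c)" for c z
    by (simp add: zero_fun_def smooth_ext_at_const)
qed (simp_all add: homogeneous_on_def law_0_1_def vec_eq_iff)

lemma tensor_C_zero: "tensor_C 0 = 0"
  by (simp add: tensor_C_def fun_eq_iff vec_eq_iff)

lemma Sol_proper_iff:
  assumes "N \<in> Sol \<Phi> A L"
  shows "N \<in> Sol_proper \<Phi> A L \<longleftrightarrow> extendable N"
proof -
  have "N \<in> fields law_connection \<Phi> A 1" using assms by (rule SolE)
  then show ?thesis
    using assms extends_in_iff_extendable[OF _ law_connection_continuous]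
    unfolding Sol_proper_def connections_eq[OF clA_subset(2)] by blast
qed

lemma extendable_add:
  assumes "extendable S" "extendable T"
  shows "extendable (S + T)"
  unfolding extendable_def
proof (intro ballI)
  fix c z assume "c \<in> \<Phi>" "z \<in> timg c clA"
  then show "smooth_ext_at (timg c A) z ((S + T) c)"
    using smooth_ext_at_add[of "timg c A" z "S c" "T c"] assms unfolding extendable_def by (simp add: plus_fun_def)
qed

lemma extendable_diff:
  assumes "extendable S" "extendable T"
  shows "extendable (S - T)"
  unfolding extendable_def
proof (intro ballI)
  fix c z assume "c \<in> \<Phi>" "z \<in> timg c clA"
  then show "smooth_ext_at (timg c A) z ((S - T) c)"
    using smooth_ext_at_diff[of "timg c A" z "S c" "T c"] assms unfolding extendable_def by (simp add: fun_diff_def)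
qed

lemma extendable_vdiff:
  assumes "extendable Z"
  shows "extendable (vdiff \<Phi> A Z)"
  using assms smooth_ext_at_vdiff unfolding extendable_def by blast

lemma extendable_tensor_C:
  assumes "extendable a"
  shows "extendable (tensor_C a)"
  unfolding extendable_def
proof (intro ballI)
  fix c z assume "c \<in> \<Phi>" "z \<in> timg c clA"
  then have a: "smooth_ext_at (timg c A) z (a c)" using assms unfolding extendable_def by blast
  show "smooth_ext_at (timg c A) z (tensor_C a c)"
    unfolding tensor_C_def
    by (rule smooth_ext_at_vec, rule smooth_ext_at_vec, unfold vec_lambda_beta)
      (intro smooth_ext_at_mult smooth_ext_at_snd_nth smooth_ext_at_nth[OF a])
qed

text \<open>
  The parts of \<open>J\<close> are obtained from \<open>J\<close> by operations that preserve smooth extendability: algebraic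
  operations, vertical derivatives and the division by \<open>|y|\<^sup>2\<close>, as \<open>y \<noteq> 0\<close> on the closure.
\<close>

lemma extendable_decomposition:
  assumes Z: "Z \<in> fields law_1_0 \<Phi> A 2" and a: "a \<in> fields law_0_1 \<Phi> A 0"
  shows "extendable (Nm + vdiff \<Phi> A Z + tensor_C a) \<longleftrightarrow> extendable Z \<and> extendable a"
proof
  assume "extendable Z \<and> extendable a"
  then show "extendable (Nm + vdiff \<Phi> A Z + tensor_C a)"
    by (intro extendable_add extendable_vdiff extendable_tensor_C N_metric_extendable) blast+
next
  assume "extendable (Nm + vdiff \<Phi> A Z + tensor_C a)"
  then have "extendable (Nm + vdiff \<Phi> A Z + tensor_C a - Nm)"
    using N_metric_extendable by (rule extendable_diff)
  then have J: "extendable (vdiff \<Phi> A Z + tensor_C a)" (is "extendable ?J")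
    by (simp add: add.assoc)
  have "smooth_ext_at (timg c A) z (Z c) \<and> smooth_ext_at (timg c A) z (a c)"
    if c: "c \<in> \<Phi>" and z: "z \<in> timg c clA" for c z
  proof
    have Jz: "smooth_ext_at (timg c A) z (?J c)"
      using J c z unfolding extendable_def by blast
    show "smooth_ext_at (timg c A) z (Z c)"
      by (rule smooth_ext_at_cong[OF smooth_ext_at_potential[OF open_timg[OF c] Jz] decomposition_parts(1)[OF Z a c]])
    have "snd z \<noteq> 0" using z unfolding timg_closure[OF c] by blast
    then show "smooth_ext_at (timg c A) z (a c)"
      by (rule smooth_ext_at_cong[OF smooth_ext_at_radial_covector[OF open_timg[OF c] Jz] decomposition_parts(2)[OF Z a c]])
  qed
  then show "extendable Z \<and> extendable a" unfolding extendable_def by blast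
qed

lemma proper_iff_parts_extend:
  assumes N: "N \<in> Sol \<Phi> A L" and Z: "Z \<in> tensors_1_0 \<Phi> A 2" and a: "a \<in> tensors_0_1 \<Phi> A 0"
    and eq: "N = Nm + vdiff \<Phi> A Z + tensor_C a"
  shows "N \<in> Sol_proper \<Phi> A L \<longleftrightarrow>
    extends_in \<Phi> A (tensors_1_0 \<Phi> clA 2) Z \<and> extends_in \<Phi> A (tensors_0_1 \<Phi> clA 0) a"
proof -
  have Z': "Z \<in> fields law_1_0 \<Phi> A 2" and a': "a \<in> fields law_0_1 \<Phi> A 0"
    using Z a unfolding tensors_1_0_eq tensors_0_1_eq .
  show ?thesis
    unfolding Sol_proper_iff[OF N] tensors_1_0_eq tensors_0_1_eq
      extends_in_iff_extendable[OF Z' law_1_0_continuous] extends_in_iff_extendable[OF a' law_0_1_continuous]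
    unfolding eq by (rule extendable_decomposition[OF Z' a'])
qed

lemma sym_proj_maps: "sym_proj \<Phi> A L \<in> Sol \<Phi> A L \<rightarrow> Sol_sym \<Phi> A L"
proof
  fix N assume N: "N \<in> Sol \<Phi> A L"
  then obtain Z a where Z: "Z \<in> fields law_1_0 \<Phi> A 2" and a: "a \<in> fields law_0_1 \<Phi> A 0"
    and eq: "N = Nm + vdiff \<Phi> A Z + tensor_C a"
    using Sol_decomposition by blast
  show "sym_proj \<Phi> A L N \<in> Sol_sym \<Phi> A L"
    using symmetric_part_in_Sol_sym[OF _ Z a] N unfolding eq sym_proj_eq[OF Z a] by blast
qed

lemma sym_proj_Sol_sym:
  assumes "N \<in> Sol_sym \<Phi> A L"
  shows "sym_proj \<Phi> A L N = N"
proof -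
  obtain Z where Z: "Z \<in> fields law_1_0 \<Phi> A 2" "N = Nm + vdiff \<Phi> A Z"
    using Sol_sym_decomposition[OF assms] by blast
  show ?thesis
    using sym_proj_eq[OF Z(1) zero_covector] unfolding tensor_C_zero Z(2) by simp
qed

lemma sym_proj_proper:
  assumes "N \<in> Sol_proper \<Phi> A L"
  shows "sym_proj \<Phi> A L N \<in> Sol_proper \<Phi> A L"
proof -
  have N: "N \<in> Sol \<Phi> A L" using assms unfolding Sol_proper_def by blast
  then obtain Z a where Z: "Z \<in> fields law_1_0 \<Phi> A 2" and a: "a \<in> fields law_0_1 \<Phi> A 0"
    and eq: "N = Nm + vdiff \<Phi> A Z + tensor_C a"
    using Sol_decomposition by blast
  have "extendable Z"
    using assms Sol_proper_iff[OF N] extendable_decomposition[OF Z a] unfolding eq by blast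
  then have "extendable (Nm + vdiff \<Phi> A Z)"
    by (intro extendable_add extendable_vdiff N_metric_extendable)
  moreover have "Nm + vdiff \<Phi> A Z \<in> Sol \<Phi> A L"
    using symmetric_part_in_Sol_sym[OF _ Z a] N unfolding eq Sol_sym_def by blast
  ultimately show ?thesis
    unfolding eq sym_proj_eq[OF Z a] using Sol_proper_iff by blast
qed

lemma sym_proj_image: "sym_proj \<Phi> A L ` Sol_proper \<Phi> A L = Sol_sym \<Phi> A L \<inter> Sol_proper \<Phi> A L"
proof (intro equalityI subsetI)
  fix S assume "S \<in> sym_proj \<Phi> A L ` Sol_proper \<Phi> A L"
  then obtain N where N: "N \<in> Sol_proper \<Phi> A L" "S = sym_proj \<Phi> A L N" by blast
  then have "N \<in> Sol \<Phi> A L" unfolding Sol_proper_def by blast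
  then show "S \<in> Sol_sym \<Phi> A L \<inter> Sol_proper \<Phi> A L"
    using sym_proj_proper[OF N(1)] sym_proj_maps unfolding N(2) by blast
next
  fix S assume S: "S \<in> Sol_sym \<Phi> A L \<inter> Sol_proper \<Phi> A L"
  then have "S = sym_proj \<Phi> A L S" by (simp add: sym_proj_Sol_sym)
  then show "S \<in> sym_proj \<Phi> A L ` Sol_proper \<Phi> A L" using S by blast
qed

end

theorem proposition5p2:
  fixes \<Phi> :: "('m::{t2_space, second_countable_topology}, 'n::finite) chart set"
    and A :: "('m, 'n) tvec set"
    and L :: "('m, 'n) tvec \<Rightarrow> real"
  assumes "CARD('n) \<ge> 2"
    and "smooth_atlas \<Phi>"
    and "connected (UNIV :: 'm set)"
    and "conic_domain \<Phi> A"
    and "proper_pseudo_finsler \<Phi> A L"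
  shows "(\<forall>N\<in>Sol \<Phi> A L. \<forall>Z\<in>tensors_1_0 \<Phi> A 2. \<forall>\<A>\<in>tensors_0_1 \<Phi> A 0.
            N = N_metric \<Phi> A L + vdiff \<Phi> A Z + tensor_C \<A> \<longrightarrow>
            (N \<in> Sol_proper \<Phi> A L \<longleftrightarrow>
               extends_in \<Phi> A (tensors_1_0 \<Phi> (slit_closure \<Phi> A) 2) Z \<and>
               extends_in \<Phi> A (tensors_0_1 \<Phi> (slit_closure \<Phi> A) 0) \<A>)) \<and>
         sym_proj \<Phi> A L \<in> Sol \<Phi> A L \<rightarrow> Sol_sym \<Phi> A L \<and>
         sym_proj \<Phi> A L ` Sol_proper \<Phi> A L = Sol_sym \<Phi> A L \<inter> Sol_proper \<Phi> A L"
proof -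
  interpret finsler_charts \<Phi> A L
    by unfold_locales (rule assms)+
  show ?thesis
    using proper_iff_parts_extend sym_proj_maps sym_proj_image by blast
qed

end
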